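(* The problem Colored Cube Isomorphism is $\mathsf{GI}$-complete, even when restricted to instances in which both input colorings are of the form $[n]^d\to[2]$.
   Context: Let $[n]=\{0,\dots,n-1\}$. The combinatorial cube $n^d$ is the point set $[n]^d$. A set $\ell\subseteq[n]^d$ of $n$ distinct points is a line if its points can be ordered as $(q^1,\dots,q^n)$ such that for every coordinate $j$ the sequence of $j$-th coordinates $(q^1_j,\dots,q^n_j)$ is strictly increasing, strictly decreasing, or constant, and at least one such sequence is not constant. $H_n^d$ is the hypergraph with vertex set $[n]^d$ whose edges are the lines. An automorphism of $n^d$ is a permutation $P$ of $[n]^d$ mapping every line onto a line. Colored Cube Isomorphism: given $n,d$ (i.e., the hypergraph $H_n^d$) and two colorings $s_1,s_2:[n]^d\to[k]$, decide whether there is an automorphism $P$ of $n^d$ with $s_1(v)=s_2(P(v))$ for every $v\in[n]^d$. $\mathsf{GI}$ is the class of decision problems that have a polynomial-time reduction to Graph Isomorphism (given two graphs, decide whether they are isomorphic); a problem is $\mathsf{GI}$-complete if it lies in $\mathsf{GI}$ and Graph Isomorphism polynomial-time reduces to it. *)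

theory Defs
  imports "HOL-Computational_Algebra.Polynomial"
begin

section \<open>Polynomial-time computation\<close>

text \<open>
  The machine model is the random access machine with unit-cost addition and truncated
  subtraction on natural numbers (and no multiplication), programmed with structured control
  flow.  One step lengthens the numbers in use by at most a constant number of bits, so
  polynomial time on this machine is polynomial time on Turing machines.

  Expressions only occur inside a fixed program, hence have constant size; evaluating one is
  charged as part of the single step of the command containing it.
\<close>

datatype aexp =
    Const nat
  | Reg nat
  | Mem aexp
  | InBit aexp
  | InLen
  | Add aexp aexp
  | Sub aexp aexp

datatype com =
    Skip
  | Assign nat aexp
  | Store aexp aexp
  | Emit aexp
  | Seq com com
  | IfNZ aexp com com
  | WhileNZ aexp com

record ram_state =
  reg :: "nat \<Rightarrow> nat"
  mem :: "nat \<Rightarrow> nat"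
  out :: "bool list"

primrec aval :: "bool list \<Rightarrow> ram_state \<Rightarrow> aexp \<Rightarrow> nat" where
  "aval w s (Const c) = c"
| "aval w s (Reg x) = reg s x"
| "aval w s (Mem a) = mem s (aval w s a)"
| "aval w s (InBit a) = (if aval w s a < length w \<and> w ! aval w s a then 1 else 0)"
| "aval w s InLen = length w"
| "aval w s (Add a b) = aval w s a + aval w s b"
| "aval w s (Sub a b) = aval w s a - aval w s b"

text \<open>
  \<open>exec w c s t s'\<close>: with the read-only input \<open>w\<close>, program \<open>c\<close> started in
  state \<open>s\<close> halts after \<open>t\<close> steps in state \<open>s'\<close>.  The output is written one bit per
  step, so it is never longer than the running time.
\<close>

inductive exec :: "bool list \<Rightarrow> com \<Rightarrow> ram_state \<Rightarrow> nat \<Rightarrow> ram_state \<Rightarrow> bool" for w where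
  exec_Skip: "exec w Skip s 1 s"
| exec_Assign: "exec w (Assign x a) s 1 (s\<lparr>reg := (reg s)(x := aval w s a)\<rparr>)"
| exec_Store: "exec w (Store a b) s 1 (s\<lparr>mem := (mem s)(aval w s a := aval w s b)\<rparr>)"
| exec_Emit: "exec w (Emit a) s 1 (s\<lparr>out := out s @ [aval w s a \<noteq> 0]\<rparr>)"
| exec_Seq: "exec w c s t s' \<Longrightarrow> exec w c' s' t' s'' \<Longrightarrow> exec w (Seq c c') s (t + t') s''"
| exec_IfTrue: "aval w s a \<noteq> 0 \<Longrightarrow> exec w c s t s' \<Longrightarrow> exec w (IfNZ a c c') s (t + 1) s'"
| exec_IfFalse: "aval w s a = 0 \<Longrightarrow> exec w c' s t s' \<Longrightarrow> exec w (IfNZ a c c') s (t + 1) s'"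
| exec_WhileFalse: "aval w s a = 0 \<Longrightarrow> exec w (WhileNZ a c) s 1 s"
| exec_WhileTrue: "aval w s a \<noteq> 0 \<Longrightarrow> exec w c s t s' \<Longrightarrow> exec w (WhileNZ a c) s' t' s''
    \<Longrightarrow> exec w (WhileNZ a c) s (t + t' + 1) s''"

definition init_state :: ram_state where
  "init_state = \<lparr>reg = (\<lambda>_. 0), mem = (\<lambda>_. 0), out = []\<rparr>"

definition poly_time_computable :: "(bool list \<Rightarrow> bool list) \<Rightarrow> bool" where
  "poly_time_computable f \<longleftrightarrow>
     (\<exists>c. \<exists>p :: nat poly. \<forall>w. \<exists>t s.
        exec w c init_state t s \<and> out s = f w \<and> t \<le> poly p (length w))"

text \<open>
  A decision problem is the set of binary words encoding its yes-instances.
\<close>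

type_synonym problem = "bool list set"

definition poly_time_reducible :: "problem \<Rightarrow> problem \<Rightarrow> bool" (infix "\<le>\<^sub>p" 50) where
  "A \<le>\<^sub>p B \<longleftrightarrow> (\<exists>f. poly_time_computable f \<and> (\<forall>w. w \<in> A \<longleftrightarrow> f w \<in> B))"


section \<open>Graph Isomorphism\<close>

type_synonym graph = "nat \<times> nat set set"

definition simple_graph :: "graph \<Rightarrow> bool" where
  "simple_graph = (\<lambda>(n, E). \<forall>e\<in>E. \<exists>u v. u < n \<and> v < n \<and> u \<noteq> v \<and> e = {u, v})"

definition graph_isomorphic :: "graph \<Rightarrow> graph \<Rightarrow> bool" where
  "graph_isomorphic = (\<lambda>(n, E) (m, F).
     \<exists>\<pi>. bij_betw \<pi> {..<n} {..<m} \<and>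
         (\<forall>u<n. \<forall>v<n. {u, v} \<in> E \<longleftrightarrow> {\<pi> u, \<pi> v} \<in> F))"

definition enc_unary :: "nat \<Rightarrow> bool list" where
  "enc_unary n = replicate n True @ [False]"

text \<open>The vertex count followed by the strict triangle of the adjacency matrix.\<close>

definition enc_graph :: "graph \<Rightarrow> bool list" where
  "enc_graph = (\<lambda>(n, E).
     enc_unary n @ concat (map (\<lambda>v. map (\<lambda>u. {u, v} \<in> E) [0..<v]) [0..<n]))"

definition Graph_Isomorphism :: problem where
  "Graph_Isomorphism =
     {enc_graph G @ enc_graph H | G H.
        simple_graph G \<and> simple_graph H \<and> graph_isomorphic G H}"

definition GI :: "problem set" where
  "GI = {A. A \<le>\<^sub>p Graph_Isomorphism}"

definition GI_complete :: "problem \<Rightarrow> bool" where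
  "GI_complete A \<longleftrightarrow> A \<in> GI \<and> Graph_Isomorphism \<le>\<^sub>p A"


section \<open>Colored Cube Isomorphism\<close>

definition cube :: "nat \<Rightarrow> nat \<Rightarrow> nat list set" where
  "cube n d = {p. length p = d \<and> set p \<subseteq> {..<n}}"

definition cube_line :: "nat \<Rightarrow> nat \<Rightarrow> nat list set \<Rightarrow> bool" where
  "cube_line n d l \<longleftrightarrow>
     l \<subseteq> cube n d \<and>
     (\<exists>qs. distinct qs \<and> length qs = n \<and> set qs = l \<and>
        (\<forall>j<d. sorted_wrt (<) (map (\<lambda>q. q ! j) qs) \<or>
               sorted_wrt (>) (map (\<lambda>q. q ! j) qs) \<or>
               (\<forall>q\<in>set qs. \<forall>q'\<in>set qs. q ! j = q' ! j)) \<and>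
        (\<exists>j<d. \<not> (\<forall>q\<in>set qs. \<forall>q'\<in>set qs. q ! j = q' ! j)))"

definition cube_automorphism :: "nat \<Rightarrow> nat \<Rightarrow> (nat list \<Rightarrow> nat list) \<Rightarrow> bool" where
  "cube_automorphism n d P \<longleftrightarrow>
     bij_betw P (cube n d) (cube n d) \<and> (\<forall>l. cube_line n d l \<longrightarrow> cube_line n d (P ` l))"

definition colored_cubes_isomorphic ::
    "nat \<Rightarrow> nat \<Rightarrow> (nat list \<Rightarrow> nat) \<Rightarrow> (nat list \<Rightarrow> nat) \<Rightarrow> bool" where
  "colored_cubes_isomorphic n d s\<^sub>1 s\<^sub>2 \<longleftrightarrow>
     (\<exists>P. cube_automorphism n d P \<and> (\<forall>v\<in>cube n d. s\<^sub>1 v = s\<^sub>2 (P v)))"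

text \<open>
  Self-delimiting binary numerals, least significant bit first: each digit is preceded by
  \<^const>\<open>True\<close>, and \<^const>\<open>False\<close> marks the end.
\<close>

fun enc_binary :: "nat \<Rightarrow> bool list" where
  "enc_binary n = (if n = 0 then [False] else True # odd n # enc_binary (n div 2))"

declare enc_binary.simps [simp del]

text \<open>\<^term>\<open>List.n_lists d [0..<n]\<close> enumerates \<^term>\<open>cube n d\<close> without repetition.\<close>

definition enc_coloring :: "nat \<Rightarrow> nat \<Rightarrow> (nat list \<Rightarrow> nat) \<Rightarrow> bool list" where
  "enc_coloring n d s = concat (map (\<lambda>v. enc_binary (s v)) (List.n_lists d [0..<n]))"

type_synonym colored_cube_instance =
  "nat \<times> nat \<times> nat \<times> (nat list \<Rightarrow> nat) \<times> (nat list \<Rightarrow> nat)"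

text \<open>
  The side length and the dimension are written in unary because they stand for the hypergraph
  of lines, whose size is not bounded by a polynomial in their binary lengths.
\<close>

definition enc_cubes :: "colored_cube_instance \<Rightarrow> bool list" where
  "enc_cubes = (\<lambda>(n, d, k, s\<^sub>1, s\<^sub>2).
     enc_unary n @ enc_unary d @ enc_binary k @ enc_coloring n d s\<^sub>1 @ enc_coloring n d s\<^sub>2)"

definition colored_cube_yes_instances :: "colored_cube_instance set" where
  "colored_cube_yes_instances =
     {(n, d, k, s\<^sub>1, s\<^sub>2).
        s\<^sub>1 ` cube n d \<subseteq> {..<k} \<and> s\<^sub>2 ` cube n d \<subseteq> {..<k} \<and>
        colored_cubes_isomorphic n d s\<^sub>1 s\<^sub>2}"

definition Colored_Cube_Isomorphism :: problem where
  "Colored_Cube_Isomorphism = enc_cubes ` colored_cube_yes_instances"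

definition Two_Colored_Cube_Isomorphism :: problem where
  "Two_Colored_Cube_Isomorphism =
     enc_cubes ` {(n, d, k, s\<^sub>1, s\<^sub>2) \<in> colored_cube_yes_instances. k = 2}"

end

theory Submission
  imports Defs
begin

text \<open>
  Cubes to graphs: two distinct points lie on at most one line, so the lines are determined by the
  ternary collinearity relation, which can be tested on the digits of the points.  The graph of a
  colored cube has the points, a vertex for every pair \<open>(u, v)\<close> of points joined to the points of
  the line through \<open>u\<close> and \<open>v\<close> (if there is one), and pendant vertices whose number encodes the
  color.  Points are the neighbors of vertices of degree one, hence an isomorphism
  maps points to points, preserves colors, and maps lines to lines.

  Graphs to cubes: in the square grid of even side \<open>2 N \<ge> 4\<close> the points on the two diagonals are those
  on three lines.  Hence an automorphism preserves the union of the diagonals and maps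
  \<open>(i, j)\<close> to \<open>(\<sigma> i, \<tau> j)\<close> up to a transposition, where \<open>\<sigma>\<close> and \<open>\<tau>\<close> induce one and the same
  permutation of the \<open>N\<close> classes \<open>{i, 2 N - 1 - i}\<close>.  Coloring \<open>(i, j)\<close> by the adjacency of the
  classes of \<open>i\<close> and \<open>j\<close> therefore turns graph isomorphisms into grid automorphisms and conversely.
\<close>

section \<open>Composing polynomial time programs\<close>

text \<open>The encodings shape the membership direction. Colors are binary numbers and may be
  exponentially large, so the graph cannot afford that many pendant vertices. It records instead the
  rank of a color among all \<open>2 * N\<close> colors of both cubes, where
  \<open>N = n ^ d\<close>; ranks are comparable because both graphs use the same list. In a
  malformed word \<open>n ^ d\<close> may be superpolynomial, so powers are capped just above the
  word length, and rejected words are sent to the empty word, which encodes no instance. In general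
  dimension nothing is used about the automorphism group: lines are the sets cut out by
  collinearity, so a graph isomorphism that carries such sets to such sets is enough.

  For hardness the even side makes all reflection classes have exactly two indices, so that any
  permutation of the classes lifts to the indices. In the grid of side 2 every point lies on a
  diagonal and rows cannot be told from diagonals; this is why graphs with fewer than two vertices
  are treated apart.

  Both directions carry a predicate \<open>Q\<close> on the number of colors, which covers the full
  problem and its two-color restriction at once.\<close>

text \<open>
  A context describes the runs of a program fragment inside a larger program: a parameter \<open>x\<close> ranges over
  \<open>cdom\<close>, the input word is \<open>cinp x\<close>, and the quantities \<open>v x\<close> for \<open>v\<close> in \<open>cvars\<close> are held in registers.
  Loop variables extend the parameter by a component.
\<close>

datatype 'c ctx = Ctx (cdom: "'c set") (cinp: "'c \<Rightarrow> bool list") (cvars: "('c \<Rightarrow> nat) list")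

definition ext :: "'c ctx \<Rightarrow> ('c \<Rightarrow> nat set) \<Rightarrow> ('c \<times> nat) ctx" where
  "ext \<Gamma> S = Ctx (SIGMA x:cdom \<Gamma>. S x) (\<lambda>p. cinp \<Gamma> (fst p))
     (map (\<lambda>v p. v (fst p)) (cvars \<Gamma>) @ [snd])"

text \<open>Each branch of a conditional has to be correct only for the parameters that reach it. In
  the reduction from cubes this confines the construction to well-formed words, where its loop
  bounds are polynomial.\<close>

definition restr :: "'c ctx \<Rightarrow> ('c \<Rightarrow> bool) \<Rightarrow> 'c ctx" where
  "restr \<Gamma> P = Ctx {x \<in> cdom \<Gamma>. P x} (cinp \<Gamma>) (cvars \<Gamma>)"

definition stored :: "'c ctx \<Rightarrow> (nat \<Rightarrow> nat) \<Rightarrow> 'c \<Rightarrow> ram_state \<Rightarrow> bool" where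
  "stored \<Gamma> \<rho> x s \<longleftrightarrow> (\<forall>i<length (cvars \<Gamma>). reg s (\<rho> i) = (cvars \<Gamma> ! i) x)"

text \<open>The base \<open>length w + 2\<close> is at least 2 even for the empty word, so constant
  factors and sums of bounds are absorbed by raising the exponent. Registers above \<open>b\<close>
  may be overwritten freely.\<close>

definition runs ::
    "bool list \<Rightarrow> com \<Rightarrow> ram_state \<Rightarrow> nat \<Rightarrow> nat \<Rightarrow> nat \<Rightarrow> bool list \<Rightarrow> bool" where
  "runs w c s k b y u \<longleftrightarrow>
     (\<exists>t s'. exec w c s t s' \<and> t \<le> (length w + 2) ^ k \<and>
        (\<forall>r<b. reg s' r = reg s r) \<and> reg s' b = y \<and> out s' = out s @ u)"

text \<open>
  Wherever the variables are held (\<open>\<rho>\<close>), and for every register \<open>b\<close> beyond them, some polynomial time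
  program leaves \<open>f x\<close> in \<open>b\<close>, preserves all registers below \<open>b\<close>, and emits \<open>g x\<close>.  Quantifying over
  \<open>\<rho>\<close> and \<open>b\<close> makes fragments composable and weakening trivial.
\<close>

definition computes :: "'c ctx \<Rightarrow> ('c \<Rightarrow> nat) \<Rightarrow> ('c \<Rightarrow> bool list) \<Rightarrow> bool" where
  "computes \<Gamma> f g \<longleftrightarrow>
     (\<forall>\<rho> b. (\<forall>i<length (cvars \<Gamma>). \<rho> i < b) \<longrightarrow>
       (\<exists>c k. \<forall>x\<in>cdom \<Gamma>. \<forall>s. stored \<Gamma> \<rho> x s \<longrightarrow> runs (cinp \<Gamma> x) c s k b (f x) (g x)))"

lemma computesE:
  assumes "computes \<Gamma> f g" "\<And>i. i < length (cvars \<Gamma>) \<Longrightarrow> \<rho> i < b"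
  obtains c k where "\<And>x s. x \<in> cdom \<Gamma> \<Longrightarrow> stored \<Gamma> \<rho> x s \<Longrightarrow> runs (cinp \<Gamma> x) c s k b (f x) (g x)"
proof -
  have "\<exists>c k. \<forall>x\<in>cdom \<Gamma>. \<forall>s. stored \<Gamma> \<rho> x s \<longrightarrow> runs (cinp \<Gamma> x) c s k b (f x) (g x)"
    using assms unfolding computes_def by simp
  then show ?thesis using that by blast
qed

lemma computesI:
  assumes "\<And>\<rho> b. (\<And>i. i < length (cvars \<Gamma>) \<Longrightarrow> \<rho> i < b) \<Longrightarrow>
    \<exists>c k. \<forall>x\<in>cdom \<Gamma>. \<forall>s. stored \<Gamma> \<rho> x s \<longrightarrow> runs (cinp \<Gamma> x) c s k b (f x) (g x)"
  shows "computes \<Gamma> f g"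
  using assms unfolding computes_def by simp

lemma runsI:
  assumes "exec w c s t s'" "t \<le> (length w + 2) ^ k" "\<And>r. r < b \<Longrightarrow> reg s' r = reg s r"
    "reg s' b = y" "out s' = out s @ u"
  shows "runs w c s k b y u"
  using assms unfolding runs_def by blast

lemma runsE:
  assumes "runs w c s k b y u"
  obtains t s' where "exec w c s t s'" "t \<le> (length w + 2) ^ k" "\<forall>r<b. reg s' r = reg s r"
    "reg s' b = y" "out s' = out s @ u"
  using assms unfolding runs_def by blast

lemma power_le_power_two_plus: "k \<le> k' \<Longrightarrow> (n + 2 :: nat) ^ k \<le> (n + 2) ^ k'"
  by (rule power_increasing) auto

lemma one_le_power_two_plus: "1 \<le> (n + 2 :: nat) ^ k"
  by simp

lemma four_mult_power_le:
  assumes "2 \<le> (m::nat)"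
  shows "4 * m ^ k \<le> m ^ (k + 2)"
proof -
  have "(2 * 2) * m ^ k \<le> (m * m) * m ^ k" using assms by (intro mult_right_mono mult_mono) auto
  then show ?thesis by (simp add: power_add power2_eq_square mult.commute)
qed

lemma computes_cong:
  assumes "computes \<Gamma> f g" "\<And>x. x \<in> cdom \<Gamma> \<Longrightarrow> f' x = f x" "\<And>x. x \<in> cdom \<Gamma> \<Longrightarrow> g' x = g x"
  shows "computes \<Gamma> f' g'"
  using assms unfolding computes_def by simp

lemma computes_weaken:
  assumes "computes \<Gamma> f g"
  shows "computes (ext \<Gamma> S) (\<lambda>p. f (fst p)) (\<lambda>p. g (fst p))"
proof (rule computesI)
  fix \<rho> :: "nat \<Rightarrow> nat" and b
  assume *: "\<And>i. i < length (cvars (ext \<Gamma> S)) \<Longrightarrow> \<rho> i < b"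
  have "\<rho> i < b" if "i < length (cvars \<Gamma>)" for i
    using *[of i] that by (simp add: ext_def)
  then obtain c k where c: "\<And>x s. x \<in> cdom \<Gamma> \<Longrightarrow> stored \<Gamma> \<rho> x s \<Longrightarrow>
      runs (cinp \<Gamma> x) c s k b (f x) (g x)"
    using computesE[OF assms, of \<rho> b] by blast
  have "stored \<Gamma> \<rho> (fst x) s" if "stored (ext \<Gamma> S) \<rho> x s" for x s
    unfolding stored_def
  proof (intro allI impI)
    fix i assume "i < length (cvars \<Gamma>)"
    then show "reg s (\<rho> i) = (cvars \<Gamma> ! i) (fst x)"
      using that[unfolded stored_def, rule_format, of i] by (simp add: ext_def nth_append)
  qed
  moreover have "fst x \<in> cdom \<Gamma>" if "x \<in> cdom (ext \<Gamma> S)" for x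
    using that by (auto simp: ext_def)
  ultimately have "runs (cinp (ext \<Gamma> S) x) c s k b (f (fst x)) (g (fst x))"
    if "x \<in> cdom (ext \<Gamma> S)" "stored (ext \<Gamma> S) \<rho> x s" for x s
    using c[of "fst x" s] that by (simp add: ext_def)
  then show "\<exists>c k. \<forall>x\<in>cdom (ext \<Gamma> S). \<forall>s. stored (ext \<Gamma> S) \<rho> x s \<longrightarrow>
      runs (cinp (ext \<Gamma> S) x) c s k b (f (fst x)) (g (fst x))"
    by blast
qed

lemma stored_restr: "stored (restr \<Gamma> P) \<rho> x s = stored \<Gamma> \<rho> x s"
  by (simp add: stored_def restr_def)

lemma restr_sel [simp]:
  "cdom (restr \<Gamma> P) = {x \<in> cdom \<Gamma>. P x}" "cinp (restr \<Gamma> P) = cinp \<Gamma>" "cvars (restr \<Gamma> P) = cvars \<Gamma>"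
  by (simp_all add: restr_def)

lemma computes_restr:
  assumes "computes \<Gamma> f g"
  shows "computes (restr \<Gamma> P) f g"
proof (rule computesI)
  fix \<rho> :: "nat \<Rightarrow> nat" and b
  assume "\<And>i. i < length (cvars (restr \<Gamma> P)) \<Longrightarrow> \<rho> i < b"
  then obtain c k where "\<And>x s. x \<in> cdom \<Gamma> \<Longrightarrow> stored \<Gamma> \<rho> x s \<Longrightarrow>
      runs (cinp \<Gamma> x) c s k b (f x) (g x)"
    using computesE[OF assms, of \<rho> b] by auto
  then show "\<exists>c k. \<forall>x\<in>cdom (restr \<Gamma> P). \<forall>s. stored (restr \<Gamma> P) \<rho> x s \<longrightarrow>
      runs (cinp (restr \<Gamma> P) x) c s k b (f x) (g x)"
    by (intro exI[of _ c] exI[of _ k]) (simp add: stored_restr)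
qed

lemma computes_Assign:
  assumes "\<And>\<rho>. \<exists>a. \<forall>x\<in>cdom \<Gamma>. \<forall>s. stored \<Gamma> \<rho> x s \<longrightarrow> aval (cinp \<Gamma> x) s a = f x"
  shows "computes \<Gamma> f (\<lambda>_. [])"
proof (rule computesI)
  fix \<rho> :: "nat \<Rightarrow> nat" and b
  from assms[of \<rho>] obtain a
    where a: "\<And>x s. x \<in> cdom \<Gamma> \<Longrightarrow> stored \<Gamma> \<rho> x s \<Longrightarrow> aval (cinp \<Gamma> x) s a = f x" by blast
  have "runs (cinp \<Gamma> x) (Assign b a) s 0 b (f x) []" if "x \<in> cdom \<Gamma>" "stored \<Gamma> \<rho> x s" for x s
    by (rule runsI[OF exec_Assign]) (use a[OF that] in simp_all)
  then show "\<exists>c k. \<forall>x\<in>cdom \<Gamma>. \<forall>s. stored \<Gamma> \<rho> x s \<longrightarrow> runs (cinp \<Gamma> x) c s k b (f x) []"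
    by blast
qed

lemma computes_const: "computes \<Gamma> (\<lambda>_. c) (\<lambda>_. [])"
  by (rule computes_Assign) (auto intro!: exI[of _ "Const c"])

lemma computes_length: "computes \<Gamma> (\<lambda>x. length (cinp \<Gamma> x)) (\<lambda>_. [])"
  by (rule computes_Assign) (auto intro!: exI[of _ "InLen"])

lemma computes_var: "computes (ext \<Gamma> S) snd (\<lambda>_. [])"
proof (rule computes_Assign)
  fix \<rho> :: "nat \<Rightarrow> nat"
  show "\<exists>a. \<forall>x\<in>cdom (ext \<Gamma> S). \<forall>s. stored (ext \<Gamma> S) \<rho> x s \<longrightarrow> aval (cinp (ext \<Gamma> S) x) s a = snd x"
    by (rule exI[of _ "Reg (\<rho> (length (cvars \<Gamma>)))"]) (auto simp: stored_def ext_def nth_append)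
qed

text \<open>The second operand is computed with target register \<open>b + 1\<close>, so the first
  result in \<open>b\<close> survives. \<open>A\<close> is an expression template over two
  registers; with a constant template the rule later becomes plain concatenation of outputs.\<close>

lemma computes_binop:
  assumes "computes \<Gamma> f g" "computes \<Gamma> f' g'"
    and A: "\<And>w s y z. aval w s (A y z) = F w (reg s y) (reg s z)"
  shows "computes \<Gamma> (\<lambda>x. F (cinp \<Gamma> x) (f x) (f' x)) (\<lambda>x. g x @ g' x)"
proof (rule computesI)
  fix \<rho> :: "nat \<Rightarrow> nat" and b
  assume \<rho>: "\<And>i. i < length (cvars \<Gamma>) \<Longrightarrow> \<rho> i < b"
  obtain c k where c: "\<And>x s. x \<in> cdom \<Gamma> \<Longrightarrow> stored \<Gamma> \<rho> x s \<Longrightarrow>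
      runs (cinp \<Gamma> x) c s k b (f x) (g x)"
    using computesE[OF assms(1), of \<rho> b] \<rho> by blast
  obtain c' k' where c': "\<And>x s. x \<in> cdom \<Gamma> \<Longrightarrow> stored \<Gamma> \<rho> x s \<Longrightarrow>
      runs (cinp \<Gamma> x) c' s k' (Suc b) (f' x) (g' x)"
    using computesE[OF assms(2), of \<rho> "Suc b"] \<rho> less_SucI by metis
  let ?p = "Seq c (Seq c' (Assign b (A b (Suc b))))"
  have "runs (cinp \<Gamma> x) ?p s (max k k' + 2) b (F (cinp \<Gamma> x) (f x) (f' x)) (g x @ g' x)"
    if x: "x \<in> cdom \<Gamma>" and s: "stored \<Gamma> \<rho> x s" for x s
  proof -
    let ?w = "cinp \<Gamma> x" let ?m = "(length ?w + 2) ^ max k k'"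
    from c[OF x s] obtain t1 s1 where 1: "exec ?w c s t1 s1" "t1 \<le> (length ?w + 2) ^ k"
      "\<forall>r<b. reg s1 r = reg s r" "reg s1 b = f x" "out s1 = out s @ g x" by (rule runsE)
    have "stored \<Gamma> \<rho> x s1" using s 1(3) \<rho> by (simp add: stored_def)
    from c'[OF x this] obtain t2 s2 where 2: "exec ?w c' s1 t2 s2" "t2 \<le> (length ?w + 2) ^ k'"
      "\<forall>r<Suc b. reg s2 r = reg s1 r" "reg s2 (Suc b) = f' x" "out s2 = out s1 @ g' x"
      by (rule runsE)
    have e: "exec ?w ?p s (t1 + (t2 + 1)) (s2\<lparr>reg := (reg s2)(b := aval ?w s2 (A b (Suc b)))\<rparr>)"
      by (intro exec_Seq[OF 1(1)] exec_Seq[OF 2(1)] exec_Assign)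
    have "t1 + (t2 + 1) \<le> ?m + (?m + ?m)"
      using 1(2) 2(2) power_le_power_two_plus[of k "max k k'" "length ?w"]
        power_le_power_two_plus[of k' "max k k'" "length ?w"]
        one_le_power_two_plus[of "length ?w" "max k k'"] by linarith
    also have "\<dots> \<le> 4 * ?m" by simp
    also have "\<dots> \<le> (length ?w + 2) ^ (max k k' + 2)" by (rule four_mult_power_le) simp
    finally show ?thesis
      by (rule runsI[OF e]) (use 1 2 A in auto)
  qed
  then show "\<exists>c k. \<forall>x\<in>cdom \<Gamma>. \<forall>s. stored \<Gamma> \<rho> x s \<longrightarrow>
      runs (cinp \<Gamma> x) c s k b (F (cinp \<Gamma> x) (f x) (f' x)) (g x @ g' x)"
    by blast
qed

lemma computes_emit:
  assumes "computes \<Gamma> f g"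
  shows "computes \<Gamma> f (\<lambda>x. g x @ [f x \<noteq> 0])"
proof (rule computesI)
  fix \<rho> :: "nat \<Rightarrow> nat" and b
  assume \<rho>: "\<And>i. i < length (cvars \<Gamma>) \<Longrightarrow> \<rho> i < b"
  obtain c k where c: "\<And>x s. x \<in> cdom \<Gamma> \<Longrightarrow> stored \<Gamma> \<rho> x s \<Longrightarrow>
      runs (cinp \<Gamma> x) c s k b (f x) (g x)"
    using computesE[OF assms(1), of \<rho> b] \<rho> by blast
  let ?p = "Seq c (Emit (Reg b))"
  have "runs (cinp \<Gamma> x) ?p s (k + 1) b (f x) (g x @ [f x \<noteq> 0])"
    if x: "x \<in> cdom \<Gamma>" and s: "stored \<Gamma> \<rho> x s" for x s
  proof -
    let ?w = "cinp \<Gamma> x"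
    from c[OF x s] obtain t1 s1 where 1: "exec ?w c s t1 s1" "t1 \<le> (length ?w + 2) ^ k"
      "\<forall>r<b. reg s1 r = reg s r" "reg s1 b = f x" "out s1 = out s @ g x" by (rule runsE)
    have e: "exec ?w ?p s (t1 + 1) (s1\<lparr>out := out s1 @ [aval ?w s1 (Reg b) \<noteq> 0]\<rparr>)"
      by (intro exec_Seq[OF 1(1)] exec_Emit)
    have "t1 + 1 \<le> 2 * (length ?w + 2) ^ k"
      using 1(2) one_le_power_two_plus[of "length ?w" k] by linarith
    also have "\<dots> \<le> (length ?w + 2) ^ (k + 1)" by simp
    finally show ?thesis
      by (rule runsI[OF e]) (use 1 in auto)
  qed
  then show "\<exists>c k. \<forall>x\<in>cdom \<Gamma>. \<forall>s. stored \<Gamma> \<rho> x s \<longrightarrow>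
      runs (cinp \<Gamma> x) c s k b (f x) (g x @ [f x \<noteq> 0])"
    by blast
qed

text \<open>The test value in \<open>b\<close> is read before the chosen branch overwrites it, so
  all three programs can share the target register.\<close>

lemma computes_if:
  assumes "computes \<Gamma> h (\<lambda>_. [])"
    and "computes (restr \<Gamma> (\<lambda>x. h x \<noteq> 0)) f g" "computes (restr \<Gamma> (\<lambda>x. h x = 0)) f' g'"
  shows "computes \<Gamma> (\<lambda>x. if h x \<noteq> 0 then f x else f' x) (\<lambda>x. if h x \<noteq> 0 then g x else g' x)"
proof (rule computesI)
  fix \<rho> :: "nat \<Rightarrow> nat" and b
  assume \<rho>: "\<And>i. i < length (cvars \<Gamma>) \<Longrightarrow> \<rho> i < b"
  obtain c k where c: "\<And>x s. x \<in> cdom \<Gamma> \<Longrightarrow> stored \<Gamma> \<rho> x s \<Longrightarrow> runs (cinp \<Gamma> x) c s k b (h x) []"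
    using computesE[OF assms(1), of \<rho> b] \<rho> by blast
  have "\<And>i. i < length (cvars (restr \<Gamma> (\<lambda>x. h x \<noteq> 0))) \<Longrightarrow> \<rho> i < b" using \<rho> by simp
  then obtain c1 k1 where c1: "\<And>x s. x \<in> cdom (restr \<Gamma> (\<lambda>x. h x \<noteq> 0)) \<Longrightarrow>
      stored (restr \<Gamma> (\<lambda>x. h x \<noteq> 0)) \<rho> x s \<Longrightarrow> runs (cinp (restr \<Gamma> (\<lambda>x. h x \<noteq> 0)) x) c1 s k1 b (f x) (g x)"
    using computesE[OF assms(2), of \<rho> b] by blast
  have "\<And>i. i < length (cvars (restr \<Gamma> (\<lambda>x. h x = 0))) \<Longrightarrow> \<rho> i < b" using \<rho> by simp
  then obtain c2 k2 where c2: "\<And>x s. x \<in> cdom (restr \<Gamma> (\<lambda>x. h x = 0)) \<Longrightarrow>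
      stored (restr \<Gamma> (\<lambda>x. h x = 0)) \<rho> x s \<Longrightarrow> runs (cinp (restr \<Gamma> (\<lambda>x. h x = 0)) x) c2 s k2 b (f' x) (g' x)"
    using computesE[OF assms(3), of \<rho> b] by blast
  note c1 = c1[simplified stored_restr restr_sel, OF CollectI, OF conjI]
    and c2 = c2[simplified stored_restr restr_sel, OF CollectI, OF conjI]
  let ?p = "Seq c (IfNZ (Reg b) c1 c2)"
  let ?K = "max k (max k1 k2)"
  have "runs (cinp \<Gamma> x) ?p s (?K + 2) b (if h x \<noteq> 0 then f x else f' x) (if h x \<noteq> 0 then g x else g' x)"
    if x: "x \<in> cdom \<Gamma>" and s: "stored \<Gamma> \<rho> x s" for x s
  proof -
    let ?w = "cinp \<Gamma> x" let ?m = "(length ?w + 2) ^ ?K"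
    from c[OF x s] obtain t1 s1 where 1: "exec ?w c s t1 s1" "t1 \<le> (length ?w + 2) ^ k"
      "\<forall>r<b. reg s1 r = reg s r" "reg s1 b = h x" "out s1 = out s @ []" by (rule runsE)
    have s1: "stored \<Gamma> \<rho> x s1" using s 1(3) \<rho> by (simp add: stored_def)
    obtain t2 s2 where 2: "exec ?w (IfNZ (Reg b) c1 c2) s1 (t2 + 1) s2" "t2 \<le> ?m"
        "\<forall>r<b. reg s2 r = reg s1 r" "reg s2 b = (if h x \<noteq> 0 then f x else f' x)"
        "out s2 = out s1 @ (if h x \<noteq> 0 then g x else g' x)"
    proof (cases "h x = 0")
      case True
      from c2[OF x True s1] obtain t2 s2 where 2: "exec ?w c2 s1 t2 s2" "t2 \<le> (length ?w + 2) ^ k2"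
        "\<forall>r<b. reg s2 r = reg s1 r" "reg s2 b = f' x" "out s2 = out s1 @ g' x" by (rule runsE)
      have "exec ?w (IfNZ (Reg b) c1 c2) s1 (t2 + 1) s2"
        using 2(1) 1(4) True by (intro exec_IfFalse) auto
      moreover have "t2 \<le> ?m" by (rule order_trans[OF 2(2)], rule power_le_power_two_plus) simp
      ultimately show ?thesis using 2 True that by auto
    next
      case False
      from c1[OF x False s1] obtain t2 s2 where 2: "exec ?w c1 s1 t2 s2" "t2 \<le> (length ?w + 2) ^ k1"
        "\<forall>r<b. reg s2 r = reg s1 r" "reg s2 b = f x" "out s2 = out s1 @ g x" by (rule runsE)
      have "exec ?w (IfNZ (Reg b) c1 c2) s1 (t2 + 1) s2"
        using 2(1) 1(4) False by (intro exec_IfTrue) auto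
      moreover have "t2 \<le> ?m" by (rule order_trans[OF 2(2)], rule power_le_power_two_plus) simp
      ultimately show ?thesis using 2 False that by auto
    qed
    have e: "exec ?w ?p s (t1 + (t2 + 1)) s2"
      by (intro exec_Seq[OF 1(1)] 2(1))
    have "t1 + (t2 + 1) \<le> ?m + (?m + ?m)"
      using 1(2) 2(2) power_le_power_two_plus[of k ?K "length ?w"]
        one_le_power_two_plus[of "length ?w" ?K] by linarith
    also have "\<dots> \<le> 4 * ?m" by simp
    also have "\<dots> \<le> (length ?w + 2) ^ (?K + 2)" by (rule four_mult_power_le) simp
    finally show ?thesis
      by (rule runsI[OF e]) (use 1 2 in auto)
  qed
  then show "\<exists>c k. \<forall>x\<in>cdom \<Gamma>. \<forall>s. stored \<Gamma> \<rho> x s \<longrightarrow>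
      runs (cinp \<Gamma> x) c s k b (if h x \<noteq> 0 then f x else f' x) (if h x \<noteq> 0 then g x else g' x)"
    by blast
qed

text \<open>Numbers may become exponential, since repeated doubling is possible in polynomial time;
  only quantities bounded in this sense may control a loop.\<close>

definition pbounded :: "'c ctx \<Rightarrow> ('c \<Rightarrow> nat) \<Rightarrow> bool" where
  "pbounded \<Gamma> f \<longleftrightarrow> (\<exists>k. \<forall>x\<in>cdom \<Gamma>. f x \<le> (length (cinp \<Gamma> x) + 2) ^ k)"

text \<open>\<open>A x\<close> is an invariant for the accumulator: the body has to be computed only
  on accumulators in it, so a polynomial bound on intermediate results can be exploited inside the
  loop. The emitted words depend on the counter but not on the accumulator.\<close>

lemma computes_loop:
  assumes "computes \<Gamma> B (\<lambda>_. [])" "pbounded \<Gamma> B" "computes \<Gamma> a0 (\<lambda>_. [])"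
    and body: "computes (ext (ext \<Gamma> (\<lambda>x. {..<B x})) (\<lambda>p. A (fst p)))
      (\<lambda>q. G (fst (fst q)) (snd (fst q)) (snd q)) (\<lambda>q. H (fst (fst q)) (snd (fst q)))"
    and A0: "\<And>x. x \<in> cdom \<Gamma> \<Longrightarrow> a0 x \<in> A x"
    and AS: "\<And>x i a. x \<in> cdom \<Gamma> \<Longrightarrow> i < B x \<Longrightarrow> a \<in> A x \<Longrightarrow> G x i a \<in> A x"
  shows "computes \<Gamma> (\<lambda>x. fold (G x) [0..<B x] (a0 x)) (\<lambda>x. concat (map (H x) [0..<B x]))"
proof (rule computesI)
  fix \<rho> :: "nat \<Rightarrow> nat" and b
  assume \<rho>: "\<And>i. i < length (cvars \<Gamma>) \<Longrightarrow> \<rho> i < b"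
  let ?n = "length (cvars \<Gamma>)"
  from assms(2) obtain j where j: "\<And>x. x \<in> cdom \<Gamma> \<Longrightarrow> B x \<le> (length (cinp \<Gamma> x) + 2) ^ j"
    unfolding pbounded_def by blast
  have \<rho>': "\<rho> i < Suc b" "\<rho> i < b + 2" if "i < ?n" for i using \<rho>[OF that] by auto
  obtain ca ka where ca: "\<And>x s. x \<in> cdom \<Gamma> \<Longrightarrow> stored \<Gamma> \<rho> x s \<Longrightarrow>
      runs (cinp \<Gamma> x) ca s ka (Suc b) (a0 x) []"
    using computesE[OF assms(3), of \<rho> "Suc b"] \<rho>' by blast
  obtain cb kb where cb: "\<And>x s. x \<in> cdom \<Gamma> \<Longrightarrow> stored \<Gamma> \<rho> x s \<Longrightarrow>
      runs (cinp \<Gamma> x) cb s kb (b + 2) (B x) []"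
    using computesE[OF assms(1), of \<rho> "b + 2"] \<rho>' by blast
  let ?\<Delta> = "ext (ext \<Gamma> (\<lambda>x. {..<B x})) (\<lambda>p. A (fst p))"
  \<comment> \<open>Register \<open>b\<close> holds the counter, \<open>b + 1\<close> the
    accumulator and \<open>b + 2\<close> the bound; the body gets the target \<open>b + 3\<close>
    and thus preserves all three.\<close>
  let ?\<rho> = "\<rho>(?n := b, Suc ?n := Suc b)"
  have \<Delta>: "length (cvars ?\<Delta>) = ?n + 2" by (simp add: ext_def)
  have "?\<rho> i < b + 3" if "i < length (cvars ?\<Delta>)" for i
    using \<rho>[of i] that unfolding \<Delta> by auto
  then obtain cg kg where cg: "\<And>q s. q \<in> cdom ?\<Delta> \<Longrightarrow> stored ?\<Delta> ?\<rho> q s \<Longrightarrow>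
      runs (cinp ?\<Delta> q) cg s kg (b + 3) (G (fst (fst q)) (snd (fst q)) (snd q))
        (H (fst (fst q)) (snd (fst q)))"
    using computesE[OF body, of ?\<rho> "b + 3"] by blast
  have cg': "runs (cinp \<Gamma> x) cg s kg (b + 3) (G x i a) (H x i)"
    if x: "x \<in> cdom \<Gamma>" "i < B x" "a \<in> A x" and s: "stored \<Gamma> \<rho> x s" "reg s b = i" "reg s (Suc b) = a"
    for x i a s
  proof -
    have "((x, i), a) \<in> cdom ?\<Delta>" using x by (auto simp: ext_def)
    moreover have "reg s (?\<rho> l) = (cvars ?\<Delta> ! l) ((x, i), a)" if l: "l < length (cvars ?\<Delta>)" for l
    proof -
      consider "l < ?n" | "l = ?n" | "l = Suc ?n" using l \<Delta> by linarith
      then show ?thesis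
        using s unfolding stored_def by cases (auto simp: ext_def nth_append)
    qed
    then have "stored ?\<Delta> ?\<rho> ((x, i), a) s" by (simp add: stored_def)
    ultimately show ?thesis using cg[of "((x, i), a)" s] by (simp add: ext_def)
  qed
  let ?lb = "Seq cg (Seq (Assign (Suc b) (Reg (b + 3))) (Assign b (Add (Reg b) (Const 1))))"
  let ?loop = "WhileNZ (Sub (Reg (b + 2)) (Reg b)) ?lb"
  \<comment> \<open>Generalized to a start at any \<open>i\<close> with any admissible accumulator,
    for induction on the number of remaining rounds. In each round 3 steps pay for the two
    assignments and the loop test; the final 1 is the failing test.\<close>
  have loop: "\<exists>t s'. exec (cinp \<Gamma> x) ?loop s t s' \<and>
      t \<le> (B x - i) * ((length (cinp \<Gamma> x) + 2) ^ kg + 3) + 1 \<and>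
      (\<forall>r<b. reg s' r = reg s r) \<and> reg s' (Suc b) = fold (G x) [i..<B x] a \<and>
      out s' = out s @ concat (map (H x) [i..<B x])"
    if "x \<in> cdom \<Gamma>" "i \<le> B x" "a \<in> A x" "stored \<Gamma> \<rho> x s"
      "reg s b = i" "reg s (Suc b) = a" "reg s (b + 2) = B x" for x i a s
    using that
  proof (induction "B x - i" arbitrary: i a s)
    case 0
    then have i: "i = B x" by simp
    have "exec (cinp \<Gamma> x) ?loop s 1 s" using 0 i by (intro exec_WhileFalse) simp
    then show ?case using 0 i by (intro exI[of _ 1] exI[of _ s]) simp
  next
    case (Suc d)
    let ?w = "cinp \<Gamma> x"
    have i: "i < B x" using Suc(2) by simp
    from cg'[OF Suc.prems(1) i Suc.prems(3-6)] obtain t1 s1 where 1: "exec ?w cg s t1 s1"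
      "t1 \<le> (length ?w + 2) ^ kg" "\<forall>r<b+3. reg s1 r = reg s r" "reg s1 (b+3) = G x i a"
      "out s1 = out s @ H x i" by (rule runsE)
    let ?s2 = "s1\<lparr>reg := (reg s1)(Suc b := aval ?w s1 (Reg (b + 3)))\<rparr>"
    let ?s3 = "?s2\<lparr>reg := (reg ?s2)(b := aval ?w ?s2 (Add (Reg b) (Const 1)))\<rparr>"
    have e: "exec ?w ?lb s (t1 + (1 + 1)) ?s3"
      by (intro exec_Seq[OF 1(1)] exec_Seq[OF exec_Assign] exec_Assign)
    have "\<exists>t s'. exec (cinp \<Gamma> x) ?loop ?s3 t s' \<and>
      t \<le> (B x - Suc i) * ((length (cinp \<Gamma> x) + 2) ^ kg + 3) + 1 \<and>
      (\<forall>r<b. reg s' r = reg ?s3 r) \<and> reg s' (Suc b) = fold (G x) [Suc i..<B x] (G x i a) \<and>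
      out s' = out ?s3 @ concat (map (H x) [Suc i..<B x])"
    proof (rule Suc.hyps(1))
      show "d = B x - Suc i" "Suc i \<le> B x" using Suc(2) by auto
      show "G x i a \<in> A x" using AS Suc.prems i by blast
      show "stored \<Gamma> \<rho> x ?s3"
        unfolding stored_def
      proof (intro allI impI)
        fix l assume l: "l < ?n"
        then have "reg s (\<rho> l) = (cvars \<Gamma> ! l) x"
          using Suc.prems(4) by (simp add: stored_def)
        then show "reg ?s3 (\<rho> l) = (cvars \<Gamma> ! l) x"
          using \<rho>[OF l] 1(3) by simp
      qed
    qed (use Suc.prems 1 in auto)
    then obtain t4 s4 where 4: "exec ?w ?loop ?s3 t4 s4"
      "t4 \<le> (B x - Suc i) * ((length ?w + 2) ^ kg + 3) + 1" "\<forall>r<b. reg s4 r = reg ?s3 r"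
      "reg s4 (Suc b) = fold (G x) [Suc i..<B x] (G x i a)"
      "out s4 = out ?s3 @ concat (map (H x) [Suc i..<B x])" by blast
    have "exec ?w ?loop s ((t1 + (1 + 1)) + t4 + 1) s4"
      using e 4(1) i Suc.prems by (intro exec_WhileTrue) auto
    moreover have "(t1 + (1 + 1)) + t4 + 1 \<le> (B x - i) * ((length ?w + 2) ^ kg + 3) + 1"
    proof -
      have "B x - i = Suc (B x - Suc i)" using i by simp
      then have "(B x - i) * ((length ?w + 2) ^ kg + 3) =
        (length ?w + 2) ^ kg + 3 + (B x - Suc i) * ((length ?w + 2) ^ kg + 3)" by simp
      then show ?thesis using 1(2) 4(2) by linarith
    qed
    moreover have "[i..<B x] = i # [Suc i..<B x]" using i by (rule upt_conv_Cons)
    ultimately show ?case using 1 4 by (intro exI[of _ "(t1 + (1 + 1)) + t4 + 1"] exI[of _ s4]) simp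
  qed
  let ?p = "Seq ca (Seq cb (Seq (Assign b (Const 0)) (Seq ?loop (Assign b (Reg (Suc b))))))"
  let ?K = "ka + kb + (j + kg + 2)"
  have "runs (cinp \<Gamma> x) ?p s (?K + 2 + 2) b (fold (G x) [0..<B x] (a0 x)) (concat (map (H x) [0..<B x]))"
    if x: "x \<in> cdom \<Gamma>" and s: "stored \<Gamma> \<rho> x s" for x s
  proof -
    let ?w = "cinp \<Gamma> x" let ?L = "length ?w + 2"
    from ca[OF x s] obtain t1 s1 where 1: "exec ?w ca s t1 s1" "t1 \<le> ?L ^ ka"
      "\<forall>r<Suc b. reg s1 r = reg s r" "reg s1 (Suc b) = a0 x" "out s1 = out s @ []" by (rule runsE)
    have "stored \<Gamma> \<rho> x s1" using s 1(3) \<rho>' by (simp add: stored_def)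
    from cb[OF x this] obtain t2 s2 where 2: "exec ?w cb s1 t2 s2" "t2 \<le> ?L ^ kb"
      "\<forall>r<b+2. reg s2 r = reg s1 r" "reg s2 (b+2) = B x" "out s2 = out s1 @ []" by (rule runsE)
    let ?s3 = "s2\<lparr>reg := (reg s2)(b := aval ?w s2 (Const 0))\<rparr>"
    have "reg ?s3 (\<rho> i) = (cvars \<Gamma> ! i) x" if "i < ?n" for i
      using that s 1(3) 2(3) \<rho>[OF that] by (simp add: stored_def)
    then have "stored \<Gamma> \<rho> x ?s3" by (simp add: stored_def)
    then have "\<exists>t s'. exec ?w ?loop ?s3 t s' \<and> t \<le> (B x - 0) * (?L ^ kg + 3) + 1 \<and>
      (\<forall>r<b. reg s' r = reg ?s3 r) \<and> reg s' (Suc b) = fold (G x) [0..<B x] (a0 x) \<and>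
      out s' = out ?s3 @ concat (map (H x) [0..<B x])"
      using x A0 1 2 by (intro loop) auto
    then obtain t4 s4 where 4: "exec ?w ?loop ?s3 t4 s4" "t4 \<le> B x * (?L ^ kg + 3) + 1"
      "\<forall>r<b. reg s4 r = reg ?s3 r" "reg s4 (Suc b) = fold (G x) [0..<B x] (a0 x)"
      "out s4 = out ?s3 @ concat (map (H x) [0..<B x])" by auto
    have e: "exec ?w ?p s (t1 + (t2 + (1 + (t4 + 1))))
        (s4\<lparr>reg := (reg s4)(b := aval ?w s4 (Reg (Suc b)))\<rparr>)"
      by (intro exec_Seq[OF 1(1)] exec_Seq[OF 2(1)] exec_Seq[OF exec_Assign] exec_Seq[OF 4(1)] exec_Assign)
    have a: "?L ^ ka \<le> ?L ^ ?K" "?L ^ kb \<le> ?L ^ ?K" "1 \<le> ?L ^ ?K"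
      by (rule power_le_power_two_plus; simp)+ (rule one_le_power_two_plus)
    have "?L ^ kg + 3 \<le> 4 * ?L ^ kg" using one_le_power_two_plus[of "length ?w" kg] by linarith
    then have "B x * (?L ^ kg + 3) \<le> ?L ^ j * (4 * ?L ^ kg)" by (intro mult_mono j x) auto
    also have "\<dots> = 4 * ?L ^ (j + kg)" by (simp only: power_add mult.left_commute)
    also have "\<dots> \<le> ?L ^ (j + kg + 2)" by (rule four_mult_power_le) simp
    also have "\<dots> \<le> ?L ^ ?K" by (rule power_le_power_two_plus) simp
    finally have "t1 + (t2 + (1 + (t4 + 1))) \<le> 16 * ?L ^ ?K" using 1(2) 2(2) 4(2) a by linarith
    also have "\<dots> = 4 * (4 * ?L ^ ?K)" by simp
    also have "\<dots> \<le> 4 * ?L ^ (?K + 2)" by (intro mult_left_mono four_mult_power_le) auto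
    also have "\<dots> \<le> ?L ^ (?K + 2 + 2)" by (rule four_mult_power_le) simp
    finally show ?thesis
      by (rule runsI[OF e]) (use 1 2 4 in auto)
  qed
  then show "\<exists>c k. \<forall>x\<in>cdom \<Gamma>. \<forall>s. stored \<Gamma> \<rho> x s \<longrightarrow>
      runs (cinp \<Gamma> x) c s k b (fold (G x) [0..<B x] (a0 x)) (concat (map (H x) [0..<B x]))"
    by blast
qed

lemma poly_time_computableI:
  assumes "computes (Ctx UNIV (\<lambda>w. w) []) f g"
  shows "poly_time_computable g"
proof -
  obtain c k where c: "\<And>w s. stored (Ctx UNIV (\<lambda>w. w) []) id w s \<Longrightarrow> runs w c s k 0 (f w) (g w)"
    using computesE[OF assms, of id 0] by auto
  \<comment> \<open>\<open>[:2, 1:]\<close> is the polynomial X + 2.\<close>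
  have "\<exists>t s. exec w c init_state t s \<and> out s = g w \<and> t \<le> poly ([:2, 1:] ^ k) (length w)" for w
  proof -
    have "runs w c init_state k 0 (f w) (g w)" by (rule c) (simp add: stored_def)
    then show ?thesis
      by (rule runsE) (auto simp: init_state_def add.commute)
  qed
  then show ?thesis unfolding poly_time_computable_def by blast
qed

section \<open>Closure properties of computable numbers, predicates and outputs\<close>

definition input :: "'c ctx \<Rightarrow> ('c \<Rightarrow> bool list) \<Rightarrow> bool" where
  "input \<Gamma> W \<longleftrightarrow> cinp \<Gamma> = W"

definition num :: "'c ctx \<Rightarrow> ('c \<Rightarrow> nat) \<Rightarrow> bool" where
  "num \<Gamma> f \<longleftrightarrow> computes \<Gamma> f (\<lambda>_. [])"

definition pnum :: "'c ctx \<Rightarrow> ('c \<Rightarrow> nat) \<Rightarrow> bool" where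
  "pnum \<Gamma> f \<longleftrightarrow> num \<Gamma> f \<and> pbounded \<Gamma> f"

definition decides :: "'c ctx \<Rightarrow> ('c \<Rightarrow> bool) \<Rightarrow> bool" where
  "decides \<Gamma> P \<longleftrightarrow> num \<Gamma> (\<lambda>x. of_bool (P x))"

definition emits :: "'c ctx \<Rightarrow> ('c \<Rightarrow> bool list) \<Rightarrow> bool" where
  "emits \<Gamma> g \<longleftrightarrow> (\<exists>f. computes \<Gamma> f g)"

lemma cdom_ext: "p \<in> cdom (ext \<Gamma> S) \<longleftrightarrow> fst p \<in> cdom \<Gamma> \<and> snd p \<in> S (fst p)"
  by (cases p) (auto simp: ext_def)

lemma input_ext: "input \<Gamma> W \<Longrightarrow> input (ext \<Gamma> S) (\<lambda>p. W (fst p))"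
  by (simp add: input_def ext_def)

lemma input_restr: "input \<Gamma> W \<Longrightarrow> input (restr \<Gamma> P) W"
  by (simp add: input_def)

lemma num_cong: "num \<Gamma> f \<Longrightarrow> (\<And>x. x \<in> cdom \<Gamma> \<Longrightarrow> f' x = f x) \<Longrightarrow> num \<Gamma> f'"
  unfolding num_def by (rule computes_cong) auto

lemma pbounded_mono: "pbounded \<Gamma> f \<Longrightarrow> (\<And>x. x \<in> cdom \<Gamma> \<Longrightarrow> f' x \<le> f x) \<Longrightarrow> pbounded \<Gamma> f'"
  unfolding pbounded_def by (meson order_trans)

lemma pnum_cong: "pnum \<Gamma> f \<Longrightarrow> (\<And>x. x \<in> cdom \<Gamma> \<Longrightarrow> f' x = f x) \<Longrightarrow> pnum \<Gamma> f'"
  unfolding pnum_def by (auto intro: num_cong pbounded_mono)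

lemma decides_cong: "decides \<Gamma> P \<Longrightarrow> (\<And>x. x \<in> cdom \<Gamma> \<Longrightarrow> P' x = P x) \<Longrightarrow> decides \<Gamma> P'"
  unfolding decides_def by (auto intro: num_cong)

lemma emits_cong: "emits \<Gamma> g \<Longrightarrow> (\<And>x. x \<in> cdom \<Gamma> \<Longrightarrow> g' x = g x) \<Longrightarrow> emits \<Gamma> g'"
  unfolding emits_def by (erule exE, rule exI, erule computes_cong) auto

lemma pbounded_const: "pbounded \<Gamma> (\<lambda>_. c)"
proof -
  have "c \<le> (length (cinp \<Gamma> x) + 2) ^ c" for x
    using less_exp[of c] power_mono[of 2 "length (cinp \<Gamma> x) + 2" c] by linarith
  then show ?thesis unfolding pbounded_def by blast
qed

lemma pbounded_mult:
  assumes "pbounded \<Gamma> f" "pbounded \<Gamma> g"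
  shows "pbounded \<Gamma> (\<lambda>x. f x * g x)"
proof -
  from assms obtain j k where
    "\<And>x. x \<in> cdom \<Gamma> \<Longrightarrow> f x \<le> (length (cinp \<Gamma> x) + 2) ^ j"
    "\<And>x. x \<in> cdom \<Gamma> \<Longrightarrow> g x \<le> (length (cinp \<Gamma> x) + 2) ^ k" unfolding pbounded_def by blast
  then have "\<forall>x\<in>cdom \<Gamma>. f x * g x \<le> (length (cinp \<Gamma> x) + 2) ^ (j + k)"
    unfolding power_add by (intro ballI mult_mono) auto
  then show ?thesis unfolding pbounded_def by blast
qed

lemma pbounded_add:
  assumes "pbounded \<Gamma> f" "pbounded \<Gamma> g"
  shows "pbounded \<Gamma> (\<lambda>x. f x + g x)"
proof -
  \<comment> \<open>A sum is at most the product of the successors, so closure under products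
    reduces the claim to closure under successor.\<close>
  have "pbounded \<Gamma> (\<lambda>x. Suc (f x)) " if "pbounded \<Gamma> f" for f
  proof -
    obtain j where j: "\<And>x. x \<in> cdom \<Gamma> \<Longrightarrow> f x \<le> (length (cinp \<Gamma> x) + 2) ^ j"
      using \<open>pbounded \<Gamma> f\<close> unfolding pbounded_def by blast
    have "Suc (f x) \<le> (length (cinp \<Gamma> x) + 2) ^ Suc j" if "x \<in> cdom \<Gamma>" for x
    proof -
      have "Suc (f x) \<le> 2 * (length (cinp \<Gamma> x) + 2) ^ j"
        using j[OF that] one_le_power_two_plus[of "length (cinp \<Gamma> x)" j] by linarith
      also have "\<dots> \<le> (length (cinp \<Gamma> x) + 2) ^ Suc j" by simp
      finally show ?thesis .
    qed
    then show ?thesis unfolding pbounded_def by blast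
  qed
  then have "pbounded \<Gamma> (\<lambda>x. Suc (f x) * Suc (g x))" using assms pbounded_mult by blast
  then show ?thesis by (rule pbounded_mono) simp
qed

lemma pbounded_weaken: "pbounded \<Gamma> f \<Longrightarrow> pbounded (ext \<Gamma> S) (\<lambda>p. f (fst p))"
  unfolding pbounded_def by (auto simp: ext_def)

lemma pbounded_var: "pbounded \<Gamma> B \<Longrightarrow> pbounded (ext \<Gamma> (\<lambda>x. {..<B x})) snd"
  by (rule pbounded_mono[OF pbounded_weaken]) (auto simp: cdom_ext)

lemma pbounded_length: "pbounded \<Gamma> (\<lambda>x. length (cinp \<Gamma> x))"
  unfolding pbounded_def by (rule exI[of _ 1]) simp

lemma num_const: "num \<Gamma> (\<lambda>_. c)"
  unfolding num_def by (rule computes_const)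

lemma num_var: "num (ext \<Gamma> S) snd"
  unfolding num_def by (rule computes_var)

lemma num_weaken: "num \<Gamma> f \<Longrightarrow> num (ext \<Gamma> S) (\<lambda>p. f (fst p))"
  unfolding num_def by (rule computes_weaken)

lemma num_add: "num \<Gamma> f \<Longrightarrow> num \<Gamma> g \<Longrightarrow> num \<Gamma> (\<lambda>x. f x + g x)"
  using computes_binop[of \<Gamma> f "\<lambda>_. []" g "\<lambda>_. []" "\<lambda>y z. Add (Reg y) (Reg z)" "\<lambda>_. (+)"]
  unfolding num_def by simp

lemma num_diff: "num \<Gamma> f \<Longrightarrow> num \<Gamma> g \<Longrightarrow> num \<Gamma> (\<lambda>x. f x - g x)"
  using computes_binop[of \<Gamma> f "\<lambda>_. []" g "\<lambda>_. []" "\<lambda>y z. Sub (Reg y) (Reg z)" "\<lambda>_. (-)"]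
  unfolding num_def by simp

text \<open>Reading past the end gives \<open>False\<close>, as \<open>InBit\<close> does, so
  scanning needs no range checks.\<close>

definition bit_at :: "bool list \<Rightarrow> nat \<Rightarrow> bool" where
  "bit_at w i \<longleftrightarrow> i < length w \<and> w ! i"

lemma decides_bit_at:
  assumes "input \<Gamma> W" "num \<Gamma> f"
  shows "decides \<Gamma> (\<lambda>x. bit_at (W x) (f x))"
  using computes_binop[of \<Gamma> f "\<lambda>_. []" f "\<lambda>_. []" "\<lambda>y z. InBit (Reg y)"
      "\<lambda>w y z. of_bool (bit_at w y)"] assms
  unfolding num_def decides_def input_def by (simp add: bit_at_def)

lemma decides_const: "decides \<Gamma> (\<lambda>_. c)"
  unfolding decides_def by (rule num_const)

text \<open>Truth values are the numbers 0 and 1, and truncated subtraction supplies the logic: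
  negation is \<open>1 - P\<close>, conjunction is \<open>P + Q - 1\<close>, and
  \<open>f < g\<close> is \<open>1 - (1 + f - g)\<close>.\<close>

lemma decides_not: "decides \<Gamma> P \<Longrightarrow> decides \<Gamma> (\<lambda>x. \<not> P x)"
  unfolding decides_def by (rule num_cong[OF num_diff[OF num_const[of _ 1]]]) auto

lemma decides_conj:
  assumes "decides \<Gamma> P" "decides \<Gamma> Q"
  shows "decides \<Gamma> (\<lambda>x. P x \<and> Q x)"
  using num_diff[OF num_add[OF assms[unfolded decides_def]] num_const[of _ 1]]
  unfolding decides_def by (rule num_cong) auto

lemma decides_disj:
  assumes "decides \<Gamma> P" "decides \<Gamma> Q"
  shows "decides \<Gamma> (\<lambda>x. P x \<or> Q x)"
  using decides_not[OF decides_conj[OF assms[THEN decides_not]]] by (rule decides_cong) auto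

lemma decides_less:
  assumes "num \<Gamma> f" "num \<Gamma> g"
  shows "decides \<Gamma> (\<lambda>x. f x < g x)"
  unfolding decides_def
  by (rule num_cong[OF num_diff[OF num_const[of _ 1] num_diff[OF num_add[OF num_const[of _ 1] assms(1)] assms(2)]]])
    auto

lemma decides_le:
  assumes "num \<Gamma> f" "num \<Gamma> g"
  shows "decides \<Gamma> (\<lambda>x. f x \<le> g x)"
  using decides_not[OF decides_less[OF assms(2,1)]] by (rule decides_cong) auto

lemma decides_eq:
  assumes "num \<Gamma> f" "num \<Gamma> g"
  shows "decides \<Gamma> (\<lambda>x. f x = g x)"
  using decides_conj[OF decides_le[OF assms] decides_le[OF assms(2,1)]] by (rule decides_cong) auto

lemma num_fold:
  assumes "pnum \<Gamma> B" "num \<Gamma> a0"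
    and "num (ext (ext \<Gamma> (\<lambda>x. {..<B x})) (\<lambda>p. A (fst p)))
      (\<lambda>q. G (fst (fst q)) (snd (fst q)) (snd q))"
    and "\<And>x. x \<in> cdom \<Gamma> \<Longrightarrow> a0 x \<in> A x"
    and "\<And>x i a. x \<in> cdom \<Gamma> \<Longrightarrow> i < B x \<Longrightarrow> a \<in> A x \<Longrightarrow> G x i a \<in> A x"
  shows "num \<Gamma> (\<lambda>x. fold (G x) [0..<B x] (a0 x))"
  unfolding num_def
  by (rule computes_cong[OF computes_loop[where H = "\<lambda>_ _. []" and A = A and G = G and B = B]])
    (use assms in \<open>auto simp: num_def pnum_def\<close>)

lemma fold_add_eq_sum: "fold (\<lambda>i a. a + f i) [0..<n] (0::nat) = (\<Sum>i<n. f i)"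
  by (induction n) auto

lemma num_sum:
  assumes "pnum \<Gamma> B" "num (ext \<Gamma> (\<lambda>x. {..<B x})) (\<lambda>p. f (fst p) (snd p))"
  shows "num \<Gamma> (\<lambda>x. \<Sum>i<B x. f x i)"
proof -
  have "num \<Gamma> (\<lambda>x. fold (\<lambda>i a. a + f x i) [0..<B x] 0)"
  proof (rule num_fold[where A = "\<lambda>_. UNIV"])
    show "num (ext (ext \<Gamma> (\<lambda>x. {..<B x})) (\<lambda>p. UNIV)) (\<lambda>q. snd q + f (fst (fst q)) (snd (fst q)))"
      by (rule num_add[OF num_var num_weaken[OF assms(2)]])
  qed (use assms num_const in auto)
  then show ?thesis by (rule num_cong) (simp add: fold_add_eq_sum)
qed

lemma pnumI: "num \<Gamma> f \<Longrightarrow> pbounded \<Gamma> f \<Longrightarrow> pnum \<Gamma> f"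
  by (simp add: pnum_def)

lemma pnum_num: "pnum \<Gamma> f \<Longrightarrow> num \<Gamma> f" and pnum_pbounded: "pnum \<Gamma> f \<Longrightarrow> pbounded \<Gamma> f"
  by (simp_all add: pnum_def)

lemma pnum_const: "pnum \<Gamma> (\<lambda>_. c)"
  by (intro pnumI num_const pbounded_const)

lemma pnum_length: "input \<Gamma> W \<Longrightarrow> pnum \<Gamma> (\<lambda>x. length (W x))"
  using computes_length[of \<Gamma>] pbounded_length[of \<Gamma>] by (simp add: pnum_def num_def input_def)

lemma pnum_var: "pnum \<Gamma> B \<Longrightarrow> pnum (ext \<Gamma> (\<lambda>x. {..<B x})) snd"
  unfolding pnum_def by (simp add: num_var pbounded_var)

lemma pnum_weaken: "pnum \<Gamma> f \<Longrightarrow> pnum (ext \<Gamma> S) (\<lambda>p. f (fst p))"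
  unfolding pnum_def by (simp add: num_weaken pbounded_weaken)

lemma pnum_add: "pnum \<Gamma> f \<Longrightarrow> pnum \<Gamma> g \<Longrightarrow> pnum \<Gamma> (\<lambda>x. f x + g x)"
  unfolding pnum_def by (simp add: num_add pbounded_add)

lemma pnum_diff: "pnum \<Gamma> f \<Longrightarrow> num \<Gamma> g \<Longrightarrow> pnum \<Gamma> (\<lambda>x. f x - g x)"
  by (rule pnumI[OF num_diff pbounded_mono[of _ f]]) (auto simp: pnum_def)

lemma pnum_min: "pnum \<Gamma> f \<Longrightarrow> num \<Gamma> g \<Longrightarrow> pnum \<Gamma> (\<lambda>x. min (f x) (g x))"
  by (rule pnum_cong[OF pnum_diff[OF _ num_diff[OF pnum_num]]]) auto

text \<open>The machine cannot multiply, so the product is a sum of \<open>f x\<close> copies of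
  \<open>g x\<close>; this is why the two factors are treated asymmetrically.\<close>

lemma num_mult:
  assumes "pnum \<Gamma> f" "num \<Gamma> g"
  shows "num \<Gamma> (\<lambda>x. f x * g x)"
  by (rule num_cong[OF num_sum[OF assms(1), of "\<lambda>x _. g x"]]) (use assms num_weaken in auto)

lemma pnum_mult: "pnum \<Gamma> f \<Longrightarrow> pnum \<Gamma> g \<Longrightarrow> pnum \<Gamma> (\<lambda>x. f x * g x)"
  by (rule pnumI) (simp_all add: num_mult pbounded_mult pnum_num pnum_pbounded)

lemma decides_ex:
  assumes "pnum \<Gamma> B" "decides (ext \<Gamma> (\<lambda>x. {..<B x})) (\<lambda>p. P (fst p) (snd p))"
  shows "decides \<Gamma> (\<lambda>x. \<exists>i<B x. P x i)"
proof (rule decides_cong)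
  show "decides \<Gamma> (\<lambda>x. 0 < (\<Sum>i<B x. of_bool (P x i) :: nat))"
    using assms unfolding decides_def[of "ext _ _"] by (intro decides_less num_const num_sum)
qed (auto simp: card_gt_0_iff)

lemma decides_all:
  assumes "pnum \<Gamma> B" "decides (ext \<Gamma> (\<lambda>x. {..<B x})) (\<lambda>p. P (fst p) (snd p))"
  shows "decides \<Gamma> (\<lambda>x. \<forall>i<B x. P x i)"
  by (rule decides_cong[OF decides_not[OF decides_ex[OF assms(1) decides_not[OF assms(2)]]]]) auto

lemma pnum_of_bool: "decides \<Gamma> P \<Longrightarrow> pnum \<Gamma> (\<lambda>x. of_bool (P x))"
  by (rule pnumI[OF _ pbounded_mono[OF pbounded_const[of _ 1]]]) (auto simp: decides_def)

lemma pnum_sum: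
  assumes "pnum \<Gamma> B" "pnum (ext \<Gamma> (\<lambda>x. {..<B x})) (\<lambda>p. f (fst p) (snd p))"
  shows "pnum \<Gamma> (\<lambda>x. \<Sum>i<B x. f x i)"
proof (rule pnumI)
  show "num \<Gamma> (\<lambda>x. \<Sum>i<B x. f x i)" using assms num_sum pnum_num by blast
  obtain k where k: "\<And>x i. x \<in> cdom \<Gamma> \<Longrightarrow> i < B x \<Longrightarrow> f x i \<le> (length (cinp \<Gamma> x) + 2) ^ k"
    using pnum_pbounded[OF assms(2)] by (fastforce simp: pbounded_def ext_def)
  have "pbounded \<Gamma> (\<lambda>x. B x * (length (cinp \<Gamma> x) + 2) ^ k)"
    by (intro pbounded_mult pnum_pbounded[OF assms(1)]) (auto simp: pbounded_def)
  moreover have "(\<Sum>i<B x. f x i) \<le> B x * (length (cinp \<Gamma> x) + 2) ^ k" if "x \<in> cdom \<Gamma>" for x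
    using sum_bounded_above[of "{..<B x}" "f x" "(length (cinp \<Gamma> x) + 2) ^ k"] k[OF that] by simp
  ultimately show "pbounded \<Gamma> (\<lambda>x. \<Sum>i<B x. f x i)" by (rule pbounded_mono)
qed

text \<open>Bounded search without a loop of its own: the least solution is the number of
  \<open>m\<close> such that neither \<open>m\<close> nor anything below it is a solution, and this
  count is a sum of truth values.\<close>

lemma Least_eq_sum:
  fixes P :: "nat \<Rightarrow> bool"
  assumes "\<exists>m\<le>n. P m"
  shows "(LEAST m. P m) = (\<Sum>m<n. of_bool (\<forall>i<Suc m. \<not> P i))"
proof -
  let ?l = "LEAST m. P m"
  from assms have l: "P ?l" "?l \<le> n" by (auto intro: LeastI Least_le order_trans)
  have "(\<forall>i<Suc m. \<not> P i) \<longleftrightarrow> m < ?l" for m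
    using l(1) not_less_Least[of _ P] by (metis less_Suc_eq_le not_le order_le_less_trans)
  then have "(\<Sum>m<n. of_bool (\<forall>i<Suc m. \<not> P i)) = (\<Sum>m<n. of_bool (m < ?l))" by simp
  also have "\<dots> = card ({..<n} \<inter> {m. m < ?l})" by simp
  also have "{..<n} \<inter> {m. m < ?l} = {..<?l}" using l(2) by auto
  finally show ?thesis by simp
qed

lemma pnum_Suc: "pnum \<Gamma> f \<Longrightarrow> pnum \<Gamma> (\<lambda>x. Suc (f x))"
  using pnum_add[OF pnum_const[of \<Gamma> 1]] by simp

lemma num_Suc: "num \<Gamma> f \<Longrightarrow> num \<Gamma> (\<lambda>x. Suc (f x))"
  using num_add[OF num_const[of \<Gamma> 1]] by simp

lemma pnum_Least:
  assumes "pnum \<Gamma> B"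
    and "decides (ext (ext \<Gamma> (\<lambda>x. {..<B x})) (\<lambda>p. {..<Suc (snd p)})) (\<lambda>q. P (fst (fst q)) (snd q))"
    and "\<And>x. x \<in> cdom \<Gamma> \<Longrightarrow> \<exists>m\<le>B x. P x m"
  shows "pnum \<Gamma> (\<lambda>x. LEAST m. P x m)"
proof (rule pnum_cong)
  show "pnum \<Gamma> (\<lambda>x. \<Sum>m<B x. of_bool (\<forall>i<Suc m. \<not> P x i))"
    by (intro pnum_sum assms pnum_of_bool decides_all pnum_Suc pnum_var decides_not)
qed (use assms Least_eq_sum in auto)

text \<open>The quotient counts the positive multiples of \<open>b\<close> not exceeding
  \<open>a\<close>; the conjunct \<open>0 < b\<close> yields the convention
  \<open>a div 0 = 0\<close>.\<close>

lemma div_eq_sum: "(a::nat) div b = (\<Sum>q<a. of_bool (0 < b \<and> Suc q * b \<le> a))"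
proof (cases "b = 0")
  case False
  then have *: "Suc q * b \<le> a \<longleftrightarrow> q < a div b" for q
    using less_eq_div_iff_mult_less_eq[of b "Suc q" a] by (simp add: Suc_le_eq)
  have "(\<Sum>q<a. of_bool (0 < b \<and> Suc q * b \<le> a)) = card ({..<a} \<inter> {q. q < a div b})"
    unfolding * using False by simp
  also have "{..<a} \<inter> {q. q < a div b} = {..<a div b}"
    by (auto intro: less_le_trans[OF _ div_le_dividend])
  finally show ?thesis by simp
qed simp

lemma pnum_div:
  assumes "pnum \<Gamma> f" "pnum \<Gamma> g"
  shows "pnum \<Gamma> (\<lambda>x. f x div g x)"
proof (rule pnum_cong)
  show "pnum \<Gamma> (\<lambda>x. \<Sum>q<f x. of_bool (0 < g x \<and> Suc q * g x \<le> f x))"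
    by (intro pnum_sum pnum_of_bool decides_conj decides_less decides_le num_const num_mult pnum_Suc
        pnum_var num_weaken pnum_num assms)
qed (simp add: div_eq_sum)

lemma pnum_mod:
  assumes "pnum \<Gamma> f" "pnum \<Gamma> g"
  shows "pnum \<Gamma> (\<lambda>x. f x mod g x)"
proof (rule pnum_cong)
  show "pnum \<Gamma> (\<lambda>x. f x - f x div g x * g x)"
    by (intro pnum_diff num_mult pnum_div assms pnum_num)
qed (simp add: modulo_nat_def)

lemma fold_div_eq: "fold (\<lambda>_ a. a div n) [0..<j] m = m div n ^ j" for n :: nat
  by (induction j) (auto simp: div_mult2_eq[symmetric] mult.commute)

text \<open>The power itself may be too large to compute with. Dividing \<open>h x\<close> times
  keeps every intermediate value at most \<open>f x\<close>, which is the loop invariant.\<close>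

lemma pnum_div_power:
  assumes "pnum \<Gamma> f" "pnum \<Gamma> g" "pnum \<Gamma> h"
  shows "pnum \<Gamma> (\<lambda>x. f x div g x ^ h x)"
proof (rule pnumI[OF num_cong])
  show "num \<Gamma> (\<lambda>x. fold (\<lambda>_ a. a div g x) [0..<h x] (f x))"
  proof (rule num_fold[where A = "\<lambda>x. {..<Suc (f x)}"])
    show "num (ext (ext \<Gamma> (\<lambda>x. {..<h x})) (\<lambda>p. {..<Suc (f (fst p))})) (\<lambda>q. snd q div g (fst (fst q)))"
      by (intro pnum_num[OF pnum_div] pnum_var pnum_Suc pnum_weaken assms)
  qed (use assms pnum_num in \<open>auto intro: le_less_trans[OF div_le_dividend]\<close>)
  show "pbounded \<Gamma> (\<lambda>x. f x div g x ^ h x)"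
    by (rule pbounded_mono[OF pnum_pbounded[OF assms(1)]]) simp
qed (simp add: fold_div_eq)

text \<open>Capping after every multiplication loses nothing: once the cap is reached, a positive
  factor keeps it there and a zero factor gives 0 either way. \<open>0 < M\<close> makes the initial
  value 1 respect the cap.\<close>

lemma fold_min_eq_min_power:
  assumes "0 < M"
  shows "fold (\<lambda>_ a. min (a * n) M) [0..<d] 1 = min (n ^ d) (M::nat)"
proof (induction d)
  case (Suc d)
  have "min (min a M * n) M = min (a * n) M" for a
  proof (cases "a \<le> M")
    case False
    then show ?thesis using assms by (cases n) (auto simp: min_def)
  qed simp
  then show ?case using Suc by (simp add: mult.commute)
qed (use assms in simp)

lemma pnum_min_power:
  assumes "pnum \<Gamma> f" "pnum \<Gamma> g" "pnum \<Gamma> h" "\<And>x. x \<in> cdom \<Gamma> \<Longrightarrow> 0 < h x"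
  shows "pnum \<Gamma> (\<lambda>x. min (f x ^ g x) (h x))"
proof (rule pnumI[OF num_cong])
  show "num \<Gamma> (\<lambda>x. fold (\<lambda>_ a. min (a * f x) (h x)) [0..<g x] 1)"
  proof (rule num_fold[where A = "\<lambda>x. {..<Suc (h x)}"])
    show "num (ext (ext \<Gamma> (\<lambda>x. {..<g x})) (\<lambda>p. {..<Suc (h (fst p))}))
       (\<lambda>q. min (snd q * f (fst (fst q))) (h (fst (fst q))))"
      by (intro pnum_num[OF pnum_min] pnum_num[OF pnum_weaken] pnum_mult pnum_var pnum_Suc pnum_weaken assms)
  qed (use assms num_const in \<open>auto simp: Suc_leI\<close>)
  show "pbounded \<Gamma> (\<lambda>x. min (f x ^ g x) (h x))"
    by (rule pbounded_mono[OF pnum_pbounded[OF assms(3)]]) simp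
qed (use assms fold_min_eq_min_power in auto)

text \<open>Horner's scheme from the most significant digit, using only doubling and addition. After
  \<open>k\<close> rounds the value is that of the top \<open>k\<close> of the \<open>m\<close>
  digits.\<close>

lemma fold_horner:
  "k \<le> m \<Longrightarrow> fold (\<lambda>i a. a + a + c (m - Suc i)) [0..<k] 0 = (\<Sum>j<k. c (m - k + j) * 2 ^ j)"
  for c :: "nat \<Rightarrow> nat"
proof (induction k)
  case (Suc k)
  have "(\<Sum>j<Suc k. c (m - Suc k + j) * 2 ^ j) =
      c (m - Suc k) + (\<Sum>j<k. c (m - Suc k + Suc j) * 2 ^ Suc j)"
    by (subst sum.lessThan_Suc_shift) simp
  also have "(\<Sum>j<k. c (m - Suc k + Suc j) * 2 ^ Suc j) = (\<Sum>j<k. c (m - k + j) * 2 ^ Suc j)"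
    using Suc.prems by (intro sum.cong arg_cong2[where f = "(*)"] arg_cong[where f = c]) auto
  also have "(\<Sum>j<k. c (m - k + j) * 2 ^ Suc j) = 2 * (\<Sum>j<k. c (m - k + j) * 2 ^ j)"
    by (simp add: sum_distrib_left ac_simps)
  finally show ?case using Suc by simp
qed simp

text \<open>The value may be exponential, so the accumulator ranges over all numbers and only
  \<open>num\<close> is claimed.\<close>

lemma num_binary_value:
  assumes "pnum \<Gamma> m"
    and "num (ext (ext \<Gamma> (\<lambda>x. {..<m x})) (\<lambda>_. UNIV)) (\<lambda>q. c (fst (fst q)) (m (fst (fst q)) - Suc (snd (fst q))))"
  shows "num \<Gamma> (\<lambda>x. \<Sum>j<m x. c x j * 2 ^ j)"
proof (rule num_cong)
  show "num \<Gamma> (\<lambda>x. fold (\<lambda>i a. a + a + c x (m x - Suc i)) [0..<m x] 0)"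
    using assms by (intro num_fold[where A = "\<lambda>x. UNIV"] num_add num_var num_const) auto
qed (simp add: fold_horner)

text \<open>Fixing the final value to 0 removes the existential quantifier, so that emitting
  programs can be combined by the rules for \<open>computes\<close>.\<close>

lemma emits_computes_zero: "emits \<Gamma> g \<longleftrightarrow> computes \<Gamma> (\<lambda>_. 0) g"
proof
  assume "emits \<Gamma> g"
  then obtain f where "computes \<Gamma> f g" by (auto simp: emits_def)
  from computes_binop[OF this computes_const, of "\<lambda>_ _. Const 0" "\<lambda>_ _ _. 0"]
  show "computes \<Gamma> (\<lambda>_. 0) g" by simp
qed (auto simp: emits_def)

lemma emits_Nil: "emits \<Gamma> (\<lambda>_. [])"
  unfolding emits_def by (rule exI, rule computes_const)

lemma emits_append: "emits \<Gamma> g \<Longrightarrow> emits \<Gamma> g' \<Longrightarrow> emits \<Gamma> (\<lambda>x. g x @ g' x)"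
  using computes_binop[of \<Gamma> "\<lambda>_. 0" g "\<lambda>_. 0" g' "\<lambda>_ _. Const 0" "\<lambda>_ _ _. 0"]
  by (simp add: emits_computes_zero)

lemma emits_single: "decides \<Gamma> P \<Longrightarrow> emits \<Gamma> (\<lambda>x. [P x])"
  using computes_emit[of \<Gamma> "\<lambda>x. of_bool (P x)" "\<lambda>_. []"]
  by (auto simp: emits_def decides_def num_def)

lemma emits_Cons: "decides \<Gamma> P \<Longrightarrow> emits \<Gamma> g \<Longrightarrow> emits \<Gamma> (\<lambda>x. P x # g x)"
  using emits_append[OF emits_single] by simp

lemma emits_restr: "emits \<Gamma> g \<Longrightarrow> emits (restr \<Gamma> P) g"
  unfolding emits_def by (erule exE, rule exI, erule computes_restr)

lemma emits_if:
  assumes "decides \<Gamma> P" "emits (restr \<Gamma> P) g" "emits (restr \<Gamma> (\<lambda>x. \<not> P x)) g'"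
  shows "emits \<Gamma> (\<lambda>x. if P x then g x else g' x)"
  using computes_if[of \<Gamma> "\<lambda>x. of_bool (P x)" "\<lambda>_. 0" g "\<lambda>_. 0" g'] assms
  by (simp add: emits_computes_zero decides_def num_def)

lemma emits_concat:
  assumes "pnum \<Gamma> B" "emits (ext \<Gamma> (\<lambda>x. {..<B x})) (\<lambda>p. g (fst p) (snd p))"
  shows "emits \<Gamma> (\<lambda>x. concat (map (\<lambda>i. g x i) [0..<B x]))"
  unfolding emits_def
proof
  show "computes \<Gamma> (\<lambda>x. fold (\<lambda>_ _. 0) [0..<B x] 0) (\<lambda>x. concat (map (g x) [0..<B x]))"
  proof (rule computes_loop[where A = "\<lambda>_. UNIV"])
    show "computes (ext (ext \<Gamma> (\<lambda>x. {..<B x})) (\<lambda>p. UNIV)) (\<lambda>q. 0) (\<lambda>q. g (fst (fst q)) (snd (fst q)))"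
      using computes_weaken[OF assms(2)[unfolded emits_computes_zero]] by simp
  qed (use assms in \<open>auto simp: pnum_def num_def intro: computes_const\<close>)
qed

lemma emits_map:
  assumes "pnum \<Gamma> B" "decides (ext \<Gamma> (\<lambda>x. {..<B x})) (\<lambda>p. P (fst p) (snd p))"
  shows "emits \<Gamma> (\<lambda>x. map (\<lambda>i. P x i) [0..<B x])"
  by (rule emits_cong[OF emits_concat[OF assms(1) emits_single[OF assms(2)]]]) simp

lemma emits_enc_unary: "pnum \<Gamma> f \<Longrightarrow> emits \<Gamma> (\<lambda>x. enc_unary (f x))"
  by (rule emits_cong[OF emits_append[OF emits_map[of _ f "\<lambda>_ _. True"] emits_single[of _ "\<lambda>_. False"]]])
    (auto simp: enc_unary_def map_replicate_const intro: decides_const)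

section \<open>Encodings\<close>

text \<open>The code is self-delimiting, so it can be split off from the front of a longer
  word.\<close>

lemma enc_unary_append_inject: "enc_unary a @ x = enc_unary b @ y \<longleftrightarrow> a = b \<and> x = y"
proof (induction a arbitrary: b)
  case 0
  then show ?case by (cases b) (auto simp: enc_unary_def)
next
  case (Suc a)
  then show ?case by (cases b) (auto simp: enc_unary_def)
qed

lemma enc_binary_append_inject: "enc_binary a @ x = enc_binary b @ y \<longleftrightarrow> a = b \<and> x = y"
proof (induction a arbitrary: b rule: enc_binary.induct)
  case (1 a)
  show ?case
  proof (cases "a = 0 \<or> b = 0")
    case True
    then show ?thesis
      by (subst (1 2) enc_binary.simps) auto
  next
    case False
    then have "enc_binary a @ x = enc_binary b @ y \<longleftrightarrow>
        odd a = odd b \<and> enc_binary (a div 2) @ x = enc_binary (b div 2) @ y"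
      by (subst (1 2) enc_binary.simps) auto
    also have "\<dots> \<longleftrightarrow> odd a = odd b \<and> a div 2 = b div 2 \<and> x = y" using 1 False by blast
    also have "\<dots> \<longleftrightarrow> a = b \<and> x = y"
      by (metis odd_two_times_div_two_succ dvd_mult_div_cancel)
    finally show ?thesis .
  qed
qed

lemma concat_enc_binary_append_inject:
  "length xs = length ys \<Longrightarrow>
    concat (map enc_binary xs) @ x = concat (map enc_binary ys) @ y \<longleftrightarrow> xs = ys \<and> x = y"
  by (induction xs ys rule: list_induct2) (auto simp: enc_binary_append_inject)

lemma concat_enc_binary_inject:
  "length xs = length ys \<Longrightarrow> concat (map enc_binary xs) = concat (map enc_binary ys) \<longleftrightarrow> xs = ys"
  using concat_enc_binary_append_inject[of xs ys "[]" "[]"] by simp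

lemma length_n_lists_upt: "length (List.n_lists d [0..<n]) = n ^ d"
  by (simp add: length_n_lists)

lemma set_n_lists_upt: "set (List.n_lists d [0..<n]) = cube n d"
  by (auto simp: set_n_lists cube_def)

lemma enc_cubes_eq:
  "enc_cubes (n, d, k, s1, s2) = enc_unary n @ enc_unary d @ enc_binary k @
     concat (map enc_binary (map s1 (List.n_lists d [0..<n]) @ map s2 (List.n_lists d [0..<n])))"
  by (simp add: enc_cubes_def enc_coloring_def comp_def)

lemma enc_cubes_inject:
  "enc_cubes (n, d, k, s1, s2) = enc_cubes (n', d', k', s1', s2') \<longleftrightarrow>
     n = n' \<and> d = d' \<and> k = k' \<and> (\<forall>v\<in>cube n d. s1 v = s1' v \<and> s2 v = s2' v)"
proof -
  have "enc_cubes (n, d, k, s1, s2) = enc_cubes (n', d', k', s1', s2') \<longleftrightarrow> n = n' \<and> d = d' \<and> k = k' \<and>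
    concat (map enc_binary (map s1 (List.n_lists d [0..<n]) @ map s2 (List.n_lists d [0..<n]))) =
    concat (map enc_binary (map s1' (List.n_lists d [0..<n]) @ map s2' (List.n_lists d [0..<n])))"
    unfolding enc_cubes_eq enc_unary_append_inject enc_binary_append_inject by auto
  also have "\<dots> \<longleftrightarrow> n = n' \<and> d = d' \<and> k = k' \<and>
      map s1 (List.n_lists d [0..<n]) @ map s2 (List.n_lists d [0..<n]) =
      map s1' (List.n_lists d [0..<n]) @ map s2' (List.n_lists d [0..<n])"
    by (subst concat_enc_binary_inject) simp_all
  also have "\<dots> \<longleftrightarrow> n = n' \<and> d = d' \<and> k = k' \<and> (\<forall>v\<in>cube n d. s1 v = s1' v \<and> s2 v = s2' v)"
    by (auto simp: set_n_lists_upt)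
  finally show ?thesis .
qed

lemma colored_cubes_isomorphic_cong:
  assumes "\<And>v. v \<in> cube n d \<Longrightarrow> s1 v = s1' v" "\<And>v. v \<in> cube n d \<Longrightarrow> s2 v = s2' v"
  shows "colored_cubes_isomorphic n d s1 s2 \<longleftrightarrow> colored_cubes_isomorphic n d s1' s2'"
proof -
  have "P v \<in> cube n d" if "cube_automorphism n d P" "v \<in> cube n d" for P v
    using that by (auto simp: cube_automorphism_def bij_betw_def)
  then show ?thesis using assms by (auto simp: colored_cubes_isomorphic_def)
qed

text \<open>Membership in the image only gives some instance with the same code. As the encoding
  forgets color values outside the cube, that instance may differ from the given one, but not in any
  property that depends on the cube alone.\<close>

lemma enc_cubes_mem_iff:
  "enc_cubes (n, d, k, s1, s2) \<in> enc_cubes ` {(n, d, k, s1, s2) \<in> colored_cube_yes_instances. Q k} \<longleftrightarrow>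
     Q k \<and> s1 ` cube n d \<subseteq> {..<k} \<and> s2 ` cube n d \<subseteq> {..<k} \<and> colored_cubes_isomorphic n d s1 s2"
proof
  assume "enc_cubes (n, d, k, s1, s2) \<in> enc_cubes ` {(n, d, k, s1, s2) \<in> colored_cube_yes_instances. Q k}"
  then obtain n' d' k' s1' s2' where e: "enc_cubes (n, d, k, s1, s2) = enc_cubes (n', d', k', s1', s2')"
    and y: "(n', d', k', s1', s2') \<in> colored_cube_yes_instances" "Q k'" by auto
  have "s1 ` cube n d = s1' ` cube n d" "s2 ` cube n d = s2' ` cube n d"
    using e unfolding enc_cubes_inject by auto
  moreover have "colored_cubes_isomorphic n d s1 s2 \<longleftrightarrow> colored_cubes_isomorphic n d s1' s2'"
    using e unfolding enc_cubes_inject by (intro colored_cubes_isomorphic_cong) auto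
  ultimately show "Q k \<and> s1 ` cube n d \<subseteq> {..<k} \<and> s2 ` cube n d \<subseteq> {..<k} \<and>
      colored_cubes_isomorphic n d s1 s2"
    using e y unfolding enc_cubes_inject by (auto simp: colored_cube_yes_instances_def)
qed (auto simp: colored_cube_yes_instances_def)

section \<open>Adjacency triangles and graph encodings\<close>

definition triangle :: "(nat \<Rightarrow> nat \<Rightarrow> bool) \<Rightarrow> nat \<Rightarrow> bool list" where
  "triangle adj n = concat (map (\<lambda>v. map (\<lambda>u. adj u v) [0..<v]) [0..<n])"

lemma enc_graph_eq: "enc_graph (n, E) = enc_unary n @ triangle (\<lambda>u v. {u, v} \<in> E) n"
  by (simp add: enc_graph_def triangle_def)

lemma triangle_Suc: "triangle adj (Suc n) = triangle adj n @ map (\<lambda>u. adj u n) [0..<n]"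
  by (simp add: triangle_def)

lemma length_triangle: "length (triangle adj n) = (\<Sum>v<n. v)"
  by (induction n) (auto simp: triangle_Suc triangle_def[of _ 0])

text \<open>Row \<open>v\<close> is preceded by rows of lengths \<open>0, ..., v - 1\<close>, hence
  the offset.\<close>

lemma nth_triangle: "u < v \<Longrightarrow> v < n \<Longrightarrow> triangle adj n ! ((\<Sum>i<v. i) + u) = adj u v"
proof (induction n)
  case (Suc n)
  show ?case
  proof (cases "v = n")
    case True
    then show ?thesis using Suc.prems by (simp add: triangle_Suc nth_append length_triangle)
  next
    case False
    then have v: "v < n" using Suc.prems by simp
    have "(\<Sum>i<v. i) + u < (\<Sum>i<Suc v. i)" using Suc.prems by simp
    also have "\<dots> \<le> (\<Sum>i<n. i)" using v by (intro sum_mono2) auto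
    finally show ?thesis using Suc v by (simp add: triangle_Suc nth_append length_triangle)
  qed
qed simp

lemma triangle_eq_iff: "triangle adj n = triangle adj' n \<longleftrightarrow> (\<forall>v<n. \<forall>u<v. adj u v = adj' u v)"
proof
  assume "triangle adj n = triangle adj' n"
  then show "\<forall>v<n. \<forall>u<v. adj u v = adj' u v" by (metis nth_triangle)
qed (auto simp: triangle_def intro!: arg_cong[where f = concat])

text \<open>Used for decoding: every word of the right length is a triangle, so only lengths have to
  be checked.\<close>

lemma triangle_surj:
  assumes "length xs = (\<Sum>v<n. v)"
  shows "xs = triangle (\<lambda>u v. xs ! ((\<Sum>i<v. i) + u)) n"
  using assms
proof (induction n arbitrary: xs)
  case 0
  then show ?case by (simp add: triangle_def)
next
  case (Suc n)
  let ?T = "\<Sum>v<n. v"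
  have "xs = take ?T xs @ drop ?T xs" by simp
  also have "take ?T xs = triangle (\<lambda>u v. take ?T xs ! ((\<Sum>i<v. i) + u)) n"
    using Suc by (intro Suc.IH) simp
  also have "\<dots> = triangle (\<lambda>u v. xs ! ((\<Sum>i<v. i) + u)) n"
    unfolding triangle_eq_iff
  proof (intro allI impI)
    fix u v assume "v < n" "u < v"
    then have "(\<Sum>i<v. i) + u < (\<Sum>i<Suc v. i)" by simp
    also have "\<dots> \<le> ?T" using \<open>v < n\<close> by (intro sum_mono2) auto
    finally show "take ?T xs ! ((\<Sum>i<v. i) + u) = xs ! ((\<Sum>i<v. i) + u)" by simp
  qed
  also have "drop ?T xs = map (\<lambda>u. xs ! (?T + u)) [0..<n]"
    using Suc.prems by (intro nth_equalityI) auto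
  finally show ?case by (simp add: triangle_Suc)
qed

lemma simple_graph_edge_ne: "simple_graph (n, E) \<Longrightarrow> {u, v} \<in> E \<Longrightarrow> u \<noteq> v"
  by (fastforce simp: simple_graph_def doubleton_eq_iff)

lemma enc_graph_append_inject:
  assumes "simple_graph (n, E)" "simple_graph (m, F)"
  shows "enc_graph (n, E) @ x = enc_graph (m, F) @ y \<longleftrightarrow>
    n = m \<and> (\<forall>u<n. \<forall>v<n. {u, v} \<in> E \<longleftrightarrow> {u, v} \<in> F) \<and> x = y"
proof -
  have "enc_graph (n, E) @ x = enc_graph (m, F) @ y \<longleftrightarrow>
      n = m \<and> triangle (\<lambda>u v. {u, v} \<in> E) n = triangle (\<lambda>u v. {u, v} \<in> F) n \<and> x = y"
    by (auto simp: enc_graph_eq enc_unary_append_inject length_triangle)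
  also have "\<dots> \<longleftrightarrow> n = m \<and> (\<forall>u<n. \<forall>v<n. {u, v} \<in> E \<longleftrightarrow> {u, v} \<in> F) \<and> x = y"
  proof -
    \<comment> \<open>The triangle omits the diagonal, where simple graphs have no edge; the other
      half follows by symmetry of \<open>{u, v}\<close>.\<close>
    have "{u, v} \<in> E \<longleftrightarrow> {u, v} \<in> F" if *: "\<forall>v<n. \<forall>u<v. {u, v} \<in> E \<longleftrightarrow> {u, v} \<in> F" "u < n" "v < n" for u v
    proof (cases u v rule: linorder_cases)
      case equal
      then show ?thesis using assms simple_graph_edge_ne by blast
    qed (use * in \<open>auto simp: insert_commute\<close>)
    then show ?thesis unfolding triangle_eq_iff by auto
  qed
  finally show ?thesis .
qed

lemma graph_isomorphic_cong:
  assumes "\<And>u v. u < n \<Longrightarrow> v < n \<Longrightarrow> {u, v} \<in> E \<longleftrightarrow> {u, v} \<in> E'"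
    and "\<And>u v. u < m \<Longrightarrow> v < m \<Longrightarrow> {u, v} \<in> F \<longleftrightarrow> {u, v} \<in> F'"
  shows "graph_isomorphic (n, E) (m, F) \<longleftrightarrow> graph_isomorphic (n, E') (m, F')"
proof -
  have "\<pi> u < m" if "bij_betw \<pi> {..<n} {..<m}" "u < n" for \<pi> u
    using that by (auto simp: bij_betw_def)
  then show ?thesis using assms by (auto simp: graph_isomorphic_def)
qed

lemma enc_graph_pair_mem_iff:
  assumes "simple_graph (n, E)" "simple_graph (m, F)"
  shows "enc_graph (n, E) @ enc_graph (m, F) \<in> Graph_Isomorphism \<longleftrightarrow> graph_isomorphic (n, E) (m, F)"
proof
  assume "enc_graph (n, E) @ enc_graph (m, F) \<in> Graph_Isomorphism"
  then obtain G H where e: "enc_graph (n, E) @ enc_graph (m, F) = enc_graph G @ enc_graph H"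
    and s: "simple_graph G" "simple_graph H" "graph_isomorphic G H"
    by (auto simp: Graph_Isomorphism_def)
  obtain n' E' m' F' where GH: "G = (n', E')" "H = (m', F')" by fastforce
  have 1: "n = n'" "\<forall>u<n. \<forall>v<n. {u, v} \<in> E \<longleftrightarrow> {u, v} \<in> E'" "enc_graph (m, F) = enc_graph (m', F')"
    using e s assms unfolding GH by (auto simp: enc_graph_append_inject)
  have 2: "m = m'" "\<forall>u<m. \<forall>v<m. {u, v} \<in> F \<longleftrightarrow> {u, v} \<in> F'"
    using enc_graph_append_inject[of m F m' F' "[]" "[]"] 1(3) s assms unfolding GH by auto
  show "graph_isomorphic (n, E) (m, F)"
    using s(3) graph_isomorphic_cong[of n E E' m F F'] 1 2 unfolding GH by simp
qed (use assms in \<open>auto simp: Graph_Isomorphism_def\<close>)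

text \<open>The empty word is the fixed no-instance to which malformed inputs are sent.\<close>

lemma Nil_notin_Graph_Isomorphism: "[] \<notin> Graph_Isomorphism"
  by (auto simp: Graph_Isomorphism_def enc_graph_def enc_unary_def)

lemma Nil_notin_enc_cubes: "[] \<notin> enc_cubes ` X"
  by (auto simp: enc_cubes_def enc_unary_def)

section \<open>Parsing unary and binary codes inside a word\<close>

definition ones_run :: "bool list \<Rightarrow> nat \<Rightarrow> nat" where
  "ones_run w p = (LEAST m. \<not> bit_at w (p + m))"

text \<open>The continuation markers of a binary code stand at even offsets from \<open>p\<close>,
  its digits at odd ones.\<close>

definition code_digits :: "bool list \<Rightarrow> nat \<Rightarrow> nat" where
  "code_digits w p = (LEAST m. \<not> bit_at w (p + 2 * m))"

definition code_value :: "bool list \<Rightarrow> nat \<Rightarrow> nat" where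
  "code_value w p = (\<Sum>j<code_digits w p. of_bool (bit_at w (p + 2 * j + 1)) * 2 ^ j)"

text \<open>Besides a terminator inside the word, the most significant digit must be 1: only
  numerals without leading zeros are values of \<open>enc_binary\<close>.\<close>

definition code_valid :: "bool list \<Rightarrow> nat \<Rightarrow> bool" where
  "code_valid w p \<longleftrightarrow> p + 2 * code_digits w p < length w \<and>
     (code_digits w p = 0 \<or> bit_at w (p + 2 * code_digits w p - 1))"

definition code_end :: "bool list \<Rightarrow> nat \<Rightarrow> nat" where
  "code_end w p = p + 2 * code_digits w p + 1"

definition code_pos :: "bool list \<Rightarrow> nat \<Rightarrow> nat \<Rightarrow> nat" where
  "code_pos w p i = (code_end w ^^ i) p"

lemma not_bit_at_ge: "length w \<le> i \<Longrightarrow> \<not> bit_at w i"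
  by (simp add: bit_at_def)

lemma pnum_ones_run:
  assumes "input \<Gamma> W" "num \<Gamma> p"
  shows "pnum \<Gamma> (\<lambda>x. ones_run (W x) (p x))"
  unfolding ones_run_def
proof (rule pnum_Least[OF pnum_length[OF assms(1)]])
  show "decides (ext (ext \<Gamma> (\<lambda>x. {..<length (W x)})) (\<lambda>p. {..<Suc (snd p)}))
     (\<lambda>q. \<not> bit_at (W (fst (fst q))) (p (fst (fst q)) + snd q))"
    by (intro decides_not decides_bit_at input_ext num_add num_var num_weaken assms)
  show "\<exists>m\<le>length (W x). \<not> bit_at (W x) (p x + m)" for x
    by (intro exI[of _ "length (W x)"] conjI not_bit_at_ge) auto
qed

lemma pnum_code_digits:
  assumes "input \<Gamma> W" "num \<Gamma> p"
  shows "pnum \<Gamma> (\<lambda>x. code_digits (W x) (p x))"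
  unfolding code_digits_def
proof (rule pnum_Least[OF pnum_length[OF assms(1)]])
  show "decides (ext (ext \<Gamma> (\<lambda>x. {..<length (W x)})) (\<lambda>p. {..<Suc (snd p)}))
     (\<lambda>q. \<not> bit_at (W (fst (fst q))) (p (fst (fst q)) + 2 * snd q))"
    by (intro decides_not decides_bit_at input_ext num_add num_mult pnum_const num_var num_weaken assms)
  show "\<exists>m\<le>length (W x). \<not> bit_at (W x) (p x + 2 * m)" for x
    by (intro exI[of _ "length (W x)"] conjI not_bit_at_ge) auto
qed

lemma num_code_value:
  assumes "input \<Gamma> W" "num \<Gamma> p"
  shows "num \<Gamma> (\<lambda>x. code_value (W x) (p x))"
  unfolding code_value_def
  by (rule num_binary_value)
    (intro pnum_code_digits assms pnum_num[OF pnum_of_bool] decides_bit_at input_ext num_add num_mult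
      pnum_const num_const num_diff num_Suc num_weaken num_var pnum_num[OF pnum_code_digits])+

lemma decides_code_valid:
  assumes "input \<Gamma> W" "num \<Gamma> p"
  shows "decides \<Gamma> (\<lambda>x. code_valid (W x) (p x))"
  unfolding code_valid_def
  by (intro decides_conj decides_disj decides_less decides_eq decides_bit_at num_add num_diff num_mult
      pnum_const num_const pnum_num[OF pnum_length] pnum_num[OF pnum_code_digits] assms)

lemma num_code_end:
  assumes "input \<Gamma> W" "num \<Gamma> p"
  shows "num \<Gamma> (\<lambda>x. code_end (W x) (p x))"
  unfolding code_end_def
  by (intro num_add num_mult pnum_const num_const pnum_num[OF pnum_code_digits] assms)

lemma fold_const_eq_funpow: "fold (\<lambda>_. f) [0..<n] a = (f ^^ n) a"
  by (induction n) auto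

lemma num_code_pos:
  assumes "input \<Gamma> W" "num \<Gamma> p" "pnum \<Gamma> i"
  shows "num \<Gamma> (\<lambda>x. code_pos (W x) (p x) (i x))"
proof (rule num_cong)
  show "num \<Gamma> (\<lambda>x. fold (\<lambda>_. code_end (W x)) [0..<i x] (p x))"
    by (intro num_fold[where A = "\<lambda>_. UNIV"] num_code_end input_ext num_var assms) auto
qed (simp add: code_pos_def fold_const_eq_funpow)

lemma bit_at_drop: "bit_at (drop p w) i = bit_at w (p + i)"
  by (auto simp: bit_at_def less_diff_conv add.commute)

lemma ones_run_enc_unary:
  assumes "drop p w = enc_unary n @ r"
  shows "ones_run w p = n" "p + n < length w" "drop (p + n + 1) w = r"
proof -
  have "length (drop p w) = length (enc_unary n @ r)" using assms by simp
  then show "p + n < length w" by (simp add: enc_unary_def)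
  have b: "bit_at w (p + m) = bit_at (enc_unary n @ r) m" for m
    unfolding assms[symmetric] bit_at_drop ..
  have "\<not> bit_at w (p + n)" unfolding b by (simp add: bit_at_def enc_unary_def nth_append)
  moreover have "bit_at w (p + m)" if "m < n" for m
    unfolding b using that by (simp add: bit_at_def enc_unary_def nth_append)
  ultimately show "ones_run w p = n"
    unfolding ones_run_def by (intro Least_equality) (auto simp: not_less[symmetric])
  have "drop (p + n + 1) w = drop (n + 1) (drop p w)" by (simp add: add.commute)
  then show "drop (p + n + 1) w = r" unfolding assms by (simp add: enc_unary_def)
qed

lemma enc_unary_ones_run:
  assumes "p + ones_run w p < length w"
  shows "drop p w = enc_unary (ones_run w p) @ drop (p + ones_run w p + 1) w"
proof -
  let ?n = "ones_run w p"
  have "\<not> bit_at w (p + length w)" by (rule not_bit_at_ge) simp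
  then have n: "\<not> bit_at w (p + ?n)" unfolding ones_run_def by (rule LeastI)
  have l: "w ! (p + m)" if "m < ?n" for m
    using not_less_Least[OF that[unfolded ones_run_def]] by (simp add: bit_at_def)
  have "take ?n (drop p w) = replicate ?n True"
    using assms l by (intro nth_equalityI) auto
  moreover have "drop (p + ?n) w = False # drop (p + ?n + 1) w"
    using assms n by (simp add: Cons_nth_drop_Suc[symmetric] bit_at_def)
  ultimately show ?thesis
    using append_take_drop_id[of ?n "drop p w"] by (simp add: enc_unary_def add.commute)
qed

lemma code_digits_0: "\<not> bit_at w p \<Longrightarrow> code_digits w p = 0"
  by (simp add: code_digits_def)

lemma code_digits_Suc:
  assumes "bit_at w p"
  shows "code_digits w p = Suc (code_digits w (p + 2))"
proof -
  have "\<not> bit_at w (p + 2 * length w)"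
  proof (cases "length w = 0")
    case True
    then show ?thesis by (simp add: bit_at_def)
  qed (auto intro!: not_bit_at_ge)
  from Least_Suc[of "\<lambda>m. \<not> bit_at w (p + 2 * m)", OF this] assms show ?thesis
    by (simp add: code_digits_def)
qed

lemma sum_binary_Suc: "(\<Sum>j<Suc m. c j * 2 ^ j) = c 0 + 2 * (\<Sum>j<m. c (Suc j) * 2 ^ j)"
  for c :: "nat \<Rightarrow> nat"
  by (subst sum.lessThan_Suc_shift) (simp add: sum_distrib_left ac_simps)

lemma code_value_Suc:
  assumes "bit_at w p"
  shows "code_value w p = of_bool (bit_at w (p + 1)) + 2 * code_value w (p + 2)"
  unfolding code_value_def code_digits_Suc[OF assms] sum_binary_Suc by simp

lemma code_valid_Suc:
  assumes "bit_at w p"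
  shows "code_valid w p \<longleftrightarrow> code_valid w (p + 2) \<and> (code_digits w (p + 2) = 0 \<longrightarrow> bit_at w (p + 1))"
  unfolding code_valid_def code_digits_Suc[OF assms]
  by (cases "code_digits w (p + 2)") (auto simp: add.commute add.left_commute)

lemma code_end_Suc:
  assumes "bit_at w p"
  shows "code_end w p = code_end w (p + 2)"
  by (simp add: code_end_def code_digits_Suc[OF assms])

text \<open>The last conjunct serves the induction: if the tail has no digits, then
  \<open>v div 2\<close> is 0, so a nonzero \<open>v\<close> is 1 and its only digit is not a
  leading zero.\<close>

lemma code_of_enc_binary:
  assumes "drop p w = enc_binary v @ r"
  shows "code_valid w p \<and> code_value w p = v \<and> drop (code_end w p) w = r \<and> (code_digits w p = 0 \<longrightarrow> v = 0)"
  using assms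
proof (induction v arbitrary: p rule: enc_binary.induct)
  case (1 v)
  have b: "bit_at w (p + m) = bit_at (enc_binary v @ r) m" for m
    unfolding 1(2)[symmetric] bit_at_drop ..
  show ?case
  proof (cases "v = 0")
    case True
    then have d: "drop p w = False # r" using 1(2) by (simp add: enc_binary.simps)
    then have "\<not> bit_at w p" using bit_at_drop[of p w 0] by (simp add: bit_at_def)
    moreover have "p < length w" using d by (metis drop_all list.distinct(1) not_less)
    moreover have "drop (Suc p) w = r" using d by (metis drop_Suc tl_drop list.sel(3))
    ultimately show ?thesis
      using True by (simp add: code_valid_def code_value_def code_end_def code_digits_0)
  next
    case False
    then have d: "drop p w = True # odd v # enc_binary (v div 2) @ r"
      using 1(2) by (simp add: enc_binary.simps[of v])
    then have bits: "bit_at w p" "bit_at w (p + 1) = odd v"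
      using bit_at_drop[of p w 0] bit_at_drop[of p w 1] by (auto simp: bit_at_def)
    have "drop (p + 2) w = drop 2 (drop p w)" by (simp add: add.commute)
    then have "drop (p + 2) w = enc_binary (v div 2) @ r" unfolding d by simp
    from 1(1)[OF False this] have IH: "code_valid w (p + 2)" "code_value w (p + 2) = v div 2"
      "drop (code_end w (p + 2)) w = r" "code_digits w (p + 2) = 0 \<longrightarrow> v div 2 = 0" by auto
    have "code_digits w (p + 2) = 0 \<longrightarrow> odd v" using IH(4) False
      by (metis dvd_mult_div_cancel mult_0_right)
    then show ?thesis
      using bits IH
      by (simp add: code_valid_Suc code_value_Suc code_end_Suc code_digits_Suc)
  qed
qed

lemma code_value_pos:
  assumes "code_valid w p" "0 < code_digits w p"
  shows "0 < code_value w p"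
proof -
  let ?j = "code_digits w p - 1"
  have "p + 2 * ?j + 1 = p + 2 * code_digits w p - 1" using assms(2) by simp
  then have "of_bool (bit_at w (p + 2 * ?j + 1)) * 2 ^ ?j > (0::nat)"
    using assms by (simp add: code_valid_def)
  then show ?thesis unfolding code_value_def using assms(2)
    by (intro sum_pos2[of _ ?j]) auto
qed

lemma enc_binary_code_value:
  assumes "code_valid w p"
  shows "drop p w = enc_binary (code_value w p) @ drop (code_end w p) w"
  using assms
proof (induction "code_digits w p" arbitrary: p)
  case 0
  then have "p < length w" by (simp add: code_valid_def)
  moreover have "\<not> bit_at w p" using 0(1) code_digits_Suc[of w p] by auto
  ultimately show ?case
    using 0(1)[symmetric]
    by (simp add: code_value_def code_end_def enc_binary.simps bit_at_def Cons_nth_drop_Suc[symmetric])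
next
  case (Suc m)
  have b: "bit_at w p" using Suc(2) code_digits_0[of w p] by fastforce
  then have v: "code_valid w (p + 2)" and t: "code_digits w (p + 2) = 0 \<longrightarrow> bit_at w (p + 1)"
    using Suc.prems code_valid_Suc by blast+
  have "p + 2 \<le> length w" using v by (simp add: code_valid_def)
  then have "drop p w = w ! p # w ! (p + 1) # drop (p + 2) w"
    by (simp add: Cons_nth_drop_Suc)
  also have "w ! p = True" using b by (simp add: bit_at_def)
  also have "w ! (p + 1) = bit_at w (p + 1)" using \<open>p + 2 \<le> length w\<close> by (simp add: bit_at_def)
  also have "drop (p + 2) w = enc_binary (code_value w (p + 2)) @ drop (code_end w (p + 2)) w"
    using Suc(2) b v by (intro Suc.hyps) (simp_all add: code_digits_Suc)
  finally have d: "drop p w =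
    True # bit_at w (p + 1) # enc_binary (code_value w (p + 2)) @ drop (code_end w p) w"
    using b by (simp add: code_end_Suc)
  have "code_value w p \<noteq> 0"
    using code_value_pos[OF Suc.prems] Suc(2) by simp
  then show ?case unfolding d using b
    by (subst enc_binary.simps) (simp add: code_value_Suc)
qed

lemma code_pos_Suc: "code_pos w p (Suc i) = code_pos w (code_end w p) i"
  unfolding code_pos_def funpow_Suc_right by simp

lemma code_pos_0: "code_pos w p 0 = p"
  by (simp add: code_pos_def)

text \<open>Existence and uniqueness of a parse in one equivalence: from left to right it analyses a
  given encoding, from right to left it certifies that a successfully scanned word is one.\<close>

lemma codes_iff:
  assumes "p \<le> length w"
  shows "drop p w = concat (map enc_binary cs) \<and> length cs = m \<longleftrightarrow>
    (\<forall>i<m. code_valid w (code_pos w p i)) \<and> code_pos w p m = length w \<and>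
    cs = map (\<lambda>i. code_value w (code_pos w p i)) [0..<m]"
  using assms
proof (induction m arbitrary: p cs)
  case 0
  then show ?case by (auto simp: code_pos_def)
next
  case (Suc m)
  have *: "code_end w p \<le> length w" if "code_valid w p"
    using that by (simp add: code_valid_def code_end_def)
  have "drop p w = concat (map enc_binary cs) \<and> length cs = Suc m \<longleftrightarrow>
      (\<exists>cs'. cs = code_value w p # cs' \<and> code_valid w p \<and>
        drop (code_end w p) w = concat (map enc_binary cs') \<and> length cs' = m)"
  proof
    assume a: "drop p w = concat (map enc_binary cs) \<and> length cs = Suc m"
    then obtain c cs' where "cs = c # cs'" by (cases cs) auto
    then show "\<exists>cs'. cs = code_value w p # cs' \<and> code_valid w p \<and>
        drop (code_end w p) w = concat (map enc_binary cs') \<and> length cs' = m"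
      using a code_of_enc_binary[of p w c] by auto
  qed (use enc_binary_code_value[of w p] in auto)
  also have "\<dots> \<longleftrightarrow> (\<exists>cs'. cs = code_value w p # cs' \<and> code_valid w p \<and>
      (\<forall>i<m. code_valid w (code_pos w p (Suc i))) \<and> code_pos w p (Suc m) = length w \<and>
      cs' = map (\<lambda>i. code_value w (code_pos w p (Suc i))) [0..<m])"
    using Suc.IH[OF *] unfolding code_pos_Suc by auto
  also have "\<dots> \<longleftrightarrow> (\<forall>i<Suc m. code_valid w (code_pos w p i)) \<and> code_pos w p (Suc m) = length w \<and>
      cs = map (\<lambda>i. code_value w (code_pos w p i)) [0..<Suc m]"
    unfolding map_upt_Suc All_less_Suc2 code_pos_0 by blast
  finally show ?case .
qed

section \<open>Lines of the cube\<close>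

text \<open>A strictly increasing sequence of \<open>n\<close> numbers below \<open>n\<close> has no
  room to skip a value.\<close>

lemma sorted_wrt_less_eq_upt:
  assumes "sorted_wrt (<) xs" "set xs \<subseteq> {..<n::nat}" "length xs = n"
  shows "xs = [0..<n]"
proof -
  have d: "sorted xs" "distinct xs" using assms(1) by (auto simp: strict_sorted_iff)
  then have "card (set xs) = n" using assms(3) by (simp add: distinct_card)
  then have "set xs = set [0..<n]"
    using card_subset_eq[OF finite_lessThan assms(2)] by (simp add: atLeast0LessThan)
  with d show ?thesis by (intro sorted_distinct_set_unique sorted_upt distinct_upt)
qed

lemma sorted_wrt_greater_eq_rev_upt:
  assumes "sorted_wrt (>) xs" "set xs \<subseteq> {..<n::nat}" "length xs = n"
  shows "xs = rev [0..<n]"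
proof -
  have "rev xs = [0..<n]"
    using assms by (intro sorted_wrt_less_eq_upt) (auto simp: sorted_wrt_rev)
  then show ?thesis by (metis rev_rev_ident)
qed

text \<open>
  A coordinate of a line is coded by a number: \<open>c < n\<close> is the constant \<open>c\<close>, \<open>n\<close> is increasing, and
  anything larger is decreasing.
\<close>

definition tval :: "nat \<Rightarrow> nat \<Rightarrow> nat \<Rightarrow> nat" where
  "tval n c t = (if c < n then c else if c = n then t else n - 1 - t)"

definition tpoint :: "nat \<Rightarrow> nat \<Rightarrow> (nat \<Rightarrow> nat) \<Rightarrow> nat \<Rightarrow> nat list" where
  "tpoint n d g t = map (\<lambda>j. tval n (g j) t) [0..<d]"

lemma length_tpoint [simp]: "length (tpoint n d g t) = d"
  by (simp add: tpoint_def)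

lemma nth_tpoint [simp]: "j < d \<Longrightarrow> tpoint n d g t ! j = tval n (g j) t"
  by (simp add: tpoint_def)

lemma tval_less: "t < n \<Longrightarrow> tval n c t < n"
  by (auto simp: tval_def)

lemma tval_inject: "n \<le> c \<Longrightarrow> t < n \<Longrightarrow> t' < n \<Longrightarrow> tval n c t = tval n c t' \<longleftrightarrow> t = t'"
  by (auto simp: tval_def)

text \<open>No two different functions among the constants, the identity and the reflection agree at
  two different parameters. So the values at \<open>s\<close> and \<open>t\<close> decide how
  coordinate \<open>c\<close> moves relative to the moving coordinate \<open>c'\<close>, and hence
  its value at \<open>u\<close>.\<close>

lemma tval_eqI:
  assumes "n \<le> c'" "s < n" "t < n" "u < n" "s \<noteq> t"
    and "(tval n c s = tval n c t \<and> tval n c t = x) \<or>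
      (tval n c s = tval n c' s \<and> tval n c t = tval n c' t \<and> x = tval n c' u) \<or>
      (tval n c s = n - 1 - tval n c' s \<and> tval n c t = n - 1 - tval n c' t \<and> x = n - 1 - tval n c' u)"
  shows "x = tval n c u"
proof -
  consider "c < n" | "c = n" | "n < c" by linarith
  then show ?thesis
  proof cases
    case 1
    show ?thesis by (cases "c' = n") (use 1 assms in \<open>auto simp: tval_def\<close>)
  next
    case 2
    show ?thesis by (cases "c' = n") (use 2 assms in \<open>auto simp: tval_def\<close>)
  next
    case 3
    show ?thesis by (cases "c' = n") (use 3 assms in \<open>auto simp: tval_def\<close>)
  qed
qed

lemma in_cubeD: "p \<in> cube n d \<Longrightarrow> j < d \<Longrightarrow> p ! j < n"
  by (auto simp: cube_def subset_iff)

lemma cube_length: "p \<in> cube n d \<Longrightarrow> length p = d"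
  by (simp add: cube_def)

lemma in_cubeI: "length p = d \<Longrightarrow> (\<And>j. j < d \<Longrightarrow> p ! j < n) \<Longrightarrow> p \<in> cube n d"
  by (auto simp: cube_def in_set_conv_nth)

lemma finite_cube: "finite (cube n d)"
  using finite_set[of "List.n_lists d [0..<n]"] by (simp only: set_n_lists_upt)

lemma tpoint_in_cube: "t < n \<Longrightarrow> tpoint n d g t \<in> cube n d"
  by (rule in_cubeI) (auto simp: tval_less)

text \<open>In a line of \<open>n\<close> points a monotone coordinate runs through all of
  \<open>0, ..., n - 1\<close> in order, so a line is a choice of one pattern per coordinate with at
  least one that moves. A nonconstant coordinate forces two different points, hence \<open>n\<close>
  is at least 2.\<close>

lemma cube_line_iff:
  "cube_line n d l \<longleftrightarrow> 2 \<le> n \<and> (\<exists>g. (\<exists>j<d. n \<le> g j) \<and> l = tpoint n d g ` {..<n})"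
proof
  assume "cube_line n d l"
  then obtain qs where l: "l \<subseteq> cube n d" and qs: "distinct qs" "length qs = n" "set qs = l"
    and mono: "\<And>j. j < d \<Longrightarrow> sorted_wrt (<) (map (\<lambda>q. q ! j) qs) \<or>
               sorted_wrt (>) (map (\<lambda>q. q ! j) qs) \<or>
               (\<forall>q\<in>set qs. \<forall>q'\<in>set qs. q ! j = q' ! j)"
    and nc: "\<exists>j<d. \<not> (\<forall>q\<in>set qs. \<forall>q'\<in>set qs. q ! j = q' ! j)"
    unfolding cube_line_def by blast
  let ?const = "\<lambda>j. \<forall>q\<in>set qs. \<forall>q'\<in>set qs. q ! j = q' ! j"
  define g where "g j = (if ?const j then hd qs ! j
    else if sorted_wrt (<) (map (\<lambda>q. q ! j) qs) then n else Suc n)" for j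
  have n: "2 \<le> n"
  proof (rule ccontr)
    assume "\<not> 2 \<le> n"
    then have "length qs \<le> 1" using qs by simp
    then have "q = q'" if "q \<in> set qs" "q' \<in> set qs" for q q'
      using that by (cases qs) auto
    then show False using nc by blast
  qed
  have "qs ! t = tpoint n d g t" if t: "t < n" for t
  proof (rule nth_equalityI)
    have q: "qs ! t \<in> set qs" using t qs(2) by simp
    then show "length (qs ! t) = length (tpoint n d g t)" using l qs cube_length by auto
    fix j assume "j < length (qs ! t)"
    then have j: "j < d" using q l qs cube_length by auto
    have c: "set (map (\<lambda>q. q ! j) qs) \<subseteq> {..<n}" using l qs in_cubeD[OF _ j] by auto
    have "(qs ! t) ! j = tval n (g j) t"
    proof (cases "?const j")
      case True
      have h: "hd qs \<in> set qs" using qs(2) n by (cases qs) auto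
      have "(qs ! t) ! j = hd qs ! j" using True q h by blast
      moreover have "hd qs ! j < n" using c h by auto
      moreover have "g j = hd qs ! j" unfolding g_def using True by (rule if_P)
      ultimately show ?thesis by (simp add: tval_def)
    next
      case False
      have m: "(qs ! t) ! j = map (\<lambda>q. q ! j) qs ! t" using t qs by simp
      show ?thesis
      proof (cases "sorted_wrt (<) (map (\<lambda>q. q ! j) qs)")
        case True
        then have "map (\<lambda>q. q ! j) qs = [0..<n]" using c qs by (intro sorted_wrt_less_eq_upt) auto
        moreover have "g j = n" unfolding g_def using True False by (simp only: if_False if_True)
        ultimately show ?thesis unfolding m using t by (simp add: tval_def)
      next
        case s: False
        then have "sorted_wrt (>) (map (\<lambda>q. q ! j) qs)" using mono[OF j] False by blast
        then have "map (\<lambda>q. q ! j) qs = rev [0..<n]"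
          using c qs by (intro sorted_wrt_greater_eq_rev_upt) auto
        moreover have "g j = Suc n" unfolding g_def using s False by (simp only: if_False)
        ultimately show ?thesis unfolding m using t by (simp add: tval_def rev_nth)
      qed
    qed
    then show "(qs ! t) ! j = tpoint n d g t ! j" using j by simp
  qed
  then have "l = tpoint n d g ` {..<n}"
    unfolding qs(3)[symmetric] set_conv_nth qs(2) by (auto simp: image_iff) metis
  moreover have "n \<le> g j" if "\<not> ?const j" for j
    unfolding g_def if_not_P[OF that] by simp
  ultimately show "2 \<le> n \<and> (\<exists>g. (\<exists>j<d. n \<le> g j) \<and> l = tpoint n d g ` {..<n})" using n nc by blast
next
  assume "2 \<le> n \<and> (\<exists>g. (\<exists>j<d. n \<le> g j) \<and> l = tpoint n d g ` {..<n})"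
  then obtain g j where n: "2 \<le> n" and j: "j < d" "n \<le> g j" and l: "l = tpoint n d g ` {..<n}" by blast
  let ?qs = "map (tpoint n d g) [0..<n]"
  have inj: "inj_on (tpoint n d g) {..<n}"
    by (rule inj_onI) (metis j lessThan_iff nth_tpoint tval_inject)
  have "distinct ?qs" "length ?qs = n" "set ?qs = l"
    using inj by (auto simp: distinct_map l atLeast0LessThan)
  moreover have "l \<subseteq> cube n d" using tpoint_in_cube l by auto
  moreover have "sorted_wrt (<) (map (\<lambda>q. q ! i) ?qs) \<or> sorted_wrt (>) (map (\<lambda>q. q ! i) ?qs) \<or>
      (\<forall>q\<in>set ?qs. \<forall>q'\<in>set ?qs. q ! i = q' ! i)" if i: "i < d" for i
  proof -
    consider "g i < n" | "g i = n" | "n < g i" by linarith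
    then show ?thesis
    proof cases
      case 1
      then show ?thesis using i by (auto simp: tval_def)
    next
      case 2
      then have "map (\<lambda>q. q ! i) ?qs = [0..<n]" using i by (intro nth_equalityI) (auto simp: tval_def)
      then show ?thesis by simp
    next
      case 3
      then have "map (\<lambda>q. q ! i) ?qs = rev [0..<n]"
        using i by (intro nth_equalityI) (auto simp: tval_def rev_nth)
      then show ?thesis by (simp add: sorted_wrt_rev)
    qed
  qed
  moreover have "\<not> (\<forall>q\<in>set ?qs. \<forall>q'\<in>set ?qs. q ! j = q' ! j)"
  proof
    assume "\<forall>q\<in>set ?qs. \<forall>q'\<in>set ?qs. q ! j = q' ! j"
    moreover have "tpoint n d g 0 \<in> set ?qs" "tpoint n d g 1 \<in> set ?qs" using n by auto
    ultimately have "tpoint n d g 0 ! j = tpoint n d g 1 ! j" by blast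
    then show False using j n by (simp add: tval_inject)
  qed
  ultimately show "cube_line n d l" unfolding cube_line_def using j by blast
qed

text \<open>\<open>j\<close> is a coordinate that moves along the line and serves as its parameter;
  every other coordinate is constant, follows \<open>j\<close> or is its reflection. Points enter as
  functions so that the digits of a point number can be used directly.\<close>

definition collinear :: "nat \<Rightarrow> nat \<Rightarrow> (nat \<Rightarrow> nat) \<Rightarrow> (nat \<Rightarrow> nat) \<Rightarrow> (nat \<Rightarrow> nat) \<Rightarrow> bool" where
  "collinear n d a b c \<longleftrightarrow> (\<exists>j<d. a j \<noteq> b j \<and>
     (\<forall>i<d. (a i = b i \<and> b i = c i) \<or> (a i = a j \<and> b i = b j \<and> c i = c j) \<or>
        (a i = n - 1 - a j \<and> b i = n - 1 - b j \<and> c i = n - 1 - c j)))"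

lemma cube_line_eq_collinear:
  assumes l: "cube_line n d l" and ab: "a \<in> l" "b \<in> l" "a \<noteq> b"
  shows "l = {c \<in> cube n d. collinear n d ((!) a) ((!) b) ((!) c)}"
proof -
  obtain g j where n: "2 \<le> n" and j: "j < d" "n \<le> g j" and l: "l = tpoint n d g ` {..<n}"
    using l unfolding cube_line_iff by blast
  obtain s t where st: "s < n" "t < n" "a = tpoint n d g s" "b = tpoint n d g t" "s \<noteq> t"
    using ab l by auto
  show ?thesis
  proof (intro set_eqI iffI)
    fix c assume "c \<in> l"
    then obtain u where u: "u < n" "c = tpoint n d g u" using l by auto
    have "collinear n d ((!) a) ((!) b) ((!) c)"
      unfolding collinear_def
    proof (intro exI[of _ j] conjI allI impI)
      show "a ! j \<noteq> b ! j" using st j by (simp add: tval_inject)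
      fix i assume i: "i < d"
      show "(a ! i = b ! i \<and> b ! i = c ! i) \<or> (a ! i = a ! j \<and> b ! i = b ! j \<and> c ! i = c ! j) \<or>
        (a ! i = n - 1 - a ! j \<and> b ! i = n - 1 - b ! j \<and> c ! i = n - 1 - c ! j)"
        using st u i j by (auto simp: tval_def)
    qed (rule j)
    then show "c \<in> {c \<in> cube n d. collinear n d ((!) a) ((!) b) ((!) c)}"
      using u tpoint_in_cube by simp
  next
    fix c assume "c \<in> {c \<in> cube n d. collinear n d ((!) a) ((!) b) ((!) c)}"
    then obtain k where c: "c \<in> cube n d" and k: "k < d" "a ! k \<noteq> b ! k"
      and K: "\<And>i. i < d \<Longrightarrow> (a ! i = b ! i \<and> b ! i = c ! i) \<or>
        (a ! i = a ! k \<and> b ! i = b ! k \<and> c ! i = c ! k) \<or>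
        (a ! i = n - 1 - a ! k \<and> b ! i = n - 1 - b ! k \<and> c ! i = n - 1 - c ! k)"
      unfolding collinear_def by blast
    have gk: "n \<le> g k" using k st by (auto simp: tval_def split: if_splits)
    have ck: "c ! k < n" using c k in_cubeD by blast
    \<comment> \<open>The parameter at which coordinate \<open>k\<close> of the line has the value
      \<open>c ! k\<close>.\<close>
    define u where "u = (if g k = n then c ! k else n - 1 - c ! k)"
    have u: "u < n" using ck by (auto simp: u_def)
    have "c = tpoint n d g u"
    proof (rule nth_equalityI)
      fix i assume "i < length c"
      then have i: "i < d" using c cube_length by auto
      have i': "a ! i = tval n (g i) s" "b ! i = tval n (g i) t" using st i by auto
      have k': "a ! k = tval n (g k) s" "b ! k = tval n (g k) t" "c ! k = tval n (g k) u"
        using st k ck gk by (auto simp: tval_def u_def)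
      have "c ! i = tval n (g i) u"
        using K[OF i] unfolding i' k' by (rule tval_eqI[OF gk st(1,2) u st(5)])
      then show "c ! i = tpoint n d g u ! i" using i by simp
    qed (use c cube_length in auto)
    then show "c \<in> l" using l u by blast
  qed
qed

lemma collinear_in_cube_line:
  assumes abc: "a \<in> cube n d" "b \<in> cube n d" "c \<in> cube n d"
    and "collinear n d ((!) a) ((!) b) ((!) c)"
  shows "\<exists>l. cube_line n d l \<and> a \<in> l \<and> b \<in> l \<and> c \<in> l"
proof -
  obtain k where k: "k < d" "a ! k \<noteq> b ! k"
      and K: "\<And>i. i < d \<Longrightarrow> (a ! i = b ! i \<and> b ! i = c ! i) \<or>
        (a ! i = a ! k \<and> b ! i = b ! k \<and> c ! i = c ! k) \<or>
        (a ! i = n - 1 - a ! k \<and> b ! i = n - 1 - b ! k \<and> c ! i = n - 1 - c ! k)"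
    using assms(4) unfolding collinear_def by blast
  have k': "a ! k < n" "b ! k < n" "c ! k < n" using abc k in_cubeD by blast+
  \<comment> \<open>Patterns of a line parametrized by its \<open>k\<close>-th coordinate, which
    itself becomes increasing.\<close>
  define g where "g i = (if a ! i = b ! i then a ! i
    else if a ! i = a ! k \<and> b ! i = b ! k \<and> c ! i = c ! k then n else Suc n)" for i
  have 1: "a ! i = tval n (g i) (a ! k)" "b ! i = tval n (g i) (b ! k)" "c ! i = tval n (g i) (c ! k)"
    if "i < d" for i
  proof -
    have "a ! i < n" "b ! i < n" "c ! i < n" using abc that in_cubeD by blast+
    then show "a ! i = tval n (g i) (a ! k)" "b ! i = tval n (g i) (b ! k)"
      "c ! i = tval n (g i) (c ! k)"
      using K[OF that] k k' by (auto simp: g_def tval_def)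
  qed
  have "a = tpoint n d g (a ! k)" "b = tpoint n d g (b ! k)" "c = tpoint n d g (c ! k)"
    using abc 1 cube_length by (auto intro!: nth_equalityI)
  moreover have "cube_line n d (tpoint n d g ` {..<n})"
    unfolding cube_line_iff using k k' by (intro conjI exI[of _ g] exI[of _ k]) (auto simp: g_def)
  ultimately show ?thesis using k' by blast
qed

lemma cube_line_subset: "cube_line n d l \<Longrightarrow> l \<subseteq> cube n d"
  by (simp add: cube_line_def)

text \<open>Automorphisms are required only to send lines to lines. As there are finitely many
  lines, the injective map on them is onto, so preimages of lines are lines.\<close>

lemma cube_line_image_iff:
  assumes P: "cube_automorphism n d P" and l: "l \<subseteq> cube n d"
  shows "cube_line n d (P ` l) \<longleftrightarrow> cube_line n d l"
proof
  assume line: "cube_line n d (P ` l)"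
  let ?L = "{l. cube_line n d l}"
  have inj: "inj_on P (cube n d)" using P by (auto simp: cube_automorphism_def bij_betw_def)
  have "?L \<subseteq> Pow (cube n d)" using cube_line_subset by auto
  then have "finite ?L" using finite_cube finite_subset by (metis finite_Pow_iff)
  moreover have "inj_on ((`) P) ?L"
    using inj by (intro inj_onI) (metis cube_line_subset inj_on_image_eq_iff mem_Collect_eq)
  moreover have "(`) P ` ?L \<subseteq> ?L" using P by (auto simp: cube_automorphism_def)
  ultimately have "(`) P ` ?L = ?L" by (intro endo_inj_surj)
  then obtain l' where "cube_line n d l'" "P ` l = P ` l'" using line by blast
  then show "cube_line n d l" using inj_on_image_eq_iff[OF inj l cube_line_subset] by blast
qed (use P in \<open>auto simp: cube_automorphism_def\<close>)

section \<open>Automorphisms of the square grid of even side\<close>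

lemma cube_2: "cube n 2 = {[i, j] |i j. i < n \<and> j < n}"
  by (auto simp: cube_def length_Suc_conv numeral_2_eq_2)

definition row :: "nat \<Rightarrow> nat \<Rightarrow> nat list set" where
  "row n i = (\<lambda>t. [i, t]) ` {..<n}"

definition column :: "nat \<Rightarrow> nat \<Rightarrow> nat list set" where
  "column n j = (\<lambda>t. [t, j]) ` {..<n}"

definition diagonal :: "nat \<Rightarrow> nat list set" where
  "diagonal n = (\<lambda>t. [t, t]) ` {..<n}"

definition antidiagonal :: "nat \<Rightarrow> nat list set" where
  "antidiagonal n = (\<lambda>t. [t, n - 1 - t]) ` {..<n}"

text \<open>Running backwards through a line gives the same set, which lets a decreasing
  parametrization be replaced by an increasing one.\<close>

lemma image_reflect: "(\<lambda>t. f (n - 1 - t)) ` {..<n} = f ` {..<n::nat}"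
proof -
  have "(\<lambda>t. n - 1 - t) ` {..<n} = {..<n}"
    by (rule endo_inj_surj) (auto intro: inj_onI)
  then have "f ` (\<lambda>t. n - 1 - t) ` {..<n} = f ` {..<n}" by simp
  then show ?thesis by (simp add: image_image)
qed

lemma cube_line_2_iff:
  "cube_line n 2 l \<longleftrightarrow> 2 \<le> n \<and>
    ((\<exists>i<n. l = row n i) \<or> (\<exists>j<n. l = column n j) \<or> l = diagonal n \<or> l = antidiagonal n)"
proof -
  have t: "tpoint n 2 g = (\<lambda>t. [tval n (g 0) t, tval n (g 1) t])" for g
    by (auto simp: tpoint_def numeral_2_eq_2)
  have inc: "tval n n = (\<lambda>t. t)" and dec: "tval n (Suc n) = (\<lambda>t. n - 1 - t)"
    and const: "i < n \<Longrightarrow> tval n i = (\<lambda>t. i)" for i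
    by (auto simp: tval_def)
  show ?thesis
  proof
    assume "cube_line n 2 l"
    then obtain g where n: "2 \<le> n" and g: "\<exists>j<2. n \<le> g j" and l: "l = tpoint n 2 g ` {..<n}"
      unfolding cube_line_iff by blast
    \<comment> \<open>Every code above \<open>n\<close> means decreasing, so it may be replaced by
      \<open>Suc n\<close>.\<close>
    have c: "tval n c = tval n (min c (Suc n))" for c by (auto simp: tval_def)
    have "g 0 < n \<or> min (g 0) (Suc n) = n \<or> min (g 0) (Suc n) = Suc n"
      "g 1 < n \<or> min (g 1) (Suc n) = n \<or> min (g 1) (Suc n) = Suc n" by auto
    moreover have "n \<le> g 0 \<or> n \<le> g 1" using g by (auto simp: less_2_cases_iff)
    ultimately consider "g 0 < n" "tval n (g 1) = tval n n"
      | "g 0 < n" "tval n (g 1) = tval n (Suc n)"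
      | "g 1 < n" "tval n (g 0) = tval n n"
      | "g 1 < n" "tval n (g 0) = tval n (Suc n)"
      | "tval n (g 0) = tval n n" "tval n (g 1) = tval n n"
      | "tval n (g 0) = tval n n" "tval n (g 1) = tval n (Suc n)"
      | "tval n (g 0) = tval n (Suc n)" "tval n (g 1) = tval n n"
      | "tval n (g 0) = tval n (Suc n)" "tval n (g 1) = tval n (Suc n)"
      using c[of "g 0"] c[of "g 1"] by (metis not_less)
    then have "(\<exists>i<n. l = row n i) \<or> (\<exists>j<n. l = column n j) \<or> l = diagonal n \<or> l = antidiagonal n"
    proof cases
      case 1
      then show ?thesis by (auto simp: l t inc const row_def)
    next
      case 2
      then show ?thesis using image_reflect[of "\<lambda>t. [g 0, t]" n]
        by (auto simp: l t dec const row_def)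
    next
      case 3
      then show ?thesis by (auto simp: l t inc const column_def)
    next
      case 4
      then show ?thesis using image_reflect[of "\<lambda>t. [t, g 1]" n]
        by (auto simp: l t dec const column_def)
    next
      case 5
      then show ?thesis by (auto simp: l t inc diagonal_def)
    next
      case 6
      then show ?thesis by (auto simp: l t inc dec antidiagonal_def)
    next
      case 7
      have "(\<lambda>t. [n - 1 - t, t]) ` {..<n} = (\<lambda>t. [n - 1 - t, n - 1 - (n - 1 - t)]) ` {..<n}"
        by (intro image_cong) auto
      then show ?thesis using 7 image_reflect[of "\<lambda>t. [t, n - 1 - t]" n]
        by (auto simp: l t inc dec antidiagonal_def)
    next
      case 8
      then show ?thesis using image_reflect[of "\<lambda>t. [t, t]" n]
        by (auto simp: l t dec diagonal_def)
    qed
    then show "2 \<le> n \<and> ((\<exists>i<n. l = row n i) \<or> (\<exists>j<n. l = column n j) \<or> l = diagonal n \<or>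
        l = antidiagonal n)" using n by blast
  next
    assume *: "2 \<le> n \<and> ((\<exists>i<n. l = row n i) \<or> (\<exists>j<n. l = column n j) \<or> l = diagonal n \<or>
        l = antidiagonal n)"
    have line: "cube_line n 2 (tpoint n 2 g ` {..<n})" if "n \<le> g 0 \<or> n \<le> g 1" for g
      unfolding cube_line_iff using * that by (auto simp: less_2_cases_iff)
    from * consider i where "i < n" "l = row n i" | j where "j < n" "l = column n j"
      | "l = diagonal n" | "l = antidiagonal n" by blast
    then show "cube_line n 2 l"
    proof cases
      case (1 i)
      then show ?thesis using line[of "\<lambda>j. if j = 0 then i else n"] by (simp add: t inc const row_def)
    next
      case (2 j)
      then show ?thesis using line[of "\<lambda>i. if i = 0 then n else j"] by (simp add: t inc const column_def)
    next
      case 3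
      then show ?thesis using line[of "\<lambda>i. n"] by (simp add: t inc diagonal_def)
    next
      case 4
      then show ?thesis using line[of "\<lambda>i. if i = 0 then n else Suc n"]
        by (simp add: t inc dec antidiagonal_def)
    qed
  qed
qed

lemma mem_line_2 [simp]:
  "[a, b] \<in> row n i \<longleftrightarrow> a = i \<and> b < n"
  "[a, b] \<in> column n j \<longleftrightarrow> b = j \<and> a < n"
  "[a, b] \<in> diagonal n \<longleftrightarrow> a = b \<and> a < n"
  "[a, b] \<in> antidiagonal n \<longleftrightarrow> b = n - 1 - a \<and> a < n"
  by (auto simp: row_def column_def diagonal_def antidiagonal_def)

definition mirror :: "nat \<Rightarrow> nat \<Rightarrow> nat" where
  "mirror n i = min i (n - 1 - i)"

lemma mirror_eq_iff: "i < n \<Longrightarrow> j < n \<Longrightarrow> mirror n i = mirror n j \<longleftrightarrow> j = i \<or> j = n - 1 - i"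
  by (auto simp: mirror_def min_def)

lemma mirror_reflect: "i < n \<Longrightarrow> mirror n (n - 1 - i) = mirror n i"
  by (auto simp: mirror_def min_def)

lemma mirror_less: "i < 2 * N \<Longrightarrow> mirror (2 * N) i < N"
  by (auto simp: mirror_def min_def)

lemma mirror_id: "i < N \<Longrightarrow> mirror (2 * N) i = i"
  by (auto simp: mirror_def min_def)

text \<open>With \<open>N\<close> at least 2 there are two different reflection classes, so every
  row and every column has points off the diagonals.\<close>

locale even_grid_automorphism =
  fixes N n :: nat and P :: "nat list \<Rightarrow> nat list"
  assumes N: "2 \<le> N" and n: "n = 2 * N" and P: "cube_automorphism n 2 P"
begin

text \<open>The union of the two diagonals, by \<open>mirror_eq_iff\<close>.\<close>

definition X :: "nat list set" where
  "X = {[i, j] |i j. i < n \<and> j < n \<and> mirror n i = mirror n j}"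

lemma in_X [simp]: "[i, j] \<in> X \<longleftrightarrow> i < n \<and> j < n \<and> mirror n i = mirror n j"
  by (auto simp: X_def)

lemma inj_P: "inj_on P (cube n 2)"
  using P by (auto simp: cube_automorphism_def bij_betw_def)

lemma P_in_cube: "p \<in> cube n 2 \<Longrightarrow> P p \<in> cube n 2"
  using P by (auto simp: cube_automorphism_def bij_betw_def)

lemma line_image: "cube_line n 2 l \<Longrightarrow> cube_line n 2 (P ` l)"
  using P by (simp add: cube_automorphism_def)

lemma line_image_eqD: "cube_line n 2 l \<Longrightarrow> cube_line n 2 l' \<Longrightarrow> P ` l = P ` l' \<Longrightarrow> l = l'"
  using inj_on_image_eq_iff[OF inj_P cube_line_subset cube_line_subset] by blast

lemma lines: "cube_line n 2 l \<longleftrightarrow>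
    (\<exists>i<n. l = row n i) \<or> (\<exists>j<n. l = column n j) \<or> l = diagonal n \<or> l = antidiagonal n"
  using N n by (simp add: cube_line_2_iff)

lemma diagonals_subset_X: "diagonal n \<subseteq> X" "antidiagonal n \<subseteq> X"
  by (auto simp: diagonal_def antidiagonal_def mirror_reflect[simplified])

lemma line_through_not_X:
  assumes "cube_line n 2 l" "[a, b] \<in> l" "[a, b] \<notin> X"
  shows "l = row n a \<or> l = column n b"
  using assms diagonals_subset_X unfolding lines by auto

text \<open>Points of the two diagonals lie on three lines, all other points on two.\<close>

lemma P_in_X:
  assumes "p \<in> X"
  shows "P p \<in> X"
proof (rule ccontr)
  assume no: "P p \<notin> X"
  obtain i j where p: "p = [i, j]" "i < n" "j < n" "mirror n i = mirror n j"
    using assms by (auto simp: X_def)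
  define d where "d = (if i = j then diagonal n else antidiagonal n)"
  have "p \<in> d" using p by (auto simp: d_def mirror_eq_iff)
  obtain a b where ab: "P p = [a, b]" using P_in_cube[of p] p by (auto simp: cube_2)
  have ls: "cube_line n 2 (row n i)" "cube_line n 2 (column n j)" "cube_line n 2 d"
    using p by (auto simp: lines d_def)
  have ps: "p \<in> row n i" "p \<in> column n j" "p \<in> d" using p \<open>p \<in> d\<close> by auto
  have two: "P ` l = row n a \<or> P ` l = column n b" if "cube_line n 2 l" "p \<in> l" for l
    using line_through_not_X[OF line_image[OF that(1)], of a b] that(2) no ab by (metis imageI)
  \<comment> \<open>An index different from \<open>i\<close> and \<open>j\<close> gives points that
    tell the row, the column and the diagonal apart; three distinct lines cannot have their images
    among only two.\<close>
  obtain k where k: "k < n" "k \<noteq> j" "k \<noteq> i"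
  proof -
    have "card {i, j} < card {..<n}" using N n by (auto simp: card_insert_if)
    then have "\<not> {..<n} \<subseteq> {i, j}" using card_mono[of "{i, j}" "{..<n}"] by auto
    then show ?thesis using that by auto
  qed
  have "[i, k] \<notin> column n j" "[i, k] \<in> row n i" using k by auto
  moreover have "[i, k] \<notin> d" "[k, j] \<notin> d"
  proof -
    show "[i, k] \<notin> d" using k p by (auto simp: d_def mirror_eq_iff split: if_splits)
    show "[k, j] \<notin> d" using k p by (auto simp: d_def mirror_eq_iff split: if_splits)
  qed
  moreover have "[k, j] \<in> column n j" using k by auto
  ultimately have "row n i \<noteq> column n j" "row n i \<noteq> d" "column n j \<noteq> d" by blast+
  then show False using two[OF ls(1) ps(1)] two[OF ls(2) ps(2)] two[OF ls(3) ps(3)]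
      line_image_eqD[OF ls(1,2)] line_image_eqD[OF ls(1,3)] line_image_eqD[OF ls(2,3)] by metis
qed

lemma X_subset: "X \<subseteq> cube n 2"
  by (auto simp: X_def cube_2)

text \<open>\<open>P\<close> is injective and maps the finite set \<open>X\<close> into itself,
  hence onto itself.\<close>

lemma P_in_X_iff:
  assumes "p \<in> cube n 2"
  shows "P p \<in> X \<longleftrightarrow> p \<in> X"
proof
  assume "P p \<in> X"
  have "P ` X = X"
    using P_in_X X_subset inj_P finite_cube finite_subset inj_on_subset
    by (intro endo_inj_surj) blast+
  then obtain p' where "p' \<in> X" "P p = P p'" using \<open>P p \<in> X\<close> by blast
  then show "p \<in> X" using inj_P assms X_subset by (metis inj_onD subsetD)
qed (rule P_in_X)

text \<open>The line contains a point off the diagonals, whose image is off them too, so the image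
  line is neither diagonal.\<close>

lemma image_row_or_column:
  assumes "cube_line n 2 l" "[a, b] \<in> l" "mirror n a \<noteq> mirror n b"
  shows "(\<exists>i<n. P ` l = row n i) \<or> (\<exists>j<n. P ` l = column n j)"
proof -
  have "[a, b] \<in> cube n 2" using assms cube_line_subset by blast
  then have "P [a, b] \<notin> X" using P_in_X_iff assms by simp
  then have "P ` l \<noteq> diagonal n" "P ` l \<noteq> antidiagonal n"
    using assms(2) diagonals_subset_X by blast+
  then show ?thesis using line_image[OF assms(1)] unfolding lines by blast
qed

lemma ex_mirror_ne: "\<exists>k<n. mirror n k \<noteq> mirror n i"
proof -
  have "mirror n 0 \<noteq> mirror n 1" "0 < n" "1 < n" using N n by (auto simp: mirror_def)
  then show ?thesis by (cases "mirror n 0 = mirror n i") metis+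
qed

lemma row_image:
  assumes "i < n"
  shows "(\<exists>k<n. P ` row n i = row n k) \<or> (\<exists>k<n. P ` row n i = column n k)"
proof -
  obtain k where "k < n" "mirror n k \<noteq> mirror n i" using ex_mirror_ne by blast
  then show ?thesis using assms image_row_or_column[of "row n i" i k] by (auto simp: lines)
qed

lemma column_image:
  assumes "i < n"
  shows "(\<exists>k<n. P ` column n i = row n k) \<or> (\<exists>k<n. P ` column n i = column n k)"
proof -
  obtain k where "k < n" "mirror n k \<noteq> mirror n i" using ex_mirror_ne by blast
  then show ?thesis using assms image_row_or_column[of "column n i" k i] by (auto simp: lines)
qed

text \<open>Distinct rows are disjoint, while every row meets every column. Hence if one row goes to
  a row, all rows do, and no column can go to a row; a point is then located by the images of its
  row and its column.\<close>

lemma product_form: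
  assumes r: "P ` row n 0 = row n r"
  obtains \<sigma> \<tau> where "\<And>i j. i < n \<Longrightarrow> j < n \<Longrightarrow> P [i, j] = [\<sigma> i, \<tau> j] \<and> \<sigma> i < n \<and> \<tau> j < n"
proof -
  have n0: "0 < n" using N n by simp
  have cube: "[i, j] \<in> cube n 2" if "i < n" "j < n" for i j using that by (simp add: cube_2)
  have ln: "cube_line n 2 (row n i)" "cube_line n 2 (column n i)" if "i < n" for i
    using that by (auto simp: lines)
  have rn: "r < n"
  proof -
    have "P [0, 0] \<in> row n r" using r n0 by (metis imageI mem_line_2(1))
    moreover have "P [0, 0] \<in> cube n 2" using P_in_cube cube n0 by blast
    ultimately show ?thesis by (auto simp: row_def cube_2)
  qed
  have rows: "\<exists>k<n. P ` row n i = row n k" if i: "i < n" for i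
  proof (cases "i = 0")
    case True
    then show ?thesis using r rn by blast
  next
    case False
    have "\<not> (\<exists>k<n. P ` row n i = column n k)"
    proof
      assume "\<exists>k<n. P ` row n i = column n k"
      then obtain k where k: "k < n" "P ` row n i = column n k" by blast
      then have "[r, k] \<in> P ` row n i" "[r, k] \<in> P ` row n 0" using r rn by auto
      then have "row n i \<inter> row n 0 \<noteq> {}"
        using inj_on_image_Int[OF inj_P, of "row n i" "row n 0"] cube_line_subset ln i n0 by blast
      then show False using False by (auto simp: row_def)
    qed
    then show ?thesis using row_image[OF i] by blast
  qed
  have columns: "\<exists>k<n. P ` column n j = column n k" if j: "j < n" for j
  proof -
    have "\<not> (\<exists>k<n. P ` column n j = row n k)"
    proof
      assume "\<exists>k<n. P ` column n j = row n k"
      then obtain k where k: "P ` column n j = row n k" by blast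
      have "P [0, j] \<in> row n k" "P [0, j] \<in> row n r"
        using j n0 unfolding k[symmetric] r[symmetric] by auto
      then have "k = r" by (auto simp: row_def)
      then have "column n j = row n 0" using k r line_image_eqD ln j n0 by metis
      moreover have "[1, j] \<in> column n j" "[1, j] \<notin> row n 0" using N n by auto
      ultimately show False by blast
    qed
    then show ?thesis using column_image[OF j] by blast
  qed
  obtain \<sigma> where \<sigma>: "\<And>i. i < n \<Longrightarrow> \<sigma> i < n \<and> P ` row n i = row n (\<sigma> i)" using rows by metis
  obtain \<tau> where \<tau>: "\<And>i. i < n \<Longrightarrow> \<tau> i < n \<and> P ` column n i = column n (\<tau> i)" using columns by metis
  have "P [i, j] = [\<sigma> i, \<tau> j]" if "i < n" "j < n" for i j
  proof -
    have "P [i, j] \<in> P ` row n i" "P [i, j] \<in> P ` column n j" using that by auto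
    then have "P [i, j] \<in> row n (\<sigma> i)" "P [i, j] \<in> column n (\<tau> j)" using \<sigma> \<tau> that by auto
    then show ?thesis by (auto simp: row_def column_def)
  qed
  then show ?thesis using \<sigma> \<tau> by (intro that[of \<sigma> \<tau>]) simp
qed

end

section \<open>Isomorphic graphs and isomorphic grids\<close>

definition mirror_coloring :: "nat \<Rightarrow> nat set set \<Rightarrow> nat list \<Rightarrow> nat" where
  "mirror_coloring N E p = of_bool ({mirror (2 * N) (p ! 0), mirror (2 * N) (p ! 1)} \<in> E)"

text \<open>The vertex map is the permutation of classes induced by \<sigma>. Preservation of the
  diagonals makes \<tau> induce the same one, so equality of colors at \<open>[u, v]\<close>
  compares an edge with its image.\<close>

lemma (in even_grid_automorphism) graph_isomorphic_if_row:
  assumes r: "P ` row n 0 = row n r"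
    and col: "\<And>v. v \<in> cube n 2 \<Longrightarrow> mirror_coloring N E v = mirror_coloring N F (P v)"
  shows "graph_isomorphic (N, E) (N, F)"
proof -
  obtain \<sigma> \<tau> where \<sigma>\<tau>: "\<And>i j. i < n \<Longrightarrow> j < n \<Longrightarrow> P [i, j] = [\<sigma> i, \<tau> j] \<and> \<sigma> i < n \<and> \<tau> j < n"
    using product_form[OF r] by blast
  have n0: "0 < n" using N n by simp
  have cube: "[i, j] \<in> cube n 2" if "i < n" "j < n" for i j using that by (simp add: cube_2)
  have q: "mirror n (\<sigma> i) = mirror n (\<tau> j)" if "i < n" "j < n" "mirror n i = mirror n j" for i j
    using P_in_X[of "[i, j]"] \<sigma>\<tau> that by simp
  have \<sigma>_inj: "i = i'" if "\<sigma> i = \<sigma> i'" "i < n" "i' < n" for i i'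
    using inj_onD[OF inj_P, of "[i, 0]" "[i', 0]"] \<sigma>\<tau> that n0 cube by auto
  have q\<sigma>: "mirror n (\<sigma> (n - 1 - i)) = mirror n (\<sigma> i)" if "i < n" for i
    using q[of "n - 1 - i" "n - 1 - i"] q[of i "n - 1 - i"] that mirror_reflect[OF that] by simp
  define \<pi> where "\<pi> v = mirror n (\<sigma> v)" for v
  have "inj_on \<pi> {..<N}"
  proof (rule inj_onI)
    fix u v assume "u \<in> {..<N}" "v \<in> {..<N}" "\<pi> u = \<pi> v"
    then have uv: "u < N" "v < N" "u < n" "v < n" "mirror n (\<sigma> u) = mirror n (\<sigma> v)"
      using n by (auto simp: \<pi>_def)
    \<comment> \<open>As \<open>n\<close> is even, \<open>u\<close> differs from its reflection, so
      the two images under \<sigma> fill the class of \<open>\<sigma> u\<close>;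
      \<open>\<sigma> v\<close> lies in this class and must be one of them.\<close>
    have "\<sigma> (n - 1 - u) \<noteq> \<sigma> u" using \<sigma>_inj[of "n - 1 - u" u] uv n by auto
    then have "\<sigma> (n - 1 - u) = n - 1 - \<sigma> u"
      using q\<sigma>[OF uv(3)] \<sigma>\<tau> n0 uv(3) mirror_eq_iff[of "\<sigma> u" n "\<sigma> (n - 1 - u)"] by auto
    moreover have "\<sigma> v = \<sigma> u \<or> \<sigma> v = n - 1 - \<sigma> u"
      using uv \<sigma>\<tau> n0 mirror_eq_iff[of "\<sigma> u" n "\<sigma> v"] by auto
    ultimately have "v = u \<or> v = n - 1 - u"
      using \<sigma>_inj[of v u] \<sigma>_inj[of v "n - 1 - u"] uv by auto
    then show "u = v" using uv n by auto
  qed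
  moreover have "\<pi> ` {..<N} \<subseteq> {..<N}"
  proof
    fix x assume "x \<in> \<pi> ` {..<N}"
    then obtain u where "u < N" "x = mirror n (\<sigma> u)" by (auto simp: \<pi>_def)
    then show "x \<in> {..<N}" using \<sigma>\<tau>[of u 0] n n0 mirror_less[of "\<sigma> u" N] by simp
  qed
  ultimately have bij: "bij_betw \<pi> {..<N} {..<N}"
    by (simp add: bij_betw_def endo_inj_surj)
  have "{u, v} \<in> E \<longleftrightarrow> {\<pi> u, \<pi> v} \<in> F" if "u < N" "v < N" for u v
  proof -
    have uv: "u < n" "v < n" using that n by auto
    have "mirror_coloring N E [u, v] = mirror_coloring N F [\<sigma> u, \<tau> v]"
      using col[OF cube[OF uv]] \<sigma>\<tau>[OF uv] by simp
    moreover have "mirror n (\<tau> v) = \<pi> v" using q[OF uv(2,2)] by (simp add: \<pi>_def)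
    ultimately show ?thesis
      using that n by (simp add: mirror_coloring_def mirror_id \<pi>_def of_bool_eq_iff)
  qed
  then show ?thesis using bij by (auto simp: graph_isomorphic_def)
qed

text \<open>Composing with the transposition of coordinates reduces an automorphism that takes rows
  to columns to one that takes rows to rows.\<close>

lemma swap_automorphism:
  assumes "cube_automorphism n 2 P"
  shows "cube_automorphism n 2 (\<lambda>p. rev (P p))"
proof -
  have c: "rev ` cube n 2 = cube n 2"
    by (rule endo_inj_surj[OF finite_cube]) (auto simp: cube_def intro: inj_onI)
  have b: "bij_betw P (cube n 2) (cube n 2)" using assms by (simp add: cube_automorphism_def)
  moreover have "bij_betw rev (cube n 2) (cube n 2)" using c by (simp add: bij_betw_def)
  ultimately have "bij_betw (\<lambda>p. rev (P p)) (cube n 2) (cube n 2)"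
    using bij_betw_trans[of P "cube n 2" "cube n 2" rev] by (simp add: comp_def)
  moreover have "rev ` row n i = column n i" "rev ` column n i = row n i" "rev ` diagonal n = diagonal n" for i
    by (auto simp: row_def column_def diagonal_def image_image)
  moreover have "rev ` antidiagonal n = antidiagonal n"
  proof -
    have "rev ` antidiagonal n = (\<lambda>t. [n - 1 - t, n - 1 - (n - 1 - t)]) ` {..<n}"
      unfolding antidiagonal_def image_image by (intro image_cong) auto
    then show ?thesis
      using image_reflect[of "\<lambda>t. [t, n - 1 - t]" n] by (simp add: antidiagonal_def)
  qed
  ultimately have *: "cube_line n 2 (rev ` l)" if "cube_line n 2 l" for l
    using that unfolding cube_line_2_iff by metis
  have "(\<lambda>p. rev (P p)) ` l = rev ` P ` l" for l by (simp add: image_image)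
  then show ?thesis
    using assms * \<open>bij_betw (\<lambda>p. rev (P p)) (cube n 2) (cube n 2)\<close> by (auto simp: cube_automorphism_def)
qed

lemma mirror_coloring_rev:
  assumes "p \<in> cube n 2"
  shows "mirror_coloring N E (rev p) = mirror_coloring N E p"
  using assms by (auto simp: cube_2 mirror_coloring_def insert_commute)

lemma graph_isomorphic_if_cubes_isomorphic:
  assumes "simple_graph (N, E)" "simple_graph (N, F)"
    and iso: "colored_cubes_isomorphic (2 * N) 2 (mirror_coloring N E) (mirror_coloring N F)"
  shows "graph_isomorphic (N, E) (N, F)"
proof (cases "2 \<le> N")
  case True
  obtain P where P: "cube_automorphism (2 * N) 2 P"
    and col: "\<And>v. v \<in> cube (2 * N) 2 \<Longrightarrow> mirror_coloring N E v = mirror_coloring N F (P v)"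
    using iso by (auto simp: colored_cubes_isomorphic_def)
  interpret P: even_grid_automorphism N "2 * N" P by unfold_locales (use True P in auto)
  interpret R: even_grid_automorphism N "2 * N" "\<lambda>p. rev (P p)"
    by unfold_locales (use True swap_automorphism[OF P] in auto)
  from P.row_image[of 0] True consider k where "P ` row (2 * N) 0 = row (2 * N) k"
    | k where "P ` row (2 * N) 0 = column (2 * N) k" by auto
  then show ?thesis
  proof cases
    case 1
    then show ?thesis using P.graph_isomorphic_if_row col by blast
  next
    case 2
    have "(\<lambda>p. rev (P p)) ` row (2 * N) 0 = rev ` P ` row (2 * N) 0" by (simp add: image_image)
    also have "\<dots> = row (2 * N) k" unfolding 2 by (auto simp: row_def column_def image_image)
    finally show ?thesis
      using R.graph_isomorphic_if_row[of k E F] col P.P_in_cube mirror_coloring_rev by metis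
  qed
next
  case False
  \<comment> \<open>With fewer than two vertices neither graph has an edge.\<close>
  have "{u, v} \<in> E \<longleftrightarrow> {u, v} \<in> F" if "u < N" "v < N" for u v
    using that False assms simple_graph_edge_ne[of N E u v] simple_graph_edge_ne[of N F u v] by auto
  then show ?thesis by (auto simp: graph_isomorphic_def intro!: exI[of _ id])
qed

lemma cubes_isomorphic_if_graph_isomorphic:
  assumes "graph_isomorphic (N, E) (N, F)"
  shows "colored_cubes_isomorphic (2 * N) 2 (mirror_coloring N E) (mirror_coloring N F)"
proof -
  obtain \<pi> where bij: "bij_betw \<pi> {..<N} {..<N}"
    and \<pi>: "\<And>u v. u < N \<Longrightarrow> v < N \<Longrightarrow> {u, v} \<in> E \<longleftrightarrow> {\<pi> u, \<pi> v} \<in> F"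
    using assms by (auto simp: graph_isomorphic_def)
  have \<pi>N: "\<pi> u < N" if "u < N" for u using bij that by (auto simp: bij_betw_def)
  have \<pi>_inj: "u = v" if "\<pi> u = \<pi> v" "u < N" "v < N" for u v
    using bij that by (auto simp: bij_betw_def inj_on_def)
  let ?n = "2 * N"
  \<comment> \<open>\<pi> is copied to the upper half so that \<sigma> commutes with the reflection.
    Applied to both coordinates, it then permutes the rows and the columns and maps each diagonal
    onto itself.\<close>
  define \<sigma> where "\<sigma> i = (if i < N then \<pi> i else ?n - 1 - \<pi> (?n - 1 - i))" for i
  have \<sigma>n: "\<sigma> i < ?n" if "i < ?n" for i
    using \<pi>N[of i] that by (auto simp: \<sigma>_def)
  have \<sigma>r: "\<sigma> (?n - 1 - i) = ?n - 1 - \<sigma> i" if "i < ?n" for i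
    using \<pi>N[of i] \<pi>N[of "?n - 1 - i"] that by (auto simp: \<sigma>_def)
  have \<sigma>m: "mirror ?n (\<sigma> i) = \<pi> (mirror ?n i)" if "i < ?n" for i
  proof (cases "i < N")
    case True
    then show ?thesis using \<pi>N[of i] by (simp add: \<sigma>_def mirror_id)
  next
    case False
    have \<pi>r: "\<pi> (?n - 1 - i) < N" using \<pi>N[of "?n - 1 - i"] False that by linarith
    have "mirror ?n (\<sigma> i) = mirror ?n (?n - 1 - \<pi> (?n - 1 - i))" using False by (simp add: \<sigma>_def)
    also have "\<dots> = mirror ?n (\<pi> (?n - 1 - i))"
      using \<pi>r by (intro mirror_reflect) simp
    also have "\<dots> = \<pi> (?n - 1 - i)" using \<pi>r by (rule mirror_id)
    also have "?n - 1 - i = mirror ?n i" using False that by (auto simp: mirror_def min_def)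
    finally show ?thesis .
  qed
  have \<sigma>_inj: "inj_on \<sigma> {..<?n}"
  proof (rule inj_onI)
    fix i j assume ij: "i \<in> {..<?n}" "j \<in> {..<?n}" "\<sigma> i = \<sigma> j"
    then have "\<pi> (mirror ?n i) = \<pi> (mirror ?n j)" using \<sigma>m by (metis lessThan_iff)
    then have "mirror ?n i = mirror ?n j" using ij \<pi>_inj mirror_less by auto
    then consider "j = i" | "j = ?n - 1 - i" using ij mirror_eq_iff by auto
    then show "i = j"
    proof cases
      case 2
      \<comment> \<open>Impossible by parity: it would give
        \<open>2 * \<sigma> i = 2 * N - 1\<close>.\<close>
      then have "\<sigma> i = ?n - 1 - \<sigma> i" using ij \<sigma>r by simp
      then show ?thesis using \<sigma>n[of i] ij by simp presburger
    qed simp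
  qed
  have \<sigma>_image: "\<sigma> ` {..<?n} = {..<?n}"
    using \<sigma>_inj \<sigma>n by (intro endo_inj_surj) auto
  have mapc: "map \<sigma> ` cube ?n 2 = cube ?n 2"
  proof (rule endo_inj_surj[OF finite_cube])
    show "map \<sigma> ` cube ?n 2 \<subseteq> cube ?n 2" using \<sigma>n by (auto simp: cube_2)
    show "inj_on (map \<sigma>) (cube ?n 2)"
      by (rule inj_onI) (use \<sigma>_inj in \<open>auto simp: cube_2 inj_on_def\<close>)
  qed
  then have "bij_betw (map \<sigma>) (cube ?n 2) (cube ?n 2)"
    by (simp add: bij_betw_def eq_card_imp_inj_on finite_cube)
  moreover have "map \<sigma> ` row ?n i = row ?n (\<sigma> i)" "map \<sigma> ` column ?n i = column ?n (\<sigma> i)"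
    "map \<sigma> ` diagonal ?n = diagonal ?n" for i
  proof -
    show "map \<sigma> ` row ?n i = row ?n (\<sigma> i)"
      unfolding row_def image_image by (subst (2) \<sigma>_image[symmetric]) (simp add: image_image)
    show "map \<sigma> ` column ?n i = column ?n (\<sigma> i)"
      unfolding column_def image_image by (subst (2) \<sigma>_image[symmetric]) (simp add: image_image)
    show "map \<sigma> ` diagonal ?n = diagonal ?n"
      unfolding diagonal_def image_image by (subst (2) \<sigma>_image[symmetric]) (simp add: image_image)
  qed
  moreover have "map \<sigma> ` antidiagonal ?n = antidiagonal ?n"
  proof -
    have "map \<sigma> ` antidiagonal ?n = (\<lambda>t. [\<sigma> t, ?n - 1 - \<sigma> t]) ` {..<?n}"
      unfolding antidiagonal_def image_image using \<sigma>r by (intro image_cong) auto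
    also have "\<dots> = (\<lambda>t. [t, ?n - 1 - t]) ` \<sigma> ` {..<?n}" by (simp add: image_image)
    finally show ?thesis unfolding \<sigma>_image antidiagonal_def .
  qed
  ultimately have "cube_automorphism ?n 2 (map \<sigma>)"
    unfolding cube_automorphism_def cube_line_2_iff using \<sigma>n by metis
  moreover have "mirror_coloring N E v = mirror_coloring N F (map \<sigma> v)" if "v \<in> cube ?n 2" for v
    using that \<pi>[OF mirror_less mirror_less] \<sigma>m by (auto simp: cube_2 mirror_coloring_def)
  ultimately show ?thesis by (auto simp: colored_cubes_isomorphic_def)
qed

section \<open>The graph of a colored cube\<close>

text \<open>
  Vertices below \<open>N\<close> are points.  The vertex \<open>N + u * (3 * N + 2) + r\<close> is the pair \<open>(u, r)\<close> if \<open>r < N\<close>, and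
  otherwise a potential pendant vertex at \<open>u\<close>.  The colors \<open>c\<close> of both cubes are listed one after the
  other, so the point \<open>u\<close> of the cube at offset \<open>h\<close> (\<open>0\<close> or \<open>N\<close>) has the color \<open>c (h + u)\<close>.  Two pendant
  vertices are always present, so that no point has degree one.
\<close>

definition gadget_rel ::
    "nat \<Rightarrow> (nat \<Rightarrow> nat \<Rightarrow> nat \<Rightarrow> bool) \<Rightarrow> (nat \<Rightarrow> nat) \<Rightarrow> nat \<Rightarrow> nat \<Rightarrow> nat \<Rightarrow> nat \<Rightarrow> bool" where
  "gadget_rel N T c h u r x \<longleftrightarrow> (r < N \<and> T u r x) \<or>
     (N \<le> r \<and> x = u \<and> (r < N + 2 \<or> c (r - (N + 2)) \<le> c (h + u)))"

definition gadget_adj ::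
    "nat \<Rightarrow> (nat \<Rightarrow> nat \<Rightarrow> nat \<Rightarrow> bool) \<Rightarrow> (nat \<Rightarrow> nat) \<Rightarrow> nat \<Rightarrow> nat \<Rightarrow> nat \<Rightarrow> bool" where
  "gadget_adj N T c h x y \<longleftrightarrow> x < N \<and> N \<le> y \<and>
     gadget_rel N T c h ((y - N) div (3 * N + 2)) ((y - N) mod (3 * N + 2)) x"

text \<open>Besides the points, each point owns a block of \<open>3 * N + 2\<close> vertices:
  \<open>N\<close> for pairs, two for the pendants always present, and one for each of the
  \<open>2 * N\<close> listed colors. Absent pendants remain as isolated vertices, so the size
  depends on \<open>N\<close> alone.\<close>

definition gadget_size :: "nat \<Rightarrow> nat" where
  "gadget_size N = N + N * (3 * N + 2)"

definition gadget_edges ::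
    "nat \<Rightarrow> (nat \<Rightarrow> nat \<Rightarrow> nat \<Rightarrow> bool) \<Rightarrow> (nat \<Rightarrow> nat) \<Rightarrow> nat \<Rightarrow> nat set set" where
  "gadget_edges N T c h = {{x, y} |x y. y < gadget_size N \<and> gadget_adj N T c h x y}"

lemma gadget_adj_less: "gadget_adj N T c h x y \<Longrightarrow> x < N \<and> N \<le> y"
  by (simp add: gadget_adj_def)

lemma in_gadget_edges:
  assumes "x < gadget_size N" "y < gadget_size N"
  shows "{x, y} \<in> gadget_edges N T c h \<longleftrightarrow> gadget_adj N T c h x y \<or> gadget_adj N T c h y x"
  using assms unfolding gadget_edges_def by (auto simp: doubleton_eq_iff)

lemma simple_gadget: "simple_graph (gadget_size N, gadget_edges N T c h)"
proof -
  have "\<exists>u v. u < gadget_size N \<and> v < gadget_size N \<and> u \<noteq> v \<and> {x, y} = {u, v}"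
    if "y < gadget_size N" "gadget_adj N T c h x y" for x y
    using that gadget_adj_less[OF that(2)] by (intro exI[of _ x] exI[of _ y]) auto
  then show ?thesis by (auto simp: simple_graph_def gadget_edges_def)
qed

definition vertex :: "nat \<Rightarrow> nat \<Rightarrow> nat \<Rightarrow> nat" where
  "vertex N u r = N + (u * (3 * N + 2) + r)"

lemma vertex_less: "u < N \<Longrightarrow> r < 3 * N + 2 \<Longrightarrow> vertex N u r < gadget_size N"
proof -
  assume "u < N" "r < 3 * N + 2"
  then have "u * (3 * N + 2) + r < Suc u * (3 * N + 2)" by simp
  also have "\<dots> \<le> N * (3 * N + 2)" using \<open>u < N\<close> by (intro mult_right_mono) auto
  finally show ?thesis by (simp add: vertex_def gadget_size_def)
qed

lemma vertex_decode:
  assumes "r < 3 * N + 2"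
  shows "(vertex N u r - N) div (3 * N + 2) = u" "(vertex N u r - N) mod (3 * N + 2) = r"
proof -
  have "vertex N u r - N = u * (3 * N + 2) + r" by (simp add: vertex_def)
  then show "(vertex N u r - N) div (3 * N + 2) = u" "(vertex N u r - N) mod (3 * N + 2) = r"
    using div_mult_self3[of "3 * N + 2" u r] mod_mult_self3[of u "3 * N + 2" r] assms
    by (simp_all only: div_less mod_less add_0_right)
qed

lemma vertex_inject:
  "r < 3 * N + 2 \<Longrightarrow> r' < 3 * N + 2 \<Longrightarrow> vertex N u r = vertex N u' r' \<longleftrightarrow> u = u' \<and> r = r'"
  using vertex_decode by metis

lemma vertex_ge: "N \<le> vertex N u r"
  by (simp add: vertex_def)

lemma vertex_cases:
  assumes "N \<le> y" "y < gadget_size N"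
  obtains u r where "u < N" "r < 3 * N + 2" "y = vertex N u r"
proof
  show "(y - N) div (3 * N + 2) < N"
    using assms by (intro less_mult_imp_div_less) (simp add: gadget_size_def)
  show "(y - N) mod (3 * N + 2) < 3 * N + 2" by simp
  show "y = vertex N ((y - N) div (3 * N + 2)) ((y - N) mod (3 * N + 2))"
    using assms(1) div_mult_mod_eq[of "y - N" "3 * N + 2"] unfolding vertex_def by linarith
qed

lemma gadget_adj_vertex:
  assumes "r < 3 * N + 2"
  shows "gadget_adj N T c h x (vertex N u r) \<longleftrightarrow> x < N \<and> gadget_rel N T c h u r x"
  unfolding gadget_adj_def vertex_decode[OF assms] by (simp add: vertex_ge)

text \<open>The point permutation acts on both components of a pair vertex but only on the owner of
  a pendant vertex: the index of a pendant refers to the list of colors, which is common to both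
  graphs.\<close>

lemma gadget_isomorphicI:
  assumes bij: "bij_betw \<pi> {..<N} {..<N}"
    and T: "\<And>u v x. u < N \<Longrightarrow> v < N \<Longrightarrow> x < N \<Longrightarrow> T u v x \<longleftrightarrow> T (\<pi> u) (\<pi> v) (\<pi> x)"
    and c: "\<And>u. u < N \<Longrightarrow> c (h + u) = c (h' + \<pi> u)"
  shows "graph_isomorphic (gadget_size N, gadget_edges N T c h) (gadget_size N, gadget_edges N T c h')"
proof -
  let ?M = "gadget_size N" let ?K = "3 * N + 2"
  have \<pi>N: "\<pi> u < N" if "u < N" for u using bij that by (auto simp: bij_betw_def)
  have \<pi>_inj: "\<pi> u = \<pi> v \<longleftrightarrow> u = v" if "u < N" "v < N" for u v
    using bij that by (auto simp: bij_betw_def inj_on_def)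
  define \<mu> where "\<mu> r = (if r < N then \<pi> r else r)" for r
  have \<mu>K: "\<mu> r < ?K" if "r < ?K" for r using \<pi>N[of r] that by (auto simp: \<mu>_def)
  have \<mu>_inj: "\<mu> r = \<mu> r' \<longleftrightarrow> r = r'" for r r' using \<pi>_inj[of r r'] \<pi>N[of r] \<pi>N[of r'] by (auto simp: \<mu>_def)
  define \<psi> where "\<psi> y = (if y < N then \<pi> y else vertex N (\<pi> ((y - N) div ?K)) (\<mu> ((y - N) mod ?K)))" for y
  have \<psi>p: "\<psi> y = \<pi> y" if "y < N" for y using that by (simp add: \<psi>_def)
  have \<psi>v: "\<psi> (vertex N u r) = vertex N (\<pi> u) (\<mu> r)" if "r < ?K" for u r
    unfolding \<psi>_def vertex_decode[OF that] using vertex_ge[of N u r] by simp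
  have "\<psi> ` {..<?M} \<subseteq> {..<?M}"
  proof (intro image_subsetI)
    fix y assume "y \<in> {..<?M}"
    show "\<psi> y \<in> {..<?M}"
    proof (cases "y < N")
      case True
      then show ?thesis using \<pi>N[of y] by (simp add: \<psi>p gadget_size_def)
    next
      case False
      then obtain u r where "u < N" "r < ?K" "y = vertex N u r"
        using vertex_cases[of N y] \<open>y \<in> {..<?M}\<close> by auto
      then show ?thesis using \<psi>v \<pi>N \<mu>K vertex_less by simp
    qed
  qed
  moreover have "inj_on \<psi> {..<?M}"
  proof (rule inj_onI)
    fix y z assume yz: "y \<in> {..<?M}" "z \<in> {..<?M}" "\<psi> y = \<psi> z"
    have p: "\<psi> y < N \<longleftrightarrow> y < N" for y using \<pi>N[of y] vertex_ge[of N] by (simp add: \<psi>_def not_less)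
    show "y = z"
    proof (cases "y < N")
      case True
      then show ?thesis using p[of y] p[of z] yz \<pi>_inj by (simp add: \<psi>p)
    next
      case False
      then have "\<not> z < N" using p[of y] p[of z] yz by simp
      obtain u r where y: "u < N" "r < ?K" "y = vertex N u r"
        using False vertex_cases[of N y] yz by auto
      obtain u' r' where z: "u' < N" "r' < ?K" "z = vertex N u' r'"
        using \<open>\<not> z < N\<close> vertex_cases[of N z] yz by auto
      have "vertex N (\<pi> u) (\<mu> r) = vertex N (\<pi> u') (\<mu> r')" using yz(3) y z \<psi>v by simp
      then show ?thesis using y z vertex_inject[OF \<mu>K \<mu>K] \<pi>_inj \<mu>_inj by simp
    qed
  qed
  ultimately have \<psi>: "bij_betw \<psi> {..<?M} {..<?M}" by (simp add: bij_betw_def endo_inj_surj)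
  have adj: "gadget_adj N T c h x y \<longleftrightarrow> gadget_adj N T c h' (\<psi> x) (\<psi> y)" if xy: "x < ?M" "y < ?M" for x y
  proof (cases "x < N \<and> N \<le> y")
    case True
    then obtain u r where y: "u < N" "r < ?K" "y = vertex N u r" using vertex_cases[of N y] xy by auto
    have "gadget_rel N T c h u r x \<longleftrightarrow> gadget_rel N T c h' (\<pi> u) (\<mu> r) (\<pi> x)"
      unfolding gadget_rel_def \<mu>_def
      using T[of u r x] c[of u] \<pi>N[of r] \<pi>_inj[of x u] True y by auto
    then show ?thesis
      unfolding y(3) \<psi>v[OF y(2)] using True \<pi>N[of x] y \<mu>K by (simp add: gadget_adj_vertex \<psi>p)
  next
    case False
    have p: "\<psi> y < N \<longleftrightarrow> y < N" for y using \<pi>N[of y] vertex_ge[of N] by (simp add: \<psi>_def not_less)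
    show ?thesis using False p[of x] p[of y] gadget_adj_less[of N T c] by (metis not_less)
  qed
  have "{x, y} \<in> gadget_edges N T c h \<longleftrightarrow> {\<psi> x, \<psi> y} \<in> gadget_edges N T c h'" if "x < ?M" "y < ?M" for x y
  proof -
    have "\<psi> x < ?M" "\<psi> y < ?M" using \<psi> that by (auto simp: bij_betw_def)
    then show ?thesis using that adj[OF that] adj[OF that(2,1)] by (simp add: in_gadget_edges)
  qed
  then show ?thesis unfolding graph_isomorphic_def using \<psi> by auto
qed

section \<open>Recovering points, colors and lines from the graph\<close>

definition nbrs :: "nat \<Rightarrow> nat set set \<Rightarrow> nat \<Rightarrow> nat set" where
  "nbrs M E y = {x. x < M \<and> {x, y} \<in> E}"

lemma nbrs_gadget_vertex:
  assumes "u < N" "r < 3 * N + 2"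
  shows "nbrs (gadget_size N) (gadget_edges N T c h) (vertex N u r) = {x. x < N \<and> gadget_rel N T c h u r x}"
proof -
  have "x < gadget_size N" if "x < N" for x using that by (simp add: gadget_size_def)
  moreover have "\<not> gadget_adj N T c h (vertex N u r) x" for x
    using gadget_adj_less[of N T c h "vertex N u r" x] vertex_ge[of N u r] by auto
  ultimately show ?thesis
    unfolding nbrs_def using assms by (auto simp: in_gadget_edges vertex_less gadget_adj_vertex)
qed

lemma nbrs_gadget_point:
  assumes "x < N"
  shows "nbrs (gadget_size N) (gadget_edges N T c h) x =
    {vertex N u r |u r. u < N \<and> r < 3 * N + 2 \<and> gadget_rel N T c h u r x}"
proof -
  have x: "x < gadget_size N" using assms by (simp add: gadget_size_def)
  show ?thesis
  proof (intro set_eqI iffI)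
    fix y assume "y \<in> nbrs (gadget_size N) (gadget_edges N T c h) x"
    then have y: "y < gadget_size N" "gadget_adj N T c h x y"
      using x assms gadget_adj_less[of N T c h y x] by (auto simp: nbrs_def in_gadget_edges)
    then have "N \<le> y" using gadget_adj_less by blast
    then obtain u r where "u < N" "r < 3 * N + 2" "y = vertex N u r" using vertex_cases y(1) by blast
    then show "y \<in> {vertex N u r |u r. u < N \<and> r < 3 * N + 2 \<and> gadget_rel N T c h u r x}"
      using y(2) by (auto simp: gadget_adj_vertex)
  next
    fix y assume "y \<in> {vertex N u r |u r. u < N \<and> r < 3 * N + 2 \<and> gadget_rel N T c h u r x}"
    then show "y \<in> nbrs (gadget_size N) (gadget_edges N T c h) x"
      using x assms by (auto simp: nbrs_def in_gadget_edges vertex_less gadget_adj_vertex)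
  qed
qed

context
  fixes N :: nat and T :: "nat \<Rightarrow> nat \<Rightarrow> nat \<Rightarrow> bool" and c :: "nat \<Rightarrow> nat" and h :: nat
  assumes T1: "\<And>u v. u < N \<Longrightarrow> v < N \<Longrightarrow> card {x. x < N \<and> T u v x} \<noteq> 1"
begin

abbreviation "nb \<equiv> nbrs (gadget_size N) (gadget_edges N T c h)"

text \<open>By \<open>T1\<close> a pair vertex has no neighbor or several, so it is never mistaken
  for a pendant vertex.\<close>

lemma gadget_leaf_vertex:
  assumes "u < N" "r < 3 * N + 2"
  shows "card (nb (vertex N u r)) = 1 \<longleftrightarrow> N \<le> r \<and> (r < N + 2 \<or> c (r - (N + 2)) \<le> c (h + u))"
proof (cases "r < N")
  case True
  then show ?thesis using T1[OF assms(1) True] assms by (simp add: nbrs_gadget_vertex gadget_rel_def)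
next
  case False
  then have "{x. x < N \<and> gadget_rel N T c h u r x} =
      (if r < N + 2 \<or> c (r - (N + 2)) \<le> c (h + u) then {u} else {})"
    using assms(1) by (auto simp: gadget_rel_def)
  then show ?thesis using False assms by (simp add: nbrs_gadget_vertex)
qed

lemma gadget_leaf_in_nb:
  assumes "x < N" "N \<le> r" "r < 3 * N + 2" "r < N + 2 \<or> c (r - (N + 2)) \<le> c (h + x)"
  shows "vertex N x r \<in> nb x"
  unfolding nbrs_gadget_point[OF assms(1)] mem_Collect_eq
  by (intro exI[of _ x] exI[of _ r]) (use assms in \<open>auto simp: gadget_rel_def\<close>)

lemma gadget_point_not_leaf:
  assumes "x < N"
  shows "card (nb x) \<noteq> 1"
proof -
  have "vertex N x N \<in> nb x" "vertex N x (N + 1) \<in> nb x"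
    using assms by (auto intro: gadget_leaf_in_nb)
  moreover have "vertex N x N \<noteq> vertex N x (N + 1)" by (simp add: vertex_def)
  ultimately show ?thesis by (metis card_1_singletonE singletonD)
qed

lemma gadget_point_iff:
  assumes "y < gadget_size N"
  shows "(\<exists>z\<in>nb y. card (nb z) = 1) \<longleftrightarrow> y < N"
proof
  assume "\<exists>z\<in>nb y. card (nb z) = 1"
  then obtain z where z: "z \<in> nb y" "card (nb z) = 1" by blast
  then have "z < gadget_size N" by (simp add: nbrs_def)
  moreover have "N \<le> z" using gadget_point_not_leaf z(2) by (meson not_less)
  ultimately obtain u r where ur: "u < N" "r < 3 * N + 2" "z = vertex N u r" using vertex_cases by blast
  have "y \<in> nb z" using z(1) assms by (simp add: nbrs_def insert_commute)
  then show "y < N" using ur by (simp add: nbrs_gadget_vertex)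
next
  assume y: "y < N"
  then have "vertex N y N \<in> nb y" by (auto intro: gadget_leaf_in_nb)
  moreover have "card (nb (vertex N y N)) = 1" using y by (subst gadget_leaf_vertex) auto
  ultimately show "\<exists>z\<in>nb y. card (nb z) = 1" by blast
qed

text \<open>Up to the two pendants always present, the count is the rank of the color of
  \<open>y\<close> in the common list; it stays at most \<open>2 * N + 2\<close> however large the
  colors are.\<close>

lemma gadget_leaf_count:
  assumes "y < N"
  shows "card {z \<in> nb y. card (nb z) = 1} = 2 + card {j. j < 2 * N \<and> c j \<le> c (h + y)}"
proof -
  let ?R = "{r. N \<le> r \<and> r < 3 * N + 2 \<and> (r < N + 2 \<or> c (r - (N + 2)) \<le> c (h + y))}"
  have "{z \<in> nb y. card (nb z) = 1} = vertex N y ` ?R"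
  proof (intro set_eqI iffI)
    fix z assume z: "z \<in> {z \<in> nb y. card (nb z) = 1}"
    then obtain u r where ur: "u < N" "r < 3 * N + 2" "z = vertex N u r" "gadget_rel N T c h u r y"
      using assms by (auto simp: nbrs_gadget_point)
    moreover have "N \<le> r \<and> (r < N + 2 \<or> c (r - (N + 2)) \<le> c (h + u))"
      using z ur gadget_leaf_vertex by auto
    ultimately show "z \<in> vertex N y ` ?R" by (auto simp: gadget_rel_def)
  next
    fix z assume "z \<in> vertex N y ` ?R"
    then obtain r where r: "r \<in> ?R" "z = vertex N y r" by blast
    then have "card (nb z) = 1" using gadget_leaf_vertex[of y r] assms by auto
    moreover have "gadget_rel N T c h y r y" using r by (auto simp: gadget_rel_def)
    then have "z \<in> nb y" using r assms by (auto simp: nbrs_gadget_point)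
    ultimately show "z \<in> {z \<in> nb y. card (nb z) = 1}" by blast
  qed
  moreover have "inj_on (vertex N y) ?R" by (auto simp: inj_on_def vertex_def)
  ultimately have "card {z \<in> nb y. card (nb z) = 1} = card ?R" by (simp add: card_image)
  also have "?R = {N, N + 1} \<union> (\<lambda>j. j + (N + 2)) ` {j. j < 2 * N \<and> c j \<le> c (h + y)}"
  proof (intro set_eqI iffI)
    fix r assume r: "r \<in> ?R"
    show "r \<in> {N, N + 1} \<union> (\<lambda>j. j + (N + 2)) ` {j. j < 2 * N \<and> c j \<le> c (h + y)}"
    proof (cases "r < N + 2")
      case False
      then have "r = (r - (N + 2)) + (N + 2)" by simp
      then show ?thesis using r False by (intro UnI2 image_eqI[of _ _ "r - (N + 2)"]) auto
    qed (use r in auto)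
  qed auto
  also have "card \<dots> = card {N, N + 1} + card ((\<lambda>j. j + (N + 2)) ` {j. j < 2 * N \<and> c j \<le> c (h + y)})"
    by (intro card_Un_disjoint) auto
  also have "\<dots> = 2 + card {j. j < 2 * N \<and> c j \<le> c (h + y)}" by (simp add: card_image inj_on_def)
  finally show ?thesis .
qed

end

text \<open>Empty sets are excluded from the last conclusion because a pair vertex without neighbors
  is isolated and may be exchanged with an absent pendant. The new indices need not be the images of
  \<open>u\<close> and \<open>v\<close>: different pairs may span the same line.\<close>

lemma gadget_isomorphicD:
  assumes T1: "\<And>u v. u < N \<Longrightarrow> v < N \<Longrightarrow> card {x. x < N \<and> T u v x} \<noteq> 1"
    and h: "h \<le> N" "h' \<le> N"
    and iso: "graph_isomorphic (gadget_size N, gadget_edges N T c h) (gadget_size N, gadget_edges N T c h')"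
  obtains \<pi> where "bij_betw \<pi> {..<N} {..<N}"
    "\<And>u. u < N \<Longrightarrow> c (h + u) = c (h' + \<pi> u)"
    "\<And>u v. u < N \<Longrightarrow> v < N \<Longrightarrow> {x. x < N \<and> T u v x} \<noteq> {} \<Longrightarrow>
       \<exists>u' v'. u' < N \<and> v' < N \<and> \<pi> ` {x. x < N \<and> T u v x} = {x. x < N \<and> T u' v' x}"
proof -
  let ?M = "gadget_size N"
  obtain \<pi> where bij: "bij_betw \<pi> {..<?M} {..<?M}"
    and e: "\<And>u v. u < ?M \<Longrightarrow> v < ?M \<Longrightarrow> {u, v} \<in> gadget_edges N T c h \<longleftrightarrow> {\<pi> u, \<pi> v} \<in> gadget_edges N T c h'"
    using iso by (auto simp: graph_isomorphic_def)
  let ?n1 = "nbrs ?M (gadget_edges N T c h)" let ?n2 = "nbrs ?M (gadget_edges N T c h')"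
  have inj: "inj_on \<pi> {..<?M}" and im: "\<pi> ` {..<?M} = {..<?M}" using bij by (auto simp: bij_betw_def)
  have \<pi>M: "\<pi> y < ?M" if "y < ?M" for y using im that by auto
  have n1M: "?n1 y \<subseteq> {..<?M}" for y by (auto simp: nbrs_def)
  have nb: "?n2 (\<pi> y) = \<pi> ` ?n1 y" if y: "y < ?M" for y
  proof (intro set_eqI iffI)
    fix z assume z: "z \<in> ?n2 (\<pi> y)"
    then have "z \<in> \<pi> ` {..<?M}" using im by (auto simp: nbrs_def)
    then obtain x where "x < ?M" "z = \<pi> x" by auto
    then show "z \<in> \<pi> ` ?n1 y" using z e y by (auto simp: nbrs_def)
  qed (use e y \<pi>M in \<open>auto simp: nbrs_def\<close>)
  have leaf: "card (?n2 (\<pi> y)) = card (?n1 y)" if "y < ?M" for y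
    unfolding nb[OF that] using inj_on_subset[OF inj n1M] by (rule card_image)
  have leaves: "{z \<in> ?n2 (\<pi> y). card (?n2 z) = 1} = \<pi> ` {z \<in> ?n1 y. card (?n1 z) = 1}" if "y < ?M" for y
  proof -
    have "card (?n2 (\<pi> z)) = card (?n1 z)" if "z \<in> ?n1 y" for z using leaf that n1M by blast
    then show ?thesis unfolding nb[OF that] by auto
  qed
  have N_M: "y < ?M" if "y < N" for y using that by (simp add: gadget_size_def)
  have point: "\<pi> y < N \<longleftrightarrow> y < N" if "y < ?M" for y
    using gadget_point_iff[where T = T and c = c and h = h, OF T1 that] leaves[OF that]
      gadget_point_iff[where T = T and c = c and h = h', OF T1 \<pi>M[OF that]] by blast
  have bijN: "bij_betw \<pi> {..<N} {..<N}"
  proof -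
    have "{..<N} \<subseteq> {..<?M}" by (simp add: gadget_size_def)
    then have "inj_on \<pi> {..<N}" by (rule inj_on_subset[OF inj])
    moreover have "\<pi> ` {..<N} \<subseteq> {..<N}" using N_M point by auto
    ultimately show ?thesis by (simp add: bij_betw_def endo_inj_surj)
  qed
  have color: "c (h + u) = c (h' + \<pi> u)" if u: "u < N" for u
  proof -
    have \<pi>u: "\<pi> u < N" using point[OF N_M[OF u]] u by simp
    have "inj_on \<pi> {z \<in> ?n1 u. card (?n1 z) = 1}" 
      by (rule inj_on_subset[OF inj]) (auto simp: nbrs_def)
    then have "card {z \<in> ?n2 (\<pi> u). card (?n2 z) = 1} = card {z \<in> ?n1 u. card (?n1 z) = 1}"
      unfolding leaves[OF N_M[OF u]] by (rule card_image)
    then have eq: "card {j. j < 2 * N \<and> c j \<le> c (h + u)} = card {j. j < 2 * N \<and> c j \<le> c (h' + \<pi> u)}"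
      using gadget_leaf_count[where T = T and c = c and h = h, OF T1 u]
        gadget_leaf_count[where T = T and c = c and h = h', OF T1 \<pi>u] by simp
    \<comment> \<open>Ranks increase strictly on listed colors: index \<open>b\<close> is counted
      for the larger color only. The bounds on \<open>h\<close> and \<open>h'\<close> keep both
      indices within the list.\<close>
    have less: "card {j. j < 2 * N \<and> c j \<le> c a} < card {j. j < 2 * N \<and> c j \<le> c b}"
      if "c a < c b" "b < 2 * N" for a b
      using that by (intro psubset_card_mono) (auto simp: psubset_eq set_eq_iff intro!: exI[of _ b])
    show ?thesis
      using less[of "h + u" "h' + \<pi> u"] less[of "h' + \<pi> u" "h + u"] eq u \<pi>u h
      by (cases "c (h + u)" "c (h' + \<pi> u)" rule: linorder_cases) auto
  qed
  have lines: "\<exists>u' v'. u' < N \<and> v' < N \<and> \<pi> ` {x. x < N \<and> T u v x} = {x. x < N \<and> T u' v' x}"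
    if uv: "u < N" "v < N" and ne: "{x. x < N \<and> T u v x} \<noteq> {}" for u v
  proof -
    let ?z = "vertex N u v"
    have z: "?z < ?M" using uv vertex_less by simp
    have n1: "?n1 ?z = {x. x < N \<and> T u v x}"
      using uv by (simp add: nbrs_gadget_vertex gadget_rel_def)
    have "N \<le> \<pi> ?z" using point[OF z] vertex_ge[of N u v] by simp
    then obtain u' r' where r': "u' < N" "r' < 3 * N + 2" "\<pi> ?z = vertex N u' r'"
      using vertex_cases[of N "\<pi> ?z"] \<pi>M[OF z] by blast
    have n2: "?n2 (\<pi> ?z) = {x. x < N \<and> gadget_rel N T c h' u' r' x}"
      unfolding r'(3) using r' by (simp add: nbrs_gadget_vertex)
    \<comment> \<open>The image has as many neighbors as \<open>?z\<close>, that is at least two,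
      whereas a pendant vertex has at most one.\<close>
    have "r' < N"
    proof (rule ccontr)
      assume "\<not> r' < N"
      then have "?n2 (\<pi> ?z) \<subseteq> {u'}" unfolding n2 by (auto simp: gadget_rel_def)
      then have "card (?n2 (\<pi> ?z)) \<le> 1" using card_mono[of "{u'}" "?n2 (\<pi> ?z)"] by simp
      moreover have "card (?n1 ?z) \<noteq> 0" unfolding n1 using ne by simp
      moreover have "card (?n1 ?z) \<noteq> 1" unfolding n1 using T1 uv by blast
      ultimately show False using leaf[OF z] by linarith
    qed
    then have "?n2 (\<pi> ?z) = {x. x < N \<and> T u' r' x}" unfolding n2 by (auto simp: gadget_rel_def)
    then have "\<pi> ` {x. x < N \<and> T u v x} = {x. x < N \<and> T u' r' x}" using nb[OF z] n1 by simp
    then show ?thesis using r'(1) \<open>r' < N\<close> by blast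
  qed
  show ?thesis using that[OF bijN color lines] by blast
qed

section \<open>Points numbered by their base \<open>n\<close> digits\<close>

definition digit :: "nat \<Rightarrow> nat \<Rightarrow> nat \<Rightarrow> nat" where
  "digit n i j = i div n ^ j mod n"

lemma nth_concat_equal_length:
  assumes "\<And>ys. ys \<in> set xss \<Longrightarrow> length ys = n" "i < length xss * n"
  shows "concat xss ! i = xss ! (i div n) ! (i mod n)"
  using assms
proof (induction xss arbitrary: i)
  case (Cons xs xss)
  then have xs: "length xs = n" "0 < n" by (auto intro: gr0I)
  show ?case
  proof (cases "i < n")
    case True
    then show ?thesis using xs by (simp add: nth_append)
  next
    case False
    then have "i div n = Suc ((i - n) div n)" "i mod n = (i - n) mod n"
      using xs(2) by (auto simp: le_div_geq le_mod_geq)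
    moreover have "concat xss ! (i - n) = xss ! ((i - n) div n) ! ((i - n) mod n)"
      using Cons.prems False by (intro Cons.IH) auto
    ultimately show ?thesis using xs False by (simp add: nth_append)
  qed
qed simp

text \<open>\<open>List.n_lists\<close> varies the first entry fastest, so the \<open>i\<close>-th
  point consists of the base \<open>n\<close> digits of \<open>i\<close>, least significant
  first.\<close>

lemma nth_n_lists_upt:
  "i < n ^ d \<Longrightarrow> j < d \<Longrightarrow> List.n_lists d [0..<n] ! i ! j = digit n i j"
proof (induction d arbitrary: i j)
  case (Suc d)
  let ?L = "List.n_lists d [0..<n]"
  have n: "0 < n" using Suc.prems by (auto intro: gr0I)
  have i: "i div n < n ^ d" using Suc.prems(1) by (intro less_mult_imp_div_less) (simp add: mult.commute)
  have "List.n_lists (Suc d) [0..<n] ! i = map (\<lambda>ys. map (\<lambda>y. y # ys) [0..<n]) ?L ! (i div n) ! (i mod n)"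
    using Suc.prems(1) unfolding n_lists.simps
    by (intro nth_concat_equal_length) (auto simp: length_n_lists_upt mult.commute)
  also have "\<dots> = (i mod n) # (?L ! (i div n))"
    using i n by (simp add: length_n_lists_upt)
  finally have e: "List.n_lists (Suc d) [0..<n] ! i = (i mod n) # (?L ! (i div n))" .
  show ?case
  proof (cases j)
    case 0
    then show ?thesis unfolding e by (simp add: digit_def)
  next
    case (Suc j')
    then show ?thesis unfolding e using Suc.IH[OF i, of j'] Suc.prems(2)
      by (simp add: digit_def div_mult2_eq)
  qed
qed simp

lemma collinear_cong:
  assumes "\<And>j. j < d \<Longrightarrow> a j = a' j" "\<And>j. j < d \<Longrightarrow> b j = b' j" "\<And>j. j < d \<Longrightarrow> c j = c' j"
  shows "collinear n d a b c \<longleftrightarrow> collinear n d a' b' c'"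
  unfolding collinear_def using assms by (simp cong: conj_cong)

lemma collinear_ne: "collinear n d ((!) a) ((!) b) ((!) c) \<Longrightarrow> a \<noteq> b"
  by (auto simp: collinear_def)

lemma collinear_iff_line:
  assumes "a \<in> cube n d" "b \<in> cube n d" "c \<in> cube n d"
  shows "collinear n d ((!) a) ((!) b) ((!) c) \<longleftrightarrow> a \<noteq> b \<and> (\<exists>l. cube_line n d l \<and> a \<in> l \<and> b \<in> l \<and> c \<in> l)"
  using collinear_in_cube_line[OF assms] collinear_ne cube_line_eq_collinear by blast

lemma collinear_set_line:
  assumes "a \<in> cube n d" "b \<in> cube n d" "c \<in> cube n d" "collinear n d ((!) a) ((!) b) ((!) c)"
  shows "cube_line n d {c \<in> cube n d. collinear n d ((!) a) ((!) b) ((!) c)}"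
proof -
  obtain l where l: "cube_line n d l" "a \<in> l" "b \<in> l" using collinear_in_cube_line[OF assms] by blast
  then show ?thesis using cube_line_eq_collinear[OF l collinear_ne[OF assms(4)]] by simp
qed

lemma card_cube_line:
  assumes "cube_line n d l"
  shows "2 \<le> card l"
proof -
  have "2 \<le> n" using assms cube_line_iff by blast
  moreover have "card l = n" using assms by (auto simp: cube_line_def distinct_card)
  ultimately show ?thesis by simp
qed

text \<open>Collinearity means that \<open>a\<close> and \<open>b\<close> differ and some line
  contains all three points; lines can be pushed forward and pulled back along
  \<open>P\<close>.\<close>

lemma collinear_automorphism:
  assumes P: "cube_automorphism n d P" and abc: "a \<in> cube n d" "b \<in> cube n d" "c \<in> cube n d"
  shows "collinear n d ((!) (P a)) ((!) (P b)) ((!) (P c)) \<longleftrightarrow> collinear n d ((!) a) ((!) b) ((!) c)"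
proof -
  have bij: "bij_betw P (cube n d) (cube n d)" using P by (simp add: cube_automorphism_def)
  then have inj: "inj_on P (cube n d)" and im: "P ` cube n d = cube n d" by (auto simp: bij_betw_def)
  have Pabc: "P a \<in> cube n d" "P b \<in> cube n d" "P c \<in> cube n d" using abc im by auto
  have "(\<exists>l. cube_line n d l \<and> P a \<in> l \<and> P b \<in> l \<and> P c \<in> l) \<longleftrightarrow>
      (\<exists>l. cube_line n d l \<and> a \<in> l \<and> b \<in> l \<and> c \<in> l)"
  proof
    assume "\<exists>l. cube_line n d l \<and> P a \<in> l \<and> P b \<in> l \<and> P c \<in> l"
    then obtain l where l: "cube_line n d l" "P a \<in> l" "P b \<in> l" "P c \<in> l" by blast
    let ?l = "{p \<in> cube n d. P p \<in> l}"
    have "P ` ?l = l" using im cube_line_subset[OF l(1)] by auto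
    then have "cube_line n d ?l" using cube_line_image_iff[OF P, of ?l] l(1) by auto
    then show "\<exists>l. cube_line n d l \<and> a \<in> l \<and> b \<in> l \<and> c \<in> l" using l abc by blast
  next
    assume "\<exists>l. cube_line n d l \<and> a \<in> l \<and> b \<in> l \<and> c \<in> l"
    then show "\<exists>l. cube_line n d l \<and> P a \<in> l \<and> P b \<in> l \<and> P c \<in> l"
      using P unfolding cube_automorphism_def by blast
  qed
  moreover have "P a = P b \<longleftrightarrow> a = b" using inj abc by (auto simp: inj_on_def)
  ultimately show ?thesis unfolding collinear_iff_line[OF abc] collinear_iff_line[OF Pabc] by simp
qed

text \<open>Every nonempty set \<open>{x. x < N \<and> T u v x}\<close> numbers the points of a
  line, and every line arises so from two of its points. Hence a point bijection that carries these
  sets to such sets is an automorphism, even if it forgets which pair named which line.\<close>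

lemma cubes_isomorphic_iff_gadgets_isomorphic:
  fixes n d s1 s2
  defines "N \<equiv> n ^ d" and "L \<equiv> List.n_lists d [0..<n]"
  assumes c1: "\<And>i. i < N \<Longrightarrow> c i = s1 (L ! i)" and c2: "\<And>i. i < N \<Longrightarrow> c (N + i) = s2 (L ! i)"
  defines "T \<equiv> \<lambda>u v x. collinear n d (digit n u) (digit n v) (digit n x)"
  shows "colored_cubes_isomorphic n d s1 s2 \<longleftrightarrow>
    graph_isomorphic (gadget_size N, gadget_edges N T c 0) (gadget_size N, gadget_edges N T c N)"
proof -
  define pt where "pt i = L ! i" for i
  have pt: "bij_betw pt {..<N} (cube n d)"
    using bij_betw_nth[of L "{..<N}" "cube n d"] distinct_n_lists[of "[0..<n]" d]
    by (simp add: pt_def[abs_def] L_def N_def length_n_lists_upt set_n_lists_upt)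
  define ix where "ix = the_inv_into {..<N} pt"
  have ix: "bij_betw ix (cube n d) {..<N}" unfolding ix_def by (rule bij_betw_the_inv_into[OF pt])
  have pt_ix: "pt (ix p) = p" if "p \<in> cube n d" for p
    using f_the_inv_into_f_bij_betw[OF pt] that by (simp add: ix_def)
  have ix_pt: "ix (pt i) = i" if "i < N" for i
    using the_inv_into_f_f[of pt "{..<N}" i] pt that by (simp add: ix_def bij_betw_def)
  have ptc: "pt i \<in> cube n d" if "i < N" for i using pt that by (auto simp: bij_betw_def)
  have ixN: "ix p < N" if "p \<in> cube n d" for p using ix that by (auto simp: bij_betw_def)
  have T: "T u v x \<longleftrightarrow> collinear n d ((!) (pt u)) ((!) (pt v)) ((!) (pt x))"
    if "u < N" "v < N" "x < N" for u v x
    unfolding T_def using that nth_n_lists_upt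
    by (intro collinear_cong) (auto simp: pt_def L_def N_def)
  have T_image: "pt ` {x. x < N \<and> T u v x} = {c \<in> cube n d. collinear n d ((!) (pt u)) ((!) (pt v)) ((!) c)}"
    if uv: "u < N" "v < N" for u v
  proof (intro set_eqI iffI)
    fix p assume "p \<in> {c \<in> cube n d. collinear n d ((!) (pt u)) ((!) (pt v)) ((!) c)}"
    then show "p \<in> pt ` {x. x < N \<and> T u v x}"
      using T[OF uv ixN] pt_ix ixN by (intro image_eqI[of _ _ "ix p"]) auto
  qed (use T[OF uv] ptc in auto)
  have inj_pt: "inj_on pt {..<N}" using pt by (simp add: bij_betw_def)
  have T1: "card {x. x < N \<and> T u v x} \<noteq> 1" if uv: "u < N" "v < N" for u v
  proof (cases "{x. x < N \<and> T u v x} = {}")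
    case False
    then obtain x where x: "x < N" "T u v x" by blast
    have "cube_line n d (pt ` {x. x < N \<and> T u v x})"
      unfolding T_image[OF uv] using x T[OF uv x(1)] ptc uv by (intro collinear_set_line[of _ _ _ _ "pt x"]) auto
    then have "2 \<le> card (pt ` {x. x < N \<and> T u v x})" by (rule card_cube_line)
    moreover have "card (pt ` {x. x < N \<and> T u v x}) = card {x. x < N \<and> T u v x}"
      by (rule card_image, rule inj_on_subset[OF inj_pt]) auto
    ultimately show ?thesis by simp
  next
    case True
    then show ?thesis unfolding True by simp
  qed
  show ?thesis
  proof
    assume "colored_cubes_isomorphic n d s1 s2"
    then obtain P where P: "cube_automorphism n d P" and s: "\<And>v. v \<in> cube n d \<Longrightarrow> s1 v = s2 (P v)"
      by (auto simp: colored_cubes_isomorphic_def)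
    have bP: "bij_betw P (cube n d) (cube n d)" using P by (simp add: cube_automorphism_def)
    then have Pc: "P p \<in> cube n d" if "p \<in> cube n d" for p using that by (auto simp: bij_betw_def)
    define \<pi> where "\<pi> i = ix (P (pt i))" for i
    have pt\<pi>: "pt (\<pi> i) = P (pt i)" if "i < N" for i using pt_ix Pc ptc that by (simp add: \<pi>_def)
    have \<pi>N: "\<pi> i < N" if "i < N" for i using ixN Pc ptc that by (simp add: \<pi>_def)
    show "graph_isomorphic (gadget_size N, gadget_edges N T c 0) (gadget_size N, gadget_edges N T c N)"
    proof (rule gadget_isomorphicI)
      show "bij_betw \<pi> {..<N} {..<N}"
        using bij_betw_trans[OF bij_betw_trans[OF pt bP] ix] by (simp add: \<pi>_def[abs_def] comp_def)
      show "T u v x \<longleftrightarrow> T (\<pi> u) (\<pi> v) (\<pi> x)" if "u < N" "v < N" "x < N" for u v x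
        using T[OF that] T[of "\<pi> u" "\<pi> v" "\<pi> x"] collinear_automorphism[OF P, of "pt u" "pt v" "pt x"]
          that \<pi>N pt\<pi> ptc by simp
      show "c (0 + u) = c (N + \<pi> u)" if "u < N" for u
        using c1[OF that] c2[OF \<pi>N[OF that]] s[OF ptc[OF that]] pt\<pi>[OF that] by (simp add: pt_def)
    qed
  next
    assume iso: "graph_isomorphic (gadget_size N, gadget_edges N T c 0) (gadget_size N, gadget_edges N T c N)"
    obtain \<pi> where \<pi>: "bij_betw \<pi> {..<N} {..<N}"
      and col: "\<And>u. u < N \<Longrightarrow> c (0 + u) = c (N + \<pi> u)"
      and lines: "\<And>u v. u < N \<Longrightarrow> v < N \<Longrightarrow> {x. x < N \<and> T u v x} \<noteq> {} \<Longrightarrow>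
         \<exists>u' v'. u' < N \<and> v' < N \<and> \<pi> ` {x. x < N \<and> T u v x} = {x. x < N \<and> T u' v' x}"
      by (rule gadget_isomorphicD[OF _ le0 order_refl iso]) (rule T1, assumption, assumption, rule that)
    define P where "P p = pt (\<pi> (ix p))" for p
    have \<pi>N: "\<pi> i < N" if "i < N" for i using \<pi> that by (auto simp: bij_betw_def)
    have bP: "bij_betw P (cube n d) (cube n d)"
      using bij_betw_trans[OF bij_betw_trans[OF ix \<pi>] pt] by (simp add: P_def[abs_def] comp_def)
    have "cube_line n d (P ` l)" if l: "cube_line n d l" for l
    proof -
      have "\<not> card l \<le> Suc 0" using card_cube_line[OF l] by linarith
      then have "\<exists>a b. a \<in> l \<and> b \<in> l \<and> a \<noteq> b"
        using card_le_Suc0_iff_eq[OF finite_subset[OF cube_line_subset[OF l] finite_cube]] by blast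
      then obtain a b where ab: "a \<in> l" "b \<in> l" "a \<noteq> b" by blast
      have abc: "a \<in> cube n d" "b \<in> cube n d" using ab cube_line_subset[OF l] by auto
      have uv: "ix a < N" "ix b < N" using ixN abc by auto
      let ?S = "{x. x < N \<and> T (ix a) (ix b) x}"
      have l': "l = pt ` ?S"
        unfolding T_image[OF uv] pt_ix[OF abc(1)] pt_ix[OF abc(2)] by (rule cube_line_eq_collinear[OF l ab])
      then have "?S \<noteq> {}" using ab by auto
      then obtain u' v' where uv': "u' < N" "v' < N" "\<pi> ` ?S = {x. x < N \<and> T u' v' x}"
        using lines[OF uv] by blast
      have "P ` l = pt ` \<pi> ` ?S"
        unfolding l' image_image by (intro image_cong) (auto simp: P_def ix_pt)
      moreover obtain x where x: "x < N" "T u' v' x" using uv'(3) \<open>?S \<noteq> {}\<close> by blast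
      ultimately have "P ` l = {c \<in> cube n d. collinear n d ((!) (pt u')) ((!) (pt v')) ((!) c)}"
        unfolding uv'(3) using T_image uv' by simp
      moreover have "cube_line n d {c \<in> cube n d. collinear n d ((!) (pt u')) ((!) (pt v')) ((!) c)}"
        using x T[OF uv'(1,2) x(1)] ptc uv' by (intro collinear_set_line[of _ _ _ _ "pt x"]) auto
      ultimately show ?thesis by simp
    qed
    then have "cube_automorphism n d P" using bP by (simp add: cube_automorphism_def)
    moreover have "s1 p = s2 (P p)" if "p \<in> cube n d" for p
      using col[OF ixN[OF that]] c1[OF ixN[OF that]] c2[OF \<pi>N[OF ixN[OF that]]] pt_ix[OF that]
      by (simp add: P_def pt_def)
    ultimately show "colored_cubes_isomorphic n d s1 s2" by (auto simp: colored_cubes_isomorphic_def)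
  qed
qed

section \<open>The reductions\<close>

lemma pnum_max:
  assumes "pnum \<Gamma> f" "pnum \<Gamma> g"
  shows "pnum \<Gamma> (\<lambda>x. max (f x) (g x))"
  by (rule pnum_cong[OF pnum_add[OF assms(1) pnum_diff[OF assms(2) pnum_num[OF assms(1)]]]]) auto

lemma pnum_digit:
  assumes "pnum \<Gamma> n" "pnum \<Gamma> i" "pnum \<Gamma> j"
  shows "pnum \<Gamma> (\<lambda>x. digit (n x) (i x) (j x))"
  unfolding digit_def by (rule pnum_mod[OF pnum_div_power[OF assms(2,1,3)] assms(1)])

lemmas decides_pless = decides_less[OF pnum_num pnum_num]
lemmas decides_ple = decides_le[OF pnum_num pnum_num]
lemmas decides_peq = decides_eq[OF pnum_num pnum_num]
lemmas pnum_pdiff = pnum_diff[OF _ pnum_num]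

lemma decides_collinear:
  assumes "pnum \<Gamma> n" "pnum \<Gamma> d" "pnum \<Gamma> u" "pnum \<Gamma> v" "pnum \<Gamma> z"
  shows "decides \<Gamma> (\<lambda>x. collinear (n x) (d x) (digit (n x) (u x)) (digit (n x) (v x)) (digit (n x) (z x)))"
  unfolding collinear_def
  by (intro decides_ex decides_all decides_conj decides_disj decides_not decides_peq pnum_digit
      pnum_pdiff pnum_const pnum_var pnum_weaken assms)

lemma emits_triangle:
  assumes "pnum \<Gamma> M"
    and "decides (ext (ext \<Gamma> (\<lambda>x. {..<M x})) (\<lambda>p. {..<snd p})) (\<lambda>q. adj (fst (fst q)) (snd q) (snd (fst q)))"
  shows "emits \<Gamma> (\<lambda>x. triangle (adj x) (M x))"
  unfolding triangle_def by (intro emits_concat emits_map pnum_var assms)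

abbreviation word_ctx :: "bool list ctx" where
  "word_ctx \<equiv> Ctx UNIV (\<lambda>w. w) []"

lemma input_word_ctx: "input word_ctx (\<lambda>w. w)"
  by (simp add: input_def)

text \<open>Inputs violating the syntactic condition \<open>P\<close> are no-instances and are sent
  to the empty word; \<open>g\<close> has to be computed only on the remaining ones.\<close>

lemma reducibleI:
  assumes "decides word_ctx P" "emits (restr word_ctx P) g"
    and "\<And>w. w \<in> A \<Longrightarrow> P w" "\<And>w. P w \<Longrightarrow> w \<in> A \<longleftrightarrow> g w \<in> B" "[] \<notin> B"
  shows "A \<le>\<^sub>p B"
proof -
  have "emits word_ctx (\<lambda>w. if P w then g w else [])"
    by (rule emits_if[OF assms(1,2) emits_Nil])
  then have "poly_time_computable (\<lambda>w. if P w then g w else [])"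
    unfolding emits_def using poly_time_computableI by blast
  then show ?thesis unfolding poly_time_reducible_def using assms(3-5)
    by (intro exI[of _ "\<lambda>w. if P w then g w else []"]) auto
qed

section \<open>From pairs of graphs to pairs of grids\<close>

definition first_size :: "bool list \<Rightarrow> nat" where
  "first_size w = ones_run w 0"

definition second_start :: "bool list \<Rightarrow> nat" where
  "second_start w = first_size w + 1 + (\<Sum>v<first_size w. v)"

text \<open>Accepts only pairs of graphs with equally many vertices, whose codes have equal lengths;
  every other pair is a no-instance.\<close>

definition graph_pair :: "bool list \<Rightarrow> bool" where
  "graph_pair w \<longleftrightarrow> ones_run w (second_start w) = first_size w \<and> length w = 2 * second_start w"

text \<open>\<open>p\<close> is the first position of an adjacency triangle; ordering the arguments
  and excluding equal ones makes the relation symmetric and loop-free.\<close>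

definition edge_bit :: "bool list \<Rightarrow> nat \<Rightarrow> nat \<Rightarrow> nat \<Rightarrow> bool" where
  "edge_bit w p u v \<longleftrightarrow> u \<noteq> v \<and> bit_at w (p + ((\<Sum>i<max u v. i) + min u v))"

definition word_edges :: "bool list \<Rightarrow> nat \<Rightarrow> nat set set" where
  "word_edges w p = {{u, v} |u v. u < first_size w \<and> v < first_size w \<and> edge_bit w p u v}"

lemma edge_bit_commute: "edge_bit w p u v = edge_bit w p v u"
  by (auto simp: edge_bit_def max.commute min.commute)

lemma in_word_edges:
  "u < first_size w \<Longrightarrow> v < first_size w \<Longrightarrow> {u, v} \<in> word_edges w p \<longleftrightarrow> edge_bit w p u v"
  unfolding word_edges_def using edge_bit_commute by (auto simp: doubleton_eq_iff)

lemma simple_word_edges: "simple_graph (first_size w, word_edges w p)"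
  by (auto simp: simple_graph_def word_edges_def edge_bit_def)

lemma triangle_word_edges:
  assumes "p + (\<Sum>v<first_size w. v) \<le> length w"
  shows "take (\<Sum>v<first_size w. v) (drop p w) = triangle (\<lambda>u v. {u, v} \<in> word_edges w p) (first_size w)"
proof -
  let ?N = "first_size w" let ?T = "\<Sum>v<first_size w. v" let ?xs = "take ?T (drop p w)"
  have "?xs = triangle (\<lambda>u v. ?xs ! ((\<Sum>i<v. i) + u)) ?N"
    using assms by (intro triangle_surj) simp
  also have "\<dots> = triangle (\<lambda>u v. {u, v} \<in> word_edges w p) ?N"
    unfolding triangle_eq_iff
  proof (intro allI impI)
    fix u v assume uv: "v < ?N" "u < v"
    then have "(\<Sum>i<v. i) + u < (\<Sum>i<Suc v. i)" by simp
    also have "\<dots> \<le> ?T" using uv by (intro sum_mono2) auto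
    finally have "(\<Sum>i<v. i) + u < ?T" .
    then show "?xs ! ((\<Sum>i<v. i) + u) = ({u, v} \<in> word_edges w p)"
      using uv assms by (simp add: in_word_edges edge_bit_def bit_at_def max_def min_def)
  qed
  finally show ?thesis .
qed

lemma graph_pair_decode:
  assumes "graph_pair w"
  shows "w = enc_graph (first_size w, word_edges w (first_size w + 1)) @
    enc_graph (first_size w, word_edges w (second_start w + first_size w + 1))"
proof -
  let ?N = "first_size w" let ?T = "\<Sum>v<first_size w. v" let ?p = "second_start w"
  have p: "?p = ?N + 1 + ?T" by (simp add: second_start_def)
  have r: "ones_run w ?p = ?N" and len: "length w = 2 * ?p" using assms by (auto simp: graph_pair_def)
  have "w = enc_unary ?N @ drop (?N + 1) w"
    using enc_unary_ones_run[of 0 w] len p by (simp add: first_size_def)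
  also have "drop (?N + 1) w = take ?T (drop (?N + 1) w) @ drop ?T (drop (?N + 1) w)"
    by (rule append_take_drop_id[symmetric])
  also have "drop ?T (drop (?N + 1) w) = drop ?p w" by (simp add: p add.commute)
  also have "drop ?p w = enc_unary ?N @ drop (?p + ?N + 1) w"
    using enc_unary_ones_run[of ?p w] len p r by simp
  also have "drop (?p + ?N + 1) w = take ?T (drop (?p + ?N + 1) w)"
    using len p by (intro take_all[symmetric]) simp
  also have "\<dots> = triangle (\<lambda>u v. {u, v} \<in> word_edges w (?p + ?N + 1)) ?N"
    using len p by (intro triangle_word_edges) simp
  also have "take ?T (drop (?N + 1) w) = triangle (\<lambda>u v. {u, v} \<in> word_edges w (?N + 1)) ?N"
    using len p by (intro triangle_word_edges) simp
  finally show ?thesis unfolding enc_graph_eq append_assoc .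
qed

lemma graph_pair_encode: "graph_pair (enc_graph (n, E) @ enc_graph (n, F))" (is "graph_pair ?w")
proof -
  have 1: "drop 0 ?w = enc_unary n @ (triangle (\<lambda>u v. {u, v} \<in> E) n @ enc_graph (n, F))"
    by (simp add: enc_graph_eq)
  have N: "first_size ?w = n" unfolding first_size_def by (rule ones_run_enc_unary(1)[OF 1])
  have len: "length (enc_graph (n, E)) = n + 1 + (\<Sum>v<n. v)" for E
    by (simp add: enc_graph_eq length_triangle enc_unary_def)
  have p: "second_start ?w = length (enc_graph (n, E))" by (simp add: second_start_def N len)
  have "drop (second_start ?w) ?w = enc_unary n @ triangle (\<lambda>u v. {u, v} \<in> F) n"
    unfolding p by (simp add: enc_graph_eq)
  from ones_run_enc_unary(1)[OF this] show ?thesis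
    by (simp add: graph_pair_def N) (simp add: p len)
qed

text \<open>Isomorphic graphs have equally many vertices, so the syntactic test rejects no
  yes-instance.\<close>

lemma Graph_Isomorphism_graph_pair: "w \<in> Graph_Isomorphism \<Longrightarrow> graph_pair w"
proof -
  assume "w \<in> Graph_Isomorphism"
  then obtain n E m F where w: "w = enc_graph (n, E) @ enc_graph (m, F)"
    and "graph_isomorphic (n, E) (m, F)" by (auto simp: Graph_Isomorphism_def)
  then have "n = m" using bij_betw_same_card by (fastforce simp: graph_isomorphic_def)
  then show ?thesis using w graph_pair_encode by blast
qed

definition grid_coloring :: "bool list \<Rightarrow> nat \<Rightarrow> nat list \<Rightarrow> nat" where
  "grid_coloring w p = mirror_coloring (first_size w) (word_edges w p)"

definition grid_instance :: "bool list \<Rightarrow> bool list" where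
  "grid_instance w = enc_cubes (2 * first_size w, 2, 2,
     grid_coloring w (first_size w + 1), grid_coloring w (second_start w + first_size w + 1))"

lemma grid_instance_correct:
  assumes "graph_pair w" "Q 2"
  shows "w \<in> Graph_Isomorphism \<longleftrightarrow>
    grid_instance w \<in> enc_cubes ` {(n, d, k, s1, s2) \<in> colored_cube_yes_instances. Q k}"
proof -
  let ?N = "first_size w"
  let ?E = "word_edges w (?N + 1)" and ?F = "word_edges w (second_start w + ?N + 1)"
  have "w \<in> Graph_Isomorphism \<longleftrightarrow> graph_isomorphic (?N, ?E) (?N, ?F)"
    using enc_graph_pair_mem_iff[OF simple_word_edges simple_word_edges, of w "?N + 1" w "second_start w + ?N + 1"]
      graph_pair_decode[OF assms(1)] by simp
  also have "\<dots> \<longleftrightarrow> colored_cubes_isomorphic (2 * ?N) 2 (mirror_coloring ?N ?E) (mirror_coloring ?N ?F)"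
    using graph_isomorphic_if_cubes_isomorphic[OF simple_word_edges simple_word_edges]
      cubes_isomorphic_if_graph_isomorphic by blast
  finally show ?thesis
    unfolding grid_instance_def enc_cubes_mem_iff grid_coloring_def
    using assms(2) by (auto simp: mirror_coloring_def)
qed

text \<open>The first coordinate runs in the inner loop, in accordance with the order of
  \<open>List.n_lists\<close>.\<close>

lemma enc_coloring_2:
  "enc_coloring n 2 s = concat (map (\<lambda>j. concat (map (\<lambda>i. enc_binary (s [i, j])) [0..<n])) [0..<n])"
proof -
  have "List.n_lists 2 [0..<n] = concat (map (\<lambda>j. map (\<lambda>i. [i, j]) [0..<n]) [0..<n])"
    by (simp add: numeral_2_eq_2 comp_def)
  moreover have "concat (concat xss) = concat (map concat xss)" for xss :: "bool list list list"
    by (induction xss) auto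
  ultimately show ?thesis by (simp add: enc_coloring_def map_concat comp_def)
qed

lemma enc_binary_small:
  "enc_binary 2 = [True, False, True, True, False]"
  "enc_binary (of_bool b) = (if b then [True, True, False] else [False])"
  by (auto simp: enc_binary.simps)

lemma enc_grid_coloring:
  "enc_coloring (2 * first_size w) 2 (grid_coloring w p) =
    concat (map (\<lambda>j. concat (map (\<lambda>i.
      if edge_bit w p (mirror (2 * first_size w) i) (mirror (2 * first_size w) j)
      then [True, True, False] else [False]) [0..<2 * first_size w])) [0..<2 * first_size w])"
  unfolding enc_coloring_2
  by (intro arg_cong[where f = concat] map_cong refl)
    (simp add: grid_coloring_def mirror_coloring_def enc_binary_small in_word_edges mirror_less)

lemma pnum_first_size: "input \<Gamma> W \<Longrightarrow> pnum \<Gamma> (\<lambda>x. first_size (W x))"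
  unfolding first_size_def by (intro pnum_ones_run num_const)

lemma pnum_second_start:
  assumes "input \<Gamma> W"
  shows "pnum \<Gamma> (\<lambda>x. second_start (W x))"
  unfolding second_start_def
  by (intro pnum_add pnum_sum pnum_const pnum_var pnum_first_size assms)

lemma decides_graph_pair: "decides word_ctx graph_pair"
  unfolding graph_pair_def[abs_def]
  by (intro decides_conj decides_peq pnum_ones_run pnum_num[OF pnum_second_start] pnum_second_start
      pnum_first_size pnum_length pnum_mult pnum_const input_word_ctx)

lemma decides_edge_bit:
  assumes "input \<Gamma> W" "num \<Gamma> p" "pnum \<Gamma> u" "pnum \<Gamma> v"
  shows "decides \<Gamma> (\<lambda>x. edge_bit (W x) (p x) (u x) (v x))"
  unfolding edge_bit_def
  by (intro decides_conj decides_not decides_peq decides_bit_at num_add pnum_num[OF pnum_sum]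
      pnum_num[OF pnum_min] pnum_max pnum_var pnum_num[OF assms(4)] assms)

lemma pnum_mirror: "pnum \<Gamma> n \<Longrightarrow> pnum \<Gamma> i \<Longrightarrow> pnum \<Gamma> (\<lambda>x. mirror (n x) (i x))"
  unfolding mirror_def by (intro pnum_min pnum_num[OF pnum_pdiff] pnum_pdiff pnum_const)

lemma emits_enc_grid_coloring:
  assumes "input \<Gamma> W" "num \<Gamma> p"
  shows "emits \<Gamma> (\<lambda>x. enc_coloring (2 * first_size (W x)) 2 (grid_coloring (W x) (p x)))"
  unfolding enc_grid_coloring
  by (intro emits_concat emits_if emits_Cons emits_Nil decides_const decides_edge_bit pnum_mirror
      pnum_mult pnum_const pnum_first_size pnum_var pnum_weaken input_ext num_weaken assms)

lemma emits_grid_instance: "emits word_ctx grid_instance"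
  unfolding grid_instance_def[abs_def] enc_cubes_def case_prod_conv enc_binary_small
  by (intro emits_append emits_enc_unary emits_Cons emits_Nil decides_const emits_enc_grid_coloring
      pnum_mult pnum_const pnum_first_size input_word_ctx num_add pnum_num[OF pnum_first_size]
      pnum_num[OF pnum_second_start] num_const)

lemma Graph_Isomorphism_reducible_to_cubes:
  assumes "Q 2"
  shows "Graph_Isomorphism \<le>\<^sub>p enc_cubes ` {(n, d, k, s1, s2) \<in> colored_cube_yes_instances. Q k}"
  using decides_graph_pair emits_restr[OF emits_grid_instance] Graph_Isomorphism_graph_pair
    grid_instance_correct[of _ Q, OF _ assms] Nil_notin_enc_cubes
  by (rule reducibleI)

section \<open>From pairs of colored cubes to pairs of graphs\<close>

definition side :: "bool list \<Rightarrow> nat" where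
  "side w = ones_run w 0"

definition dimension :: "bool list \<Rightarrow> nat" where
  "dimension w = ones_run w (side w + 1)"

definition bound_pos :: "bool list \<Rightarrow> nat" where
  "bound_pos w = side w + 1 + dimension w + 1"

definition colors_pos :: "bool list \<Rightarrow> nat" where
  "colors_pos w = code_end w (bound_pos w)"

definition color :: "bool list \<Rightarrow> nat \<Rightarrow> nat" where
  "color w i = code_value w (code_pos w (colors_pos w) i)"

text \<open>The first conjunct ensures that both unary codes are terminated. The bound on the number
  of points holds for every encoding, because each color takes at least one bit, and it keeps the
  graph polynomial in the input. The scan must stop exactly at the end of the word.\<close>

definition cube_pair :: "bool list \<Rightarrow> bool" where
  "cube_pair w \<longleftrightarrow> side w + 1 + dimension w < length w \<and> code_valid w (bound_pos w) \<and>
     side w ^ dimension w \<le> length w \<and>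
     (\<forall>i<2 * side w ^ dimension w. code_valid w (code_pos w (colors_pos w) i) \<and>
        color w i < code_value w (bound_pos w)) \<and>
     code_pos w (colors_pos w) (2 * side w ^ dimension w) = length w"

lemma colors_pos_le: "code_valid w (bound_pos w) \<Longrightarrow> colors_pos w \<le> length w"
  by (simp add: code_valid_def colors_pos_def code_end_def)

lemma cube_pair_decode:
  assumes "cube_pair w"
  obtains s1 s2 where
    "w = enc_cubes (side w, dimension w, code_value w (bound_pos w), s1, s2)"
    "s1 ` cube (side w) (dimension w) \<subseteq> {..<code_value w (bound_pos w)}"
    "s2 ` cube (side w) (dimension w) \<subseteq> {..<code_value w (bound_pos w)}"
    "\<And>i. i < side w ^ dimension w \<Longrightarrow> color w i = s1 (List.n_lists (dimension w) [0..<side w] ! i)"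
    "\<And>i. i < side w ^ dimension w \<Longrightarrow>
      color w (side w ^ dimension w + i) = s2 (List.n_lists (dimension w) [0..<side w] ! i)"
proof -
  let ?n = "side w" let ?d = "dimension w" let ?k = "code_value w (bound_pos w)"
  let ?N = "?n ^ ?d" let ?L = "List.n_lists ?d [0..<?n]"
  note * = assms[unfolded cube_pair_def]
  have L: "length ?L = ?N" "distinct ?L" "set ?L = cube ?n ?d"
    by (auto simp: length_n_lists_upt distinct_n_lists set_n_lists_upt)
  have inj: "inj_on ((!) ?L) {..<?N}" using L by (auto intro!: inj_on_nth)
  \<comment> \<open>Turns the table of colors into functions on points, through the number of a
    point in the enumeration.\<close>
  define ix where "ix = the_inv_into {..<?N} ((!) ?L)"
  have ix: "ix (?L ! i) = i" if "i < ?N" for i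
    unfolding ix_def using that by (intro the_inv_into_f_f[OF inj]) simp
  define s1 where "s1 v = color w (ix v)" for v
  define s2 where "s2 v = color w (?N + ix v)" for v
  have s: "color w i = s1 (?L ! i)" "color w (?N + i) = s2 (?L ! i)" if "i < ?N" for i
    using ix[OF that] by (auto simp: s1_def s2_def)
  have cube: "\<exists>i<?N. v = ?L ! i" if "v \<in> cube ?n ?d" for v
    using that L by (metis in_set_conv_nth)
  have "drop 0 w = enc_unary ?n @ drop (0 + ?n + 1) w"
    using * enc_unary_ones_run[of 0 w] by (simp add: side_def)
  also have "drop (0 + ?n + 1) w = enc_unary ?d @ drop (bound_pos w) w"
    using * enc_unary_ones_run[of "?n + 1" w] by (simp add: dimension_def bound_pos_def)
  also have "drop (bound_pos w) w = enc_binary ?k @ drop (colors_pos w) w"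
    unfolding colors_pos_def using * by (intro enc_binary_code_value) simp
  also have "drop (colors_pos w) w = concat (map enc_binary (map (color w) [0..<2 * ?N]))"
    using codes_iff[OF colors_pos_le, of w "map (color w) [0..<2 * ?N]" "2 * ?N"] *
    by (simp add: color_def[abs_def])
  also have "map (color w) [0..<2 * ?N] = map s1 ?L @ map s2 ?L"
  proof (rule nth_equalityI)
    fix i assume "i < length (map (color w) [0..<2 * ?N])"
    then show "map (color w) [0..<2 * ?N] ! i = (map s1 ?L @ map s2 ?L) ! i"
      using s(1)[of i] s(2)[of "i - ?N"] by (auto simp: nth_append L)
  qed (simp add: L)
  finally have "w = enc_cubes (?n, ?d, ?k, s1, s2)" by (simp add: enc_cubes_eq)
  moreover have "s1 ` cube ?n ?d \<subseteq> {..<?k}"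
  proof (intro image_subsetI)
    fix v assume "v \<in> cube ?n ?d"
    then obtain i where i: "i < ?N" "v = ?L ! i" using cube by blast
    then have "color w i < ?k" using * by simp
    then show "s1 v \<in> {..<?k}" using s(1)[of i] i by simp
  qed
  moreover have "s2 ` cube ?n ?d \<subseteq> {..<?k}"
  proof (intro image_subsetI)
    fix v assume "v \<in> cube ?n ?d"
    then obtain i where i: "i < ?N" "v = ?L ! i" using cube by blast
    then have "color w (?N + i) < ?k" using * by simp
    then show "s2 v \<in> {..<?k}" using s(2)[of i] i by simp
  qed
  ultimately show ?thesis using s by (intro that[of s1 s2])
qed

lemma length_concat_enc_binary: "length cs \<le> length (concat (map enc_binary cs))"
proof (induction cs)
  case (Cons c cs)
  have "1 \<le> length (enc_binary c)" by (subst enc_binary.simps) simp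
  then show ?case using Cons by simp
qed simp

lemma cube_pair_encode:
  assumes "s1 ` cube n d \<subseteq> {..<k}" "s2 ` cube n d \<subseteq> {..<k}"
  shows "cube_pair (enc_cubes (n, d, k, s1, s2))" "code_value (enc_cubes (n, d, k, s1, s2))
    (bound_pos (enc_cubes (n, d, k, s1, s2))) = k"
proof -
  let ?L = "List.n_lists d [0..<n]"
  define w where "w = enc_cubes (n, d, k, s1, s2)"
  define cs where "cs = map s1 ?L @ map s2 ?L"
  have d0: "drop 0 w = enc_unary n @ (enc_unary d @ enc_binary k @ concat (map enc_binary cs))"
    by (simp add: w_def cs_def enc_cubes_eq)
  have n: "side w = n" unfolding side_def by (rule ones_run_enc_unary(1)[OF d0])
  have d1: "drop (side w + 1) w = enc_unary d @ (enc_binary k @ concat (map enc_binary cs))"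
    using ones_run_enc_unary(3)[OF d0] n by simp
  have d: "dimension w = d" unfolding dimension_def by (rule ones_run_enc_unary(1)[OF d1])
  have len: "side w + 1 + dimension w < length w" using ones_run_enc_unary(2)[OF d1] d by simp
  have d2: "drop (bound_pos w) w = enc_binary k @ concat (map enc_binary cs)"
    using ones_run_enc_unary(3)[OF d1] d by (simp add: bound_pos_def)
  have v: "code_valid w (bound_pos w)" and k: "code_value w (bound_pos w) = k"
    and d3: "drop (colors_pos w) w = concat (map enc_binary cs)"
    using code_of_enc_binary[OF d2] by (auto simp: colors_pos_def)
  have lcs: "length cs = 2 * n ^ d" by (simp add: cs_def length_n_lists_upt)
  have c: "\<forall>i<2 * n ^ d. code_valid w (code_pos w (colors_pos w) i)"
    "code_pos w (colors_pos w) (2 * n ^ d) = length w" "cs = map (color w) [0..<2 * n ^ d]"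
    using codes_iff[OF colors_pos_le[OF v], of cs "2 * n ^ d"] d3 lcs
    by (auto simp: color_def[abs_def])
  have "set cs \<subseteq> {..<k}" using assms by (auto simp: cs_def set_n_lists_upt)
  moreover have "color w i \<in> set cs" if "i < 2 * n ^ d" for i unfolding c(3) using that by simp
  ultimately have "color w i < k" if "i < 2 * n ^ d" for i using that by auto
  moreover have "n ^ d \<le> length w"
    using length_concat_enc_binary[of cs] lcs unfolding d3[symmetric] by simp
  ultimately have "cube_pair w"
    using len v c(1,2) by (simp add: cube_pair_def n d k)
  then show "cube_pair (enc_cubes (n, d, k, s1, s2))" "code_value (enc_cubes (n, d, k, s1, s2))
    (bound_pos (enc_cubes (n, d, k, s1, s2))) = k"
    using k by (simp_all add: w_def)
qed

definition word_collinear :: "bool list \<Rightarrow> nat \<Rightarrow> nat \<Rightarrow> nat \<Rightarrow> bool" where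
  "word_collinear w u v x \<longleftrightarrow>
     collinear (side w) (dimension w) (digit (side w) u) (digit (side w) v) (digit (side w) x)"

definition gadget_instance :: "bool list \<Rightarrow> bool list" where
  "gadget_instance w = (let N = side w ^ dimension w in
     enc_graph (gadget_size N, gadget_edges N (word_collinear w) (color w) 0) @
     enc_graph (gadget_size N, gadget_edges N (word_collinear w) (color w) N))"

lemma gadget_instance_correct:
  assumes "cube_pair w" "Q (code_value w (bound_pos w))"
  shows "w \<in> enc_cubes ` {(n, d, k, s1, s2) \<in> colored_cube_yes_instances. Q k} \<longleftrightarrow>
    gadget_instance w \<in> Graph_Isomorphism"
proof -
  let ?n = "side w" let ?d = "dimension w" let ?k = "code_value w (bound_pos w)" let ?N = "side w ^ dimension w"
  obtain s1 s2 where w: "w = enc_cubes (?n, ?d, ?k, s1, s2)"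
    and r: "s1 ` cube ?n ?d \<subseteq> {..<?k}" "s2 ` cube ?n ?d \<subseteq> {..<?k}"
    and c: "\<And>i. i < ?N \<Longrightarrow> color w i = s1 (List.n_lists ?d [0..<?n] ! i)"
      "\<And>i. i < ?N \<Longrightarrow> color w (?N + i) = s2 (List.n_lists ?d [0..<?n] ! i)"
    using cube_pair_decode[OF assms(1)] by metis
  have "w \<in> enc_cubes ` {(n, d, k, s1, s2) \<in> colored_cube_yes_instances. Q k} \<longleftrightarrow>
      enc_cubes (?n, ?d, ?k, s1, s2) \<in> enc_cubes ` {(n, d, k, s1, s2) \<in> colored_cube_yes_instances. Q k}"
    using w by simp
  also have "\<dots> \<longleftrightarrow> colored_cubes_isomorphic ?n ?d s1 s2"
    unfolding enc_cubes_mem_iff using assms(2) r by blast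
  also have "\<dots> \<longleftrightarrow> graph_isomorphic
      (gadget_size ?N, gadget_edges ?N (word_collinear w) (color w) 0)
      (gadget_size ?N, gadget_edges ?N (word_collinear w) (color w) ?N)"
    unfolding word_collinear_def[abs_def] using c by (rule cubes_isomorphic_iff_gadgets_isomorphic)
  also have "\<dots> \<longleftrightarrow> gadget_instance w \<in> Graph_Isomorphism"
    unfolding gadget_instance_def Let_def enc_graph_pair_mem_iff[OF simple_gadget simple_gadget] ..
  finally show ?thesis .
qed

lemma cube_yes_instanceD:
  assumes "w \<in> enc_cubes ` {(n, d, k, s1, s2) \<in> colored_cube_yes_instances. Q k}"
  shows "cube_pair w \<and> Q (code_value w (bound_pos w))"
  using assms cube_pair_encode by (auto simp: colored_cube_yes_instances_def)

lemma pnum_side: "input \<Gamma> W \<Longrightarrow> pnum \<Gamma> (\<lambda>x. side (W x))"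
  unfolding side_def by (intro pnum_ones_run num_const)

lemma pnum_dimension: "input \<Gamma> W \<Longrightarrow> pnum \<Gamma> (\<lambda>x. dimension (W x))"
  unfolding dimension_def by (intro pnum_ones_run num_add pnum_num[OF pnum_side] num_const)

lemma num_bound_pos: "input \<Gamma> W \<Longrightarrow> num \<Gamma> (\<lambda>x. bound_pos (W x))"
  unfolding bound_pos_def by (intro num_add pnum_num[OF pnum_side] pnum_num[OF pnum_dimension] num_const)

lemma num_colors_pos: "input \<Gamma> W \<Longrightarrow> num \<Gamma> (\<lambda>x. colors_pos (W x))"
  unfolding colors_pos_def by (intro num_code_end num_bound_pos)

lemma num_color: "input \<Gamma> W \<Longrightarrow> pnum \<Gamma> i \<Longrightarrow> num \<Gamma> (\<lambda>x. color (W x) (i x))"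
  unfolding color_def by (intro num_code_value num_code_pos num_colors_pos)

text \<open>The cap exceeds the word length by one, so the capped value is at most the length
  exactly when the power is.\<close>

lemma pnum_capped_points:
  assumes "input \<Gamma> W"
  shows "pnum \<Gamma> (\<lambda>x. min (side (W x) ^ dimension (W x)) (Suc (length (W x))))"
  by (intro pnum_min_power pnum_side pnum_dimension pnum_Suc pnum_length assms) simp

text \<open>The test is run with the capped number of points. If the cap takes effect, the
  comparison with the length fails in the original and in the capped condition alike.\<close>

lemma decides_cube_pair: "decides word_ctx cube_pair"
proof (rule decides_cong)
  let ?C = "\<lambda>w. min (side w ^ dimension w) (Suc (length w))"
  note i = input_word_ctx
  note C = pnum_capped_points[OF i]
  have C2: "pnum word_ctx (\<lambda>w. 2 * ?C w)" by (intro pnum_mult pnum_const C)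
  let ?\<Delta> = "ext word_ctx (\<lambda>w. {..<2 * ?C w})"
  have "decides word_ctx (\<lambda>w. side w + 1 + dimension w < length w)"
    by (intro decides_pless pnum_add pnum_side pnum_dimension pnum_const pnum_length i)
  moreover have "decides word_ctx (\<lambda>w. code_valid w (bound_pos w))"
    by (intro decides_code_valid num_bound_pos i)
  moreover have "decides word_ctx (\<lambda>w. ?C w \<le> length w)"
    by (intro decides_ple C pnum_length i)
  moreover have "decides word_ctx (\<lambda>w. \<forall>i<2 * ?C w. code_valid w (code_pos w (colors_pos w) i) \<and>
        color w i < code_value w (bound_pos w))"
  proof (rule decides_all[OF C2 decides_conj])
    show "decides ?\<Delta> (\<lambda>p. code_valid (fst p) (code_pos (fst p) (colors_pos (fst p)) (snd p)))"
      by (intro decides_code_valid num_code_pos num_colors_pos input_ext i pnum_var C2)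
    show "decides ?\<Delta> (\<lambda>p. color (fst p) (snd p) < code_value (fst p) (bound_pos (fst p)))"
      by (intro decides_less num_color num_code_value num_bound_pos input_ext i pnum_var C2)
  qed
  moreover have "decides word_ctx (\<lambda>w. code_pos w (colors_pos w) (2 * ?C w) = length w)"
    by (intro decides_eq num_code_pos num_colors_pos C2 i pnum_num[OF pnum_length])
  ultimately show "decides word_ctx (\<lambda>w. side w + 1 + dimension w < length w \<and>
     code_valid w (bound_pos w) \<and> ?C w \<le> length w \<and>
     (\<forall>i<2 * ?C w. code_valid w (code_pos w (colors_pos w) i) \<and>
        color w i < code_value w (bound_pos w)) \<and>
     code_pos w (colors_pos w) (2 * ?C w) = length w)"
    by (intro decides_conj)
  show "cube_pair w \<longleftrightarrow> side w + 1 + dimension w < length w \<and> code_valid w (bound_pos w) \<and>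
     ?C w \<le> length w \<and>
     (\<forall>i<2 * ?C w. code_valid w (code_pos w (colors_pos w) i) \<and>
        color w i < code_value w (bound_pos w)) \<and>
     code_pos w (colors_pos w) (2 * ?C w) = length w" for w
  proof (cases "side w ^ dimension w \<le> length w")
    case True
    then have "?C w = side w ^ dimension w" by simp
    then show ?thesis unfolding cube_pair_def by simp
  next
    case False
    then have "\<not> ?C w \<le> length w" by simp
    then show ?thesis unfolding cube_pair_def using False by blast
  qed
qed

lemma decides_gadget_rel:
  assumes i: "input \<Gamma> W" and p: "pnum \<Gamma> N" "pnum \<Gamma> h" "pnum \<Gamma> u" "pnum \<Gamma> r" "pnum \<Gamma> z"
  shows "decides \<Gamma> (\<lambda>x. gadget_rel (N x) (word_collinear (W x)) (color (W x)) (h x) (u x) (r x) (z x))"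
proof -
  have "decides \<Gamma> (\<lambda>x. word_collinear (W x) (u x) (r x) (z x))"
    unfolding word_collinear_def by (intro decides_collinear pnum_side pnum_dimension assms)
  moreover have "decides \<Gamma> (\<lambda>x. color (W x) (r x - (N x + 2)) \<le> color (W x) (h x + u x))"
    by (intro decides_le num_color pnum_pdiff pnum_add pnum_const assms)
  moreover have "decides \<Gamma> (\<lambda>x. r x < N x)" "decides \<Gamma> (\<lambda>x. N x \<le> r x)"
    "decides \<Gamma> (\<lambda>x. z x = u x)" "decides \<Gamma> (\<lambda>x. r x < N x + 2)"
    by (intro decides_pless decides_ple decides_peq pnum_add pnum_const p)+
  ultimately show ?thesis
    unfolding gadget_rel_def by (intro decides_conj decides_disj)
qed

lemma decides_gadget_adj:
  assumes "input \<Gamma> W" "pnum \<Gamma> N" "pnum \<Gamma> h" "pnum \<Gamma> x" "pnum \<Gamma> y"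
  shows "decides \<Gamma> (\<lambda>z. gadget_adj (N z) (word_collinear (W z)) (color (W z)) (h z) (x z) (y z))"
  unfolding gadget_adj_def
  by (intro decides_conj decides_pless decides_ple decides_gadget_rel pnum_div pnum_mod pnum_pdiff
      pnum_add pnum_mult pnum_const assms)

text \<open>Points have smaller numbers than all their neighbors, so above the diagonal only one
  orientation of \<open>gadget_adj\<close> can hold.\<close>

lemma enc_gadget:
  "enc_graph (gadget_size N, gadget_edges N T c h) =
    enc_unary (gadget_size N) @ triangle (gadget_adj N T c h) (gadget_size N)"
proof -
  have "triangle (\<lambda>u v. {u, v} \<in> gadget_edges N T c h) (gadget_size N) =
      triangle (gadget_adj N T c h) (gadget_size N)"
    unfolding triangle_eq_iff
  proof (intro allI impI)
    fix u v assume uv: "v < gadget_size N" "u < v"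
    have "\<not> gadget_adj N T c h v u" using gadget_adj_less[of N T c h v u] uv by auto
    then show "({u, v} \<in> gadget_edges N T c h) = gadget_adj N T c h u v"
      using uv by (simp add: in_gadget_edges)
  qed
  then show ?thesis by (simp add: enc_graph_eq)
qed

lemma emits_enc_gadget:
  assumes "input \<Gamma> W" "pnum \<Gamma> N" "pnum \<Gamma> h"
  shows "emits \<Gamma> (\<lambda>x. enc_graph (gadget_size (N x),
    gadget_edges (N x) (word_collinear (W x)) (color (W x)) (h x)))"
proof -
  have M: "pnum \<Gamma> (\<lambda>x. gadget_size (N x))"
    unfolding gadget_size_def by (intro pnum_add pnum_mult pnum_const assms)
  show ?thesis
    unfolding enc_gadget
    by (intro emits_append emits_enc_unary emits_triangle decides_gadget_adj M input_ext pnum_var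
        pnum_weaken assms)
qed

lemma cubes_reducible_to_Graph_Isomorphism:
  assumes "decides word_ctx (\<lambda>w. Q (code_value w (bound_pos w)))"
  shows "enc_cubes ` {(n, d, k, s1, s2) \<in> colored_cube_yes_instances. Q k} \<le>\<^sub>p Graph_Isomorphism"
proof (rule reducibleI)
  let ?P = "\<lambda>w. cube_pair w \<and> Q (code_value w (bound_pos w))"
  show "decides word_ctx ?P" by (intro decides_conj decides_cube_pair assms)
  have i: "input (restr word_ctx ?P) (\<lambda>w. w)" by (intro input_restr input_word_ctx)
  \<comment> \<open>On accepted words the power is at most the length, so the cap is inactive and
    the plain power is polynomially bounded.\<close>
  have "pnum (restr word_ctx ?P) (\<lambda>w. side w ^ dimension w)"
    by (rule pnum_cong[OF pnum_capped_points[OF i]]) (auto simp: cube_pair_def)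
  then show "emits (restr word_ctx ?P) gadget_instance"
    unfolding gadget_instance_def[abs_def] Let_def
    by (intro emits_append emits_enc_gadget i pnum_const)
  show "?P w" if "w \<in> enc_cubes ` {(n, d, k, s1, s2) \<in> colored_cube_yes_instances. Q k}" for w
    using that by (rule cube_yes_instanceD)
  show "w \<in> enc_cubes ` {(n, d, k, s1, s2) \<in> colored_cube_yes_instances. Q k} \<longleftrightarrow>
      gadget_instance w \<in> Graph_Isomorphism" if "?P w" for w
    using gadget_instance_correct[of w Q] that by simp
qed (rule Nil_notin_Graph_Isomorphism)

theorem theorem2:
  shows "GI_complete Colored_Cube_Isomorphism \<and> GI_complete Two_Colored_Cube_Isomorphism"
proof -
  have all: "Colored_Cube_Isomorphism =
      enc_cubes ` {(n, d, k, s1, s2) \<in> colored_cube_yes_instances. True}"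
    unfolding Colored_Cube_Isomorphism_def by simp
  \<comment> \<open>For two colors the syntactic test also compares the decoded bound with 2; this
    number may be exponential, but it is only compared and never controls a loop.\<close>
  have two: "decides word_ctx (\<lambda>w. code_value w (bound_pos w) = 2)"
    by (intro decides_eq num_code_value num_bound_pos num_const input_word_ctx)
  have "GI_complete Colored_Cube_Isomorphism"
    unfolding GI_complete_def GI_def all
    using cubes_reducible_to_Graph_Isomorphism[of "\<lambda>_. True", OF decides_const]
      Graph_Isomorphism_reducible_to_cubes[of "\<lambda>_. True"] by simp
  moreover have "GI_complete Two_Colored_Cube_Isomorphism"
    unfolding GI_complete_def GI_def Two_Colored_Cube_Isomorphism_def
    using cubes_reducible_to_Graph_Isomorphism[of "\<lambda>k. k = 2", OF two]
      Graph_Isomorphism_reducible_to_cubes[of "\<lambda>k. k = 2"] by simp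
  ultimately show ?thesis by blast
qed

end
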